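(* Let $\mathbf{P}=\bigoplus_{i=1}^k\mathbf{P}_i$ be a direct sum of matrix polynomials $\mathbf{P}_i$ in $z=(z_1,\ldots,z_d)$ with coefficients in $\mathbb{C}^{\ell_i\times m_i}$, satisfying the approximation condition and the Archimedean condition stated in the context. Let $p\in\mathbb{C}[z]$ be a polynomial in $d$ variables $z=(z_1,\ldots,z_d)$ which is strongly stable on $\mathcal{D}_{\mathbf{P}}$, i.e., has no zeros in $\overline{\mathcal{D}_{\mathbf{P}}}$. Then there exist a polynomial $q\in\mathbb{C}[z]$, nonnegative integers $n_1,\ldots,n_k$, and a contractive matrix $K$ of size $\sum_{i=1}^km_in_i\times\sum_{i=1}^k\ell_in_i$ such that $$p(z)q(z)=\det(I-K\,\mathbf{P}(z)_n),\qquad\mathbf{P}(z)_n=\bigoplus_{i=1}^k(\mathbf{P}_i(z)\otimes I_{n_i}).$$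
   Context: Norms of matrices are spectral norms; contractive means norm at most $1$. If $n_i=0$, the corresponding direct summand of $\mathbf{P}(z)_n$ is void. For a matrix polynomial $Q(z)=\sum_\mu Q_\mu z^\mu$ and a $d$-tuple $T$ of commuting bounded operators on a Hilbert space, $Q(T)=\sum_\mu Q_\mu\otimes T^\mu$; also $Q^*(w):=\sum_\mu Q_\mu^*w^\mu$. Domain and operator class: $\mathcal{D}_{\mathbf{P}}=\{z\in\mathbb{C}^d:\|\mathbf{P}(z)\|<1\}$, and $\mathcal{T}_{\mathbf{P}}$ is the set of $d$-tuples $T=(T_1,\ldots,T_d)$ of commuting bounded operators on a Hilbert space satisfying $\|\mathbf{P}(T)\|<1$. Approximation condition: every $d$-tuple $T$ of commuting bounded linear operators on a Hilbert space satisfying $\|\mathbf{P}(T)\|\le1$ is a norm limit of elements of $\mathcal{T}_{\mathbf{P}}$ (on the same Hilbert space). Archimedean condition: the polynomials $I_{m_j}-\mathbf{P}_j^*(w)\mathbf{P}_j(z)$, $j=1,\ldots,k$, generate an Archimedean matrix system of Hermitian quadratic modules, that is, there is a constant $c>0$ such that for every $i=1,\ldots,d$ the polynomial $c^2-w_iz_i$ (in the commuting indeterminates $w=(w_1,\ldots,w_d)$, $z=(z_1,\ldots,z_d)$) can be written as $$H_0^*(w)H_0(z)+\sum_{j=1}^kH_j^*(w)\Big((I_{m_j}-\mathbf{P}_j^*(w)\mathbf{P}_j(z))\otimes I_{n_j}\Big)H_j(z)$$ for some $n_0,\ldots,n_k\in\mathbb{N}$ and polynomial columns $H_0\in\mathbb{C}^{n_0\times1}[z]$,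 $H_j\in\mathbb{C}^{m_jn_j\times1}[z]$ (depending on $i$; these $n_j$ are unrelated to the $n_j$ in the conclusion). In particular, $\mathcal{D}_{\mathbf{P}}$ is bounded. *)

theory Defs
  imports
    "HOL-Library.Poly_Mapping"
    "HOL-Library.Equipollence"
    "HOL-Analysis.Elementary_Topology"
    "HOL-Analysis.Finite_Cartesian_Product"
    "Jordan_Normal_Form.VS_Connect"
begin

hide_const (open) Finite_Cartesian_Product.mat Finite_Cartesian_Product.vec

section \<open>Polynomials and matrix polynomials\<close>

text \<open>
  Polynomials over the complex numbers in commuting indeterminates indexed by a type of variables;
  the library makes this type a commutative ring under convolution. The matrix polynomial
  \<open>Q(z) = \<Sum>\<mu>. Q\<^sub>\<mu> z\<^sup>\<mu>\<close> is the matrix of its polynomial entries, so that the \<open>(a, b)\<close> entry of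
  \<open>Q\<^sub>\<mu>\<close> is \<open>lookup (Q $$ (a, b)) \<mu>\<close>.
\<close>

type_synonym 'v cpoly = "('v \<Rightarrow>\<^sub>0 nat) \<Rightarrow>\<^sub>0 complex"

definition cpoly_const :: "complex \<Rightarrow> 'v cpoly"
  where "cpoly_const c = Poly_Mapping.single 0 c"

definition cpoly_var :: "'v \<Rightarrow> 'v cpoly"
  where "cpoly_var v = Poly_Mapping.single (Poly_Mapping.single v 1) 1"

definition cpoly_subst ::
    "(complex \<Rightarrow> 'r) \<Rightarrow> ('v \<Rightarrow> 'r) \<Rightarrow> 'v cpoly \<Rightarrow> 'r :: comm_ring_1"
  where "cpoly_subst \<phi> x f =
    (\<Sum>\<mu>\<in>Poly_Mapping.keys f.
      \<phi> (Poly_Mapping.lookup f \<mu>) * (\<Prod>v\<in>Poly_Mapping.keys \<mu>. x v ^ Poly_Mapping.lookup \<mu> v))"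

definition cpoly_eval :: "'d cpoly \<Rightarrow> complex ^ 'd \<Rightarrow> complex"
  where "cpoly_eval f z = cpoly_subst (\<lambda>c. c) (vec_nth z) f"

definition matpoly_eval :: "'d cpoly mat \<Rightarrow> complex ^ 'd \<Rightarrow> complex mat"
  where "matpoly_eval Q z = map_mat (\<lambda>f. cpoly_eval f z) Q"

text \<open>
  Among the indeterminates \<open>'d + 'd\<close>, \<open>Inl i\<close> stands for \<open>w\<^sub>i\<close> and \<open>Inr i\<close> for \<open>z\<^sub>i\<close>.
  Then \<open>matpoly_z Q\<close> is \<open>Q(z)\<close> and \<open>matpoly_adj_w Q\<close> is \<open>Q\<^sup>*(w) = \<Sum>\<mu>. Q\<^sub>\<mu>\<^sup>* w\<^sup>\<mu>\<close>.
\<close>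

definition matpoly_z :: "'d cpoly mat \<Rightarrow> ('d + 'd) cpoly mat"
  where "matpoly_z Q = map_mat (cpoly_subst cpoly_const (\<lambda>i. cpoly_var (Inr i))) Q"

definition matpoly_adj_w :: "'d cpoly mat \<Rightarrow> ('d + 'd) cpoly mat"
  where "matpoly_adj_w Q =
    map_mat (cpoly_subst (\<lambda>c. cpoly_const (cnj c)) (\<lambda>i. cpoly_var (Inl i))) (transpose_mat Q)"

definition kron :: "'a :: times mat \<Rightarrow> 'a mat \<Rightarrow> 'a mat"
  where "kron A B = mat (dim_row A * dim_row B) (dim_col A * dim_col B)
    (\<lambda>(i, j). A $$ (i div dim_row B, j div dim_col B) * B $$ (i mod dim_row B, j mod dim_col B))"

definition mat_direct_sum :: "nat \<Rightarrow> (nat \<Rightarrow> 'a :: zero mat) \<Rightarrow> 'a mat"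
  where "mat_direct_sum k P = diag_block_mat (map P [0..<k])"

definition amplified_sum ::
    "nat \<Rightarrow> (nat \<Rightarrow> nat) \<Rightarrow> (nat \<Rightarrow> 'a :: semiring_1 mat) \<Rightarrow> 'a mat"
  where "amplified_sum k n P = mat_direct_sum k (\<lambda>i. kron (P i) (1\<^sub>m (n i)))"

section \<open>The domain\<close>

definition l2_norm_vec :: "complex Matrix.vec \<Rightarrow> real"
  where "l2_norm_vec v = sqrt (Re (v \<bullet>c v))"

definition spectral_norm :: "complex mat \<Rightarrow> real"
  where "spectral_norm A =
    (SUP v\<in>{v \<in> carrier_vec (dim_col A). l2_norm_vec v \<le> 1}. l2_norm_vec (A *\<^sub>v v))"

definition poly_domain :: "'d :: finite cpoly mat \<Rightarrow> (complex ^ 'd) set"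
  where "poly_domain Q = {z. spectral_norm (matpoly_eval Q z) < 1}"

definition strongly_stable :: "'d :: finite cpoly \<Rightarrow> (complex ^ 'd) set \<Rightarrow> bool"
  where "strongly_stable p D \<longleftrightarrow> (\<forall>z\<in>closure D. cpoly_eval p z \<noteq> 0)"

section \<open>Operators on Hilbert spaces\<close>

text \<open>
  Statements about all Hilbert spaces need Hilbert spaces with explicit carriers. The \<open>mult\<close> and
  \<open>one\<close> fields inherited from the library's record of modules play no role.
\<close>

record 'h hilbert = "(complex, 'h) module" +
  cinner :: "'h \<Rightarrow> 'h \<Rightarrow> complex"

definition hnorm :: "'h hilbert \<Rightarrow> 'h \<Rightarrow> real"
  where "hnorm H x = sqrt (Re (cinner H x x))"

locale complex_hilbert_space = vectorspace class_ring H for H :: "'h hilbert" +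
  assumes cinner_add_left: "\<And>x y z. \<lbrakk>x \<in> carrier H; y \<in> carrier H; z \<in> carrier H\<rbrakk>
      \<Longrightarrow> cinner H (x \<oplus>\<^bsub>H\<^esub> y) z = cinner H x z + cinner H y z"
    and cinner_smult_left: "\<And>a x y. \<lbrakk>x \<in> carrier H; y \<in> carrier H\<rbrakk>
      \<Longrightarrow> cinner H (a \<odot>\<^bsub>H\<^esub> x) y = a * cinner H x y"
    and cinner_commute: "\<And>x y. \<lbrakk>x \<in> carrier H; y \<in> carrier H\<rbrakk>
      \<Longrightarrow> cinner H x y = cnj (cinner H y x)"
    and cinner_pos: "\<And>x. \<lbrakk>x \<in> carrier H; x \<noteq> \<zero>\<^bsub>H\<^esub>\<rbrakk> \<Longrightarrow> 0 < Re (cinner H x x)"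
    and complete: "\<And>X :: nat \<Rightarrow> 'h. \<lbrakk>\<And>n. X n \<in> carrier H;
        \<forall>e>0. \<exists>N. \<forall>m\<ge>N. \<forall>n\<ge>N. hnorm H (X m \<ominus>\<^bsub>H\<^esub> X n) < e\<rbrakk>
      \<Longrightarrow> \<exists>x\<in>carrier H. (\<lambda>n. hnorm H (X n \<ominus>\<^bsub>H\<^esub> x)) \<longlonglongrightarrow> 0"

definition bounded_operator :: "'h hilbert \<Rightarrow> ('h \<Rightarrow> 'h) \<Rightarrow> bool"
  where "bounded_operator H A \<longleftrightarrow>
    (\<forall>x\<in>carrier H. A x \<in> carrier H) \<and>
    (\<forall>x\<in>carrier H. \<forall>y\<in>carrier H. A (x \<oplus>\<^bsub>H\<^esub> y) = A x \<oplus>\<^bsub>H\<^esub> A y) \<and>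
    (\<forall>c. \<forall>x\<in>carrier H. A (c \<odot>\<^bsub>H\<^esub> x) = c \<odot>\<^bsub>H\<^esub> A x) \<and>
    (\<exists>C. \<forall>x\<in>carrier H. hnorm H (A x) \<le> C * hnorm H x)"

definition op_norm :: "'h hilbert \<Rightarrow> ('h \<Rightarrow> 'h) \<Rightarrow> real"
  where "op_norm H A = (SUP x\<in>{x \<in> carrier H. hnorm H x \<le> 1}. hnorm H (A x))"

definition commuting_tuple :: "'h hilbert \<Rightarrow> ('d \<Rightarrow> 'h \<Rightarrow> 'h) \<Rightarrow> bool"
  where "commuting_tuple H T \<longleftrightarrow>
    (\<forall>i. bounded_operator H (T i)) \<and>
    (\<forall>i j. \<forall>x\<in>carrier H. T i (T j x) = T j (T i x))"

text \<open>
  The factors \<open>T\<^sub>i\<close> are composed in the order of the indices, because operators that commute on the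
  carrier need not commute as functions on the whole type.
\<close>

definition monomial_op ::
    "('d :: {finite, linorder} \<Rightarrow> 'h \<Rightarrow> 'h) \<Rightarrow> ('d \<Rightarrow>\<^sub>0 nat) \<Rightarrow> 'h \<Rightarrow> 'h"
  where "monomial_op T \<mu> =
    foldr (\<lambda>i A. (T i ^^ Poly_Mapping.lookup \<mu> i) \<circ> A) (sorted_list_of_set UNIV) id"

text \<open>
  \<open>Q(T) = \<Sum>\<mu>. Q\<^sub>\<mu> \<otimes> T\<^sup>\<mu>\<close> for an \<open>r \<times> s\<close> matrix polynomial \<open>Q\<close> maps the Hilbert space
  \<open>\<complex>\<^sup>s \<otimes> H = H\<^sup>s\<close> to \<open>\<complex>\<^sup>r \<otimes> H = H\<^sup>r\<close>. An element of \<open>H\<^sup>s\<close> is given by the components \<open>h b\<close>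
  with \<open>b < s\<close>.
\<close>

definition matpoly_op ::
    "'h hilbert \<Rightarrow> 'd :: {finite, linorder} cpoly mat \<Rightarrow> ('d \<Rightarrow> 'h \<Rightarrow> 'h) \<Rightarrow> (nat \<Rightarrow> 'h) \<Rightarrow> nat \<Rightarrow> 'h"
  where "matpoly_op H Q T h a =
    (\<Oplus>\<^bsub>H\<^esub>b\<in>{..<dim_col Q}. \<Oplus>\<^bsub>H\<^esub>\<mu>\<in>Poly_Mapping.keys (Q $$ (a, b)).
      Poly_Mapping.lookup (Q $$ (a, b)) \<mu> \<odot>\<^bsub>H\<^esub> monomial_op T \<mu> (h b))"

definition hnorm_tuple :: "'h hilbert \<Rightarrow> nat \<Rightarrow> (nat \<Rightarrow> 'h) \<Rightarrow> real"
  where "hnorm_tuple H s h = sqrt (\<Sum>b<s. (hnorm H (h b))\<^sup>2)"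

definition matpoly_op_norm ::
    "'h hilbert \<Rightarrow> 'd :: {finite, linorder} cpoly mat \<Rightarrow> ('d \<Rightarrow> 'h \<Rightarrow> 'h) \<Rightarrow> real"
  where "matpoly_op_norm H Q T =
    (SUP h\<in>{h. (\<forall>b<dim_col Q. h b \<in> carrier H) \<and> hnorm_tuple H (dim_col Q) h \<le> 1}.
      hnorm_tuple H (dim_row Q) (matpoly_op H Q T h))"

definition op_class ::
    "'h hilbert \<Rightarrow> 'd :: {finite, linorder} cpoly mat \<Rightarrow> ('d \<Rightarrow> 'h \<Rightarrow> 'h) set"
  where "op_class H Q = {T. commuting_tuple H T \<and> matpoly_op_norm H Q T < 1}"

section \<open>The two conditions\<close>

text \<open>
  HOL cannot quantify over all Hilbert spaces at once, only over those whose carrier consists of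
  elements of a given type \<open>'h\<close>. If \<open>'h\<close> has at least the cardinality of the continuum, these
  include isomorphic copies of all separable Hilbert spaces; \<open>'h\<close> may be arbitrarily large.
\<close>

definition approximation_condition ::
    "'h itself \<Rightarrow> 'd :: {finite, linorder} cpoly mat \<Rightarrow> bool"
  where "approximation_condition _ Q \<longleftrightarrow>
    (\<forall>H :: 'h hilbert. complex_hilbert_space H \<longrightarrow>
      (\<forall>T. commuting_tuple H T \<and> matpoly_op_norm H Q T \<le> 1 \<longrightarrow>
        (\<exists>S :: nat \<Rightarrow> 'd \<Rightarrow> 'h \<Rightarrow> 'h. (\<forall>r. S r \<in> op_class H Q) \<and>
          (\<forall>i. (\<lambda>r. op_norm H (\<lambda>x. S r i x \<ominus>\<^bsub>H\<^esub> T i x)) \<longlonglongrightarrow> 0))))"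

definition archimedean_condition ::
    "nat \<Rightarrow> (nat \<Rightarrow> nat) \<Rightarrow> (nat \<Rightarrow> 'd cpoly mat) \<Rightarrow> bool"
  where "archimedean_condition k m P \<longleftrightarrow>
    (\<exists>c::real. c > 0 \<and> (\<forall>i::'d. \<exists>(n0::nat) (n::nat \<Rightarrow> nat) H0 H.
      H0 \<in> carrier_mat n0 1 \<and>
      (\<forall>j<k. H j \<in> carrier_mat (m j * n j) 1) \<and>
      cpoly_const (of_real (c\<^sup>2)) - cpoly_var (Inl i) * cpoly_var (Inr i) =
        (matpoly_adj_w H0 * matpoly_z H0) $$ (0, 0) +
        (\<Sum>j<k. (matpoly_adj_w (H j) *
            kron (1\<^sub>m (m j) - matpoly_adj_w (P j) * matpoly_z (P j)) (1\<^sub>m (n j)) *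
            matpoly_z (H j)) $$ (0, 0))))"

end

theory Submission
  imports Defs "HOL-Analysis.Topology_Euclidean_Space"
begin

text \<open>
  Suppose that for some \<open>c > 0\<close> the polynomial \<open>p\<^sup>*(w) p(z) - c\<^sup>2\<close> belongs to the Hermitian quadratic
  module generated by the \<open>I - P\<^sub>j\<^sup>*(w) P\<^sub>j(z)\<close>. Collect the columns of such a certificate in one column
  \<open>H\<close>. Comparing coefficients yields a contractive matrix with blocks \<open>K, B, C, D\<close> such that
  \<open>H = K P\<^sub>n H + B p\<close> and \<open>c = C P\<^sub>n H + D p\<close>; this is the lurking contraction argument
  (\<open>lurking_contraction\<close>). In other words, \<open>c / p = D + C P\<^sub>n (I - K P\<^sub>n)\<inverse> B\<close>, and Cramer's rule
  shows that \<open>p\<close> divides \<open>det (I - K P\<^sub>n)\<close> (\<open>det_of_realization\<close>).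

  The certificate (\<open>hsq_bounded_below\<close>) comes from Banach algebra theory rather than from a separation
  argument on the quadratic module. Let \<open>\<parallel>f\<parallel>\<close> be the infimum of all \<open>t > 0\<close> for which
  \<open>t\<^sup>2 - f\<^sup>*(w) f(z)\<close> belongs to the module. By the Archimedean condition this is finite, and it is a
  submultiplicative seminorm on \<open>\<complex>[z]\<close>. If \<open>1\<close> is a limit of multiples \<open>p g\<close> of \<open>p\<close>, then a bound for
  \<open>g\<close> gives the certificate. If not, Gelfand theory provides a point \<open>z\<close> with
  \<open>p(z) = 0\<close> and \<open>|f(z)| \<le> \<parallel>f\<parallel>\<close> for all \<open>f\<close> (\<open>evaluation_bounded_by_seminorm\<close>). Applied to \<open>f = u\<^sup>* P\<^sub>j v\<close>,
  this bound shows that each \<open>P\<^sub>j(z)\<close> is a contraction (\<open>evaluation_contractive\<close>). The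
  approximation condition for operators on a one-dimensional space then puts \<open>z\<close> into the
  closure of the domain (\<open>closure_poly_domain\<close>), where \<open>p\<close> has no zeros.

  The existence of spectral values (\<open>spectrum_nonempty\<close>) is proved for seminormed algebras that need not be
  complete, with approximate inverses in place of resolvents.
\<close>

hide_const (open) Finite_Cartesian_Product.mat Finite_Cartesian_Product.vec
no_notation Finite_Cartesian_Product.vec_nth (infixl "$" 90)

section \<open>Substitution into polynomials\<close>

lemma comm_ring_homI:
  fixes \<phi> :: "'a :: comm_ring_1 \<Rightarrow> 'b :: comm_ring_1"
  assumes "\<And>x y. \<phi> (x + y) = \<phi> x + \<phi> y" "\<And>x y. \<phi> (x * y) = \<phi> x * \<phi> y" "\<phi> 1 = 1"
  shows "comm_ring_hom \<phi>"
proof -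
  have "\<phi> 0 = 0"
    using assms(1)[of 0 0] by simp
  then show ?thesis
    using assms by unfold_locales auto
qed

definition monomial_val :: "('v \<Rightarrow> 'r) \<Rightarrow> ('v \<Rightarrow>\<^sub>0 nat) \<Rightarrow> 'r :: comm_ring_1"
  where "monomial_val x \<mu> =
    (\<Prod>v\<in>Poly_Mapping.keys \<mu>. x v ^ Poly_Mapping.lookup \<mu> v)"

lemma monomial_val_superset:
  assumes "finite S" "Poly_Mapping.keys \<mu> \<subseteq> S"
  shows "monomial_val x \<mu> = (\<Prod>v\<in>S. x v ^ Poly_Mapping.lookup \<mu> v)"
  unfolding monomial_val_def using assms
  by (intro prod.mono_neutral_left) (auto simp: in_keys_iff)

lemma monomial_val_0 [simp]: "monomial_val x 0 = 1"
  by (simp add: monomial_val_def)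

lemma monomial_val_var [simp]: "monomial_val x (Poly_Mapping.single v 1) = x v"
  by (simp add: monomial_val_def)

lemma monomial_val_add: "monomial_val x (\<mu> + \<nu>) = monomial_val x \<mu> * monomial_val x \<nu>"
proof -
  let ?S = "Poly_Mapping.keys \<mu> \<union> Poly_Mapping.keys \<nu>"
  have "monomial_val x (\<mu> + \<nu>) = (\<Prod>v\<in>?S. x v ^ Poly_Mapping.lookup (\<mu> + \<nu>) v)"
    by (rule monomial_val_superset) (auto simp: Poly_Mapping.keys_add)
  also have "\<dots> = (\<Prod>v\<in>?S. x v ^ Poly_Mapping.lookup \<mu> v) * (\<Prod>v\<in>?S. x v ^ Poly_Mapping.lookup \<nu> v)"
    by (simp add: lookup_add power_add prod.distrib)
  also have "\<dots> = monomial_val x \<mu> * monomial_val x \<nu>"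
    by (simp add: monomial_val_superset[of ?S])
  finally show ?thesis .
qed

lemma cpoly_subst_superset:
  assumes "finite S" "Poly_Mapping.keys f \<subseteq> S" "\<phi> 0 = 0"
  shows "cpoly_subst \<phi> x f = (\<Sum>\<mu>\<in>S. \<phi> (Poly_Mapping.lookup f \<mu>) * monomial_val x \<mu>)"
  unfolding cpoly_subst_def monomial_val_def[symmetric] using assms
  by (intro sum.mono_neutral_left) (auto simp: in_keys_iff)

lemma cpoly_subst_add:
  assumes "comm_ring_hom \<phi>"
  shows "cpoly_subst \<phi> x (f + g) = cpoly_subst \<phi> x f + cpoly_subst \<phi> x g"
proof -
  interpret comm_ring_hom \<phi> by fact
  let ?S = "Poly_Mapping.keys f \<union> Poly_Mapping.keys g"
  have "cpoly_subst \<phi> x (f + g)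
      = (\<Sum>\<mu>\<in>?S. \<phi> (Poly_Mapping.lookup (f + g) \<mu>) * monomial_val x \<mu>)"
    by (rule cpoly_subst_superset) (auto simp: Poly_Mapping.keys_add)
  also have "\<dots> = cpoly_subst \<phi> x f + cpoly_subst \<phi> x g"
    by (simp add: cpoly_subst_superset[of ?S] lookup_add hom_add distrib_right sum.distrib)
  finally show ?thesis .
qed

lemma cpoly_subst_single:
  assumes "\<phi> 0 = 0"
  shows "cpoly_subst \<phi> x (Poly_Mapping.single \<mu> c) = \<phi> c * monomial_val x \<mu>"
  using cpoly_subst_superset[of "{\<mu>}" "Poly_Mapping.single \<mu> c" \<phi> x] assms by simp

lemma poly_mapping_eq_sum_single:
  fixes f :: "'a \<Rightarrow>\<^sub>0 'b :: comm_monoid_add"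
  shows "f = (\<Sum>\<mu>\<in>Poly_Mapping.keys f. Poly_Mapping.single \<mu> (Poly_Mapping.lookup f \<mu>))"
  by (rule poly_mapping_eqI)
     (auto simp: lookup_sum lookup_single when_def in_keys_iff sum.delta)

lemma poly_mapping_single_induct [case_names single add]:
  fixes f :: "'a \<Rightarrow>\<^sub>0 'b :: comm_monoid_add"
  assumes "\<And>\<mu> c. Q (Poly_Mapping.single \<mu> c)" "\<And>f g. Q f \<Longrightarrow> Q g \<Longrightarrow> Q (f + g)"
  shows "Q f"
proof -
  have "Q 0"
    using assms(1)[of _ 0] by simp
  have "Q (\<Sum>\<mu>\<in>S. Poly_Mapping.single \<mu> (h \<mu>))" if "finite S" for S h
    using that by (induction S rule: finite_induct) (auto intro: assms \<open>Q 0\<close>)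
  then show ?thesis
    using poly_mapping_eq_sum_single[of f] finite_keys by metis
qed

lemma cpoly_subst_mult:
  assumes "comm_ring_hom \<phi>"
  shows "cpoly_subst \<phi> x (f * g) = cpoly_subst \<phi> x f * cpoly_subst \<phi> x g"
proof (induction f rule: poly_mapping_single_induct)
  interpret comm_ring_hom \<phi> by fact
  case f: (single \<mu> c)
  show ?case
  proof (induction g rule: poly_mapping_single_induct)
    case (single \<nu> d)
    show ?case
      by (simp add: mult_single cpoly_subst_single hom_mult monomial_val_add mult_ac)
  next
    case (add g h)
    then show ?case by (simp add: cpoly_subst_add[OF assms] distrib_left)
  qed
next
  case (add f h)
  then show ?case by (simp add: cpoly_subst_add[OF assms] distrib_right)
qed

lemma cpoly_subst_const:
  assumes "\<phi> 0 = 0"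
  shows "cpoly_subst \<phi> x (cpoly_const c) = \<phi> c"
  using cpoly_subst_single[of \<phi> x 0 c] assms by (simp add: cpoly_const_def)

lemma cpoly_subst_var:
  assumes "comm_ring_hom \<phi>"
  shows "cpoly_subst \<phi> x (cpoly_var v) = x v"
proof -
  interpret comm_ring_hom \<phi> by fact
  show ?thesis
    by (simp add: cpoly_var_def cpoly_subst_single del: One_nat_def)
qed

lemma comm_ring_hom_cpoly_const: "comm_ring_hom cpoly_const"
  by (rule comm_ring_homI) (simp_all add: cpoly_const_def single_add mult_single)

interpretation cpoly_const: comm_ring_hom cpoly_const
  by (rule comm_ring_hom_cpoly_const)

lemma comm_ring_hom_cpoly_const_cnj: "comm_ring_hom (\<lambda>c. cpoly_const (cnj c))"
  by (rule comm_ring_homI) (simp_all add: cpoly_const.hom_add cpoly_const.hom_mult)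

lemma comm_ring_hom_cpoly_subst:
  assumes "comm_ring_hom \<phi>"
  shows "comm_ring_hom (cpoly_subst \<phi> x)"
proof -
  interpret comm_ring_hom \<phi> by fact
  show ?thesis
    using cpoly_subst_const[of \<phi> x 1]
    by (intro comm_ring_homI cpoly_subst_add cpoly_subst_mult assms) simp
qed

lemma cpoly_var_power: "cpoly_var v ^ n = Poly_Mapping.single (Poly_Mapping.single v n) 1"
proof (induction n)
  case (Suc n)
  have "Poly_Mapping.single v 1 + Poly_Mapping.single v n = Poly_Mapping.single v (Suc n)"
    by (simp flip: single_add)
  then show ?case
    using Suc by (simp add: cpoly_var_def mult_single del: One_nat_def)
qed simp

text \<open>
  Constants and variables generate the polynomial ring, so a property that is stable under sums and
  products has to be checked on them only. Norm bounds and evaluations are compared in this way.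
\<close>

lemma cpoly_induct [case_names const var add mult]:
  fixes f :: "'v cpoly"
  assumes const: "\<And>c. Q (cpoly_const c)" and var: "\<And>v. Q (cpoly_var v)"
    and add: "\<And>f g. Q f \<Longrightarrow> Q g \<Longrightarrow> Q (f + g)" and mult: "\<And>f g. Q f \<Longrightarrow> Q g \<Longrightarrow> Q (f * g)"
  shows "Q f"
proof -
  have Q1: "Q 1"
    using const[of 1] by simp
  have pow: "Q (cpoly_var v ^ n)" for v n
    by (induction n) (auto simp: Q1 var mult)
  have mono: "Q (Poly_Mapping.single \<mu> 1)" for \<mu> :: "'v \<Rightarrow>\<^sub>0 nat"
  proof (induction \<mu> rule: poly_mapping_single_induct)
    case (single v n)
    have "Poly_Mapping.single (Poly_Mapping.single v n) 1 = (cpoly_var v :: 'v cpoly) ^ n"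
      by (simp add: cpoly_var_power)
    then show ?case using pow by simp
  next
    case (add \<mu> \<nu>)
    then show ?case
      using mult[of "Poly_Mapping.single \<mu> 1" "Poly_Mapping.single \<nu> 1"] by (simp add: mult_single)
  qed
  show ?thesis
  proof (induction f rule: poly_mapping_single_induct)
    case (single \<mu> c)
    have "Poly_Mapping.single \<mu> c = cpoly_const c * Poly_Mapping.single \<mu> 1"
      by (simp add: cpoly_const_def mult_single)
    then show ?case using mult const mono by metis
  qed (rule add)
qed

interpretation cpoly_eval: comm_ring_hom "\<lambda>f. cpoly_eval f z"
  unfolding cpoly_eval_def
  by (rule comm_ring_hom_cpoly_subst) (rule comm_ring_homI; simp)

lemma cpoly_eval_const [simp]: "cpoly_eval (cpoly_const c) z = c"
  by (simp add: cpoly_eval_def cpoly_subst_const)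

lemma cpoly_eval_var [simp]: "cpoly_eval (cpoly_var v) z = vec_nth z v"
  unfolding cpoly_eval_def by (rule cpoly_subst_var) (rule comm_ring_homI; simp)

text \<open>
  For a scalar polynomial \<open>f\<close> these are \<open>f(z)\<close>, \<open>f\<^sup>*(w)\<close> and the Hermitian square \<open>f\<^sup>*(w) f(z)\<close>, as
  polynomials in \<open>w\<close> and \<open>z\<close>.
\<close>

definition in_z :: "'d cpoly \<Rightarrow> ('d + 'd) cpoly"
  where "in_z = cpoly_subst cpoly_const (\<lambda>i. cpoly_var (Inr i))"

definition adj_w :: "'d cpoly \<Rightarrow> ('d + 'd) cpoly"
  where "adj_w = cpoly_subst (\<lambda>c. cpoly_const (cnj c)) (\<lambda>i. cpoly_var (Inl i))"

definition hsq :: "'d cpoly \<Rightarrow> ('d + 'd) cpoly"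
  where "hsq f = adj_w f * in_z f"

interpretation in_z: comm_ring_hom in_z
  unfolding in_z_def by (rule comm_ring_hom_cpoly_subst) (rule comm_ring_hom_cpoly_const)

interpretation adj_w: comm_ring_hom adj_w
  unfolding adj_w_def by (rule comm_ring_hom_cpoly_subst) (rule comm_ring_hom_cpoly_const_cnj)

lemma in_z_const [simp]: "in_z (cpoly_const c) = cpoly_const c"
  by (simp add: in_z_def cpoly_subst_const)

lemma adj_w_const [simp]: "adj_w (cpoly_const c) = cpoly_const (cnj c)"
  by (simp add: adj_w_def cpoly_subst_const)

lemma in_z_var [simp]: "in_z (cpoly_var i) = cpoly_var (Inr i)"
  unfolding in_z_def by (rule cpoly_subst_var) (rule comm_ring_hom_cpoly_const)

lemma adj_w_var [simp]: "adj_w (cpoly_var i) = cpoly_var (Inl i)"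
  unfolding adj_w_def by (rule cpoly_subst_var) (rule comm_ring_hom_cpoly_const_cnj)

lemma hsq_mult: "hsq (f * g) = hsq f * hsq g"
  by (simp add: hsq_def adj_w.hom_mult in_z.hom_mult mult_ac)

lemma hsq_const: "hsq (cpoly_const c) = cpoly_const (of_real ((cmod c)\<^sup>2))"
proof -
  have "hsq (cpoly_const c) = cpoly_const (cnj c * c)"
    by (simp add: hsq_def cpoly_const.hom_mult)
  also have "cnj c * c = of_real ((cmod c)\<^sup>2)"
    by (simp add: complex_norm_square[symmetric] mult.commute del: of_real_power)
  finally show ?thesis .
qed

section \<open>Coefficients of Hermitian squares\<close>

text \<open>
  The exponent of \<open>w\<^sup>\<mu> z\<^sup>\<nu>\<close>.
\<close>

definition wz_monomial :: "('d \<Rightarrow>\<^sub>0 nat) \<Rightarrow> ('d \<Rightarrow>\<^sub>0 nat) \<Rightarrow> ('d + 'd \<Rightarrow>\<^sub>0 nat)"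
  where "wz_monomial \<mu> \<nu> =
    (\<Sum>v\<in>Poly_Mapping.keys \<mu>. Poly_Mapping.single (Inl v) (Poly_Mapping.lookup \<mu> v)) +
    (\<Sum>v\<in>Poly_Mapping.keys \<nu>. Poly_Mapping.single (Inr v) (Poly_Mapping.lookup \<nu> v))"

lemma lookup_wz_monomial:
  "Poly_Mapping.lookup (wz_monomial \<mu> \<nu>) (Inl v) = Poly_Mapping.lookup \<mu> v"
  "Poly_Mapping.lookup (wz_monomial \<mu> \<nu>) (Inr v) = Poly_Mapping.lookup \<nu> v"
  by (auto simp: wz_monomial_def lookup_add lookup_sum lookup_single when_def in_keys_iff sum.delta)

lemma wz_monomial_eq_iff: "wz_monomial \<mu> \<nu> = wz_monomial \<mu>' \<nu>' \<longleftrightarrow> \<mu> = \<mu>' \<and> \<nu> = \<nu>'"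
proof
  assume eq: "wz_monomial \<mu> \<nu> = wz_monomial \<mu>' \<nu>'"
  show "\<mu> = \<mu>' \<and> \<nu> = \<nu>'"
  proof
    show "\<mu> = \<mu>'"
      by (rule poly_mapping_eqI) (metis eq lookup_wz_monomial(1))
    show "\<nu> = \<nu>'"
      by (rule poly_mapping_eqI) (metis eq lookup_wz_monomial(2))
  qed
qed simp

lemma prod_single_one:
  "(\<Prod>i\<in>S. Poly_Mapping.single (g i) (1 :: 'b :: comm_semiring_1)) =
    Poly_Mapping.single (\<Sum>i\<in>S. g i :: 'a :: comm_monoid_add) 1"
  by (induction S rule: infinite_finite_induct) (simp_all add: mult_single)

lemma monomial_val_cpoly_var:
  "monomial_val (\<lambda>v. cpoly_var (\<sigma> v)) \<mu> =
    Poly_Mapping.single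
      (\<Sum>v\<in>Poly_Mapping.keys \<mu>. Poly_Mapping.single (\<sigma> v) (Poly_Mapping.lookup \<mu> v)) 1"
  by (simp add: monomial_val_def cpoly_var_power prod_single_one)

text \<open>
  Distinct pairs \<open>(\<mu>, \<nu>)\<close> give distinct monomials \<open>w\<^sup>\<mu> z\<^sup>\<nu>\<close>. Therefore an identity between sums of
  Hermitian squares says that the coefficient vectors have equal Gram matrices; this is what
  treating \<open>w\<close> as an indeterminate independent of \<open>z\<close> buys.
\<close>

lemma lookup_adj_w_times_in_z:
  "Poly_Mapping.lookup (adj_w f * in_z g) (wz_monomial \<mu> \<nu>) =
    cnj (Poly_Mapping.lookup f \<mu>) * Poly_Mapping.lookup g \<nu>"
proof -
  have "adj_w f * in_z g = (\<Sum>\<mu>\<in>Poly_Mapping.keys f. \<Sum>\<nu>\<in>Poly_Mapping.keys g.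
      Poly_Mapping.single (wz_monomial \<mu> \<nu>)
        (cnj (Poly_Mapping.lookup f \<mu>) * Poly_Mapping.lookup g \<nu>))"
    unfolding adj_w_def in_z_def cpoly_subst_def monomial_val_def[symmetric]
      monomial_val_cpoly_var
    by (simp add: sum_product cpoly_const_def mult_single wz_monomial_def)
  then have "Poly_Mapping.lookup (adj_w f * in_z g) (wz_monomial \<mu> \<nu>) =
      (\<Sum>\<mu>'\<in>Poly_Mapping.keys f. \<Sum>\<nu>'\<in>Poly_Mapping.keys g.
        if \<nu>' = \<nu> then (if \<mu>' = \<mu> then cnj (Poly_Mapping.lookup f \<mu>) * Poly_Mapping.lookup g \<nu> else 0)
        else 0)"
    by (auto simp: lookup_sum lookup_single wz_monomial_eq_iff when_def intro!: sum.cong)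
  also have "\<dots> = cnj (Poly_Mapping.lookup f \<mu>) * Poly_Mapping.lookup g \<nu>"
    by (cases "Poly_Mapping.lookup g \<nu> = 0") (simp_all add: sum.delta in_keys_iff)
  finally show ?thesis .
qed

section \<open>A Gelfand--Mazur theorem for seminormed algebras\<close>

locale submult_seminorm = scalar: comm_ring_hom \<iota>
  for \<iota> :: "complex \<Rightarrow> 'a :: comm_ring_1" +
  fixes N :: "'a \<Rightarrow> real"
  assumes add: "N (f + g) \<le> N f + N g"
    and mult: "N (f * g) \<le> N f * N g"
    and scale: "N (\<iota> c * f) = cmod c * N f"
begin

lemma zero: "N 0 = 0"
  using scale[of 0 0] by simp

lemma minus: "N (- f) = N f"
  using scale[of "-1" f] by (simp add: scalar.hom_uminus)

lemma diff: "N (f - g) \<le> N f + N g"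
  using add[of f "- g"] by (simp add: minus)

lemma diff_commute: "N (f - g) = N (g - f)"
  using minus[of "f - g"] by simp

lemma nonneg: "0 \<le> N f"
  using diff[of f f] by (simp add: zero)

lemma const: "N (\<iota> c) = cmod c * N 1"
  using scale[of c 1] by simp

lemma one_ge: "1 \<le> N 1" if "N 1 \<noteq> 0"
proof -
  have "N 1 * 1 \<le> N 1 * N 1"
    using mult[of 1 1] by simp
  then show ?thesis
    using that nonneg[of 1] by (metis antisym_conv1 mult_le_cancel_left_pos)
qed

lemma sum_le: "N (\<Sum>i\<in>S. f i) \<le> (\<Sum>i\<in>S. N (f i))"
proof (induction S rule: infinite_finite_induct)
  case (insert i S)
  then show ?case using add[of "f i" "sum f S"] by simp
qed (simp_all add: zero)

lemma power_le: "N (f ^ n) \<le> N 1 * N f ^ n"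
proof (induction n)
  case (Suc n)
  have "N (f ^ Suc n) \<le> N f * N (f ^ n)"
    using mult by simp
  also have "\<dots> \<le> N f * (N 1 * N f ^ n)"
    by (intro mult_left_mono Suc nonneg)
  finally show ?case by (simp add: mult_ac)
qed simp

end

text \<open>
  A relation \<open>B f t\<close>, to be read as \<open>t\<close> is an upper bound for the norm of \<open>f\<close>, is often easier to
  define than the norm. Both the norm given by the Hermitian quadratic module and the quotient norms
  arise from such a relation.
\<close>

lemma submult_seminorm_Inf:
  fixes \<iota> :: "complex \<Rightarrow> 'a :: comm_ring_1"
  assumes \<iota>: "comm_ring_hom \<iota>"
    and pos: "\<And>f t. B f t \<Longrightarrow> 0 < t"
    and ex: "\<And>f. \<exists>t. B f t"
    and add: "\<And>f g s t. B f s \<Longrightarrow> B g t \<Longrightarrow> B (f + g) (s + t)"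
    and mult: "\<And>f g s t. B f s \<Longrightarrow> B g t \<Longrightarrow> B (f * g) (s * t)"
    and scale: "\<And>f t c. B f t \<Longrightarrow> c \<noteq> 0 \<Longrightarrow> B (\<iota> c * f) (cmod c * t)"
    and zero: "\<And>t. 0 < t \<Longrightarrow> B 0 t"
  shows "submult_seminorm \<iota> (\<lambda>f. Inf {t. B f t})"
proof -
  interpret \<iota>: comm_ring_hom \<iota> by fact
  let ?N = "\<lambda>f. Inf {t. B f t}"
  have bdd: "bdd_below {t. B f t}" for f
    using pos by (intro bdd_belowI[of _ 0]) (auto intro: less_imp_le)
  have N_le: "?N f \<le> t" if "B f t" for f t
    using that by (intro cInf_lower bdd) auto
  have le_N: "r \<le> ?N f" if "\<And>t. B f t \<Longrightarrow> r \<le> t" for f r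
    using that ex by (intro cInf_greatest) auto
  have nonneg: "0 \<le> ?N f" for f
    using pos by (intro le_N) (auto intro: less_imp_le)
  have scale_le: "?N (\<iota> c * f) \<le> cmod c * ?N f" if "c \<noteq> 0" for c f
  proof -
    have "?N (\<iota> c * f) / cmod c \<le> ?N f"
      using that N_le[OF scale] by (intro le_N) (simp add: field_simps)
    then show ?thesis using that by (simp add: field_simps)
  qed
  show ?thesis
  proof
    fix f g
    have "?N (f + g) - s \<le> ?N g" if "B f s" for s
      using N_le[OF add[OF that]] by (intro le_N) (simp add: diff_le_eq add.commute[of _ s])
    then have "?N (f + g) - ?N g \<le> ?N f"
      by (intro le_N) (simp add: algebra_simps)
    then show "?N (f + g) \<le> ?N f + ?N g" by simp
  next
    fix f g
    have *: "?N (f * g) \<le> s * ?N g" if "B f s" for s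
    proof -
      have "?N (f * g) / s \<le> ?N g"
        using N_le[OF mult[OF that]] pos[OF that]
        by (intro le_N) (simp add: pos_divide_le_eq mult.commute[of _ s])
      then show ?thesis using pos[OF that] by (simp add: pos_divide_le_eq mult.commute[of _ s])
    qed
    show "?N (f * g) \<le> ?N f * ?N g"
    proof (cases "?N g = 0")
      case True
      then show ?thesis using * ex[of f] by auto
    next
      case False
      then have g: "0 < ?N g" using nonneg[of g] by simp
      then have "?N (f * g) / ?N g \<le> ?N f"
        using * by (intro le_N) (simp add: field_simps)
      then show ?thesis using g by (simp add: field_simps)
    qed
  next
    fix c f
    show "?N (\<iota> c * f) = cmod c * ?N f"
    proof (cases "c = 0")
      case True
      have "?N 0 \<le> 0"
      proof (rule field_le_epsilon)
        fix e :: real assume "0 < e"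
        then show "?N 0 \<le> 0 + e" using N_le[OF zero, of e] by simp
      qed
      with True show ?thesis using nonneg[of 0] by simp
    next
      case False
      have "\<iota> (1 / c) * (\<iota> c * f) = \<iota> (1 / c * c) * f"
        by (simp only: \<iota>.hom_mult mult.assoc)
      then have "f = \<iota> (1 / c) * (\<iota> c * f)"
        using False by simp
      then have "?N f \<le> cmod (1 / c) * ?N (\<iota> c * f)"
        using scale_le[of "1 / c" "\<iota> c * f"] False by simp
      then have "cmod c * ?N f \<le> ?N (\<iota> c * f)"
        using False by (simp add: norm_divide field_simps)
      then show ?thesis using scale_le[OF False, of f] by simp
    qed
  qed
qed

definition quotient_seminorm :: "('a :: comm_ring_1 \<Rightarrow> real) \<Rightarrow> 'a \<Rightarrow> 'a \<Rightarrow> real"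
  where "quotient_seminorm N x f = Inf {t. \<exists>g. N (f - x * g) < t}"

context submult_seminorm
begin

lemma submult_seminorm_quotient: "submult_seminorm \<iota> (quotient_seminorm N x)"
  unfolding quotient_seminorm_def
proof (rule submult_seminorm_Inf)
  show "comm_ring_hom \<iota>" by unfold_locales
next
  fix f t assume "\<exists>g. N (f - x * g) < t"
  then show "0 < t" using nonneg le_less_trans by blast
next
  fix f
  show "\<exists>t. \<exists>g. N (f - x * g) < t"
    using gt_ex by blast
next
  fix f g s t assume "\<exists>h. N (f - x * h) < s" "\<exists>h. N (g - x * h) < t"
  then obtain a b where ab: "N (f - x * a) < s" "N (g - x * b) < t" by blast
  have "f + g - x * (a + b) = (f - x * a) + (g - x * b)"
    by (simp add: algebra_simps)
  then have "N (f + g - x * (a + b)) < s + t"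
    using add[of "f - x * a" "g - x * b"] ab by (simp only:)
  then show "\<exists>h. N (f + g - x * h) < s + t" by blast
next
  fix f g s t assume "\<exists>h. N (f - x * h) < s" "\<exists>h. N (g - x * h) < t"
  then obtain a b where ab: "N (f - x * a) < s" "N (g - x * b) < t" by blast
  have "f * g - x * (a * g + b * f - x * a * b) = (f - x * a) * (g - x * b)"
    by (simp add: algebra_simps)
  moreover have "N (f - x * a) * N (g - x * b) < s * t"
    using ab nonneg by (intro mult_strict_mono') auto
  ultimately have "N (f * g - x * (a * g + b * f - x * a * b)) < s * t"
    using mult[of "f - x * a" "g - x * b"] by simp
  then show "\<exists>h. N (f * g - x * h) < s * t" by blast
next
  fix f t and c :: complex assume "\<exists>h. N (f - x * h) < t" and c: "c \<noteq> 0"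
  then obtain a where a: "N (f - x * a) < t" by blast
  have "\<iota> c * f - x * (\<iota> c * a) = \<iota> c * (f - x * a)"
    by (simp add: algebra_simps)
  then have "N (\<iota> c * f - x * (\<iota> c * a)) < cmod c * t"
    using a c by (simp add: scale)
  then show "\<exists>h. N (\<iota> c * f - x * h) < cmod c * t" by blast
next
  fix t :: real assume "0 < t"
  then have "N (0 - x * 0) < t" by (simp add: zero)
  then show "\<exists>h. N (0 - x * h) < t" by blast
qed

lemma quotient_seminorm_lessD:
  assumes "quotient_seminorm N x f < t"
  shows "\<exists>g. N (f - x * g) < t"
proof -
  have "{t. \<exists>g. N (f - x * g) < t} \<noteq> {}"
    using gt_ex by blast
  from cInf_lessD[OF this assms[unfolded quotient_seminorm_def]]
  obtain s g where "s < t" "N (f - x * g) < s" by blast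
  then show ?thesis by (blast intro: less_trans)
qed

lemma quotient_seminorm_le: "quotient_seminorm N x f \<le> N (f - x * g)"
proof (rule field_le_epsilon)
  fix e :: real assume "0 < e"
  then have "N (f - x * g) < N (f - x * g) + e" by simp
  moreover have "bdd_below {t. \<exists>g. N (f - x * g) < t}"
    using nonneg by (intro bdd_belowI[of _ 0]) (auto intro: order.trans less_imp_le)
  ultimately show "quotient_seminorm N x f \<le> N (f - x * g) + e"
    unfolding quotient_seminorm_def by (intro cInf_lower) blast+
qed

lemma quotient_seminorm_self: "quotient_seminorm N x x = 0"
proof -
  interpret q: submult_seminorm \<iota> "quotient_seminorm N x"
    by (rule submult_seminorm_quotient)
  show ?thesis
    using quotient_seminorm_le[of x x 1] q.nonneg[of x] by (simp add: zero)
qed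

end

lemma sum_root_of_unity_powers:
  assumes "0 < j" "j < n"
  shows "(\<Sum>k<n. cis (2 * pi * real k / real n) ^ j) = 0"
proof -
  define \<omega> where "\<omega> = cis (2 * pi * real j / real n)"
  have "\<omega> \<noteq> 1"
  proof
    assume "\<omega> = 1"
    then have "cis (2 * pi * real j / real n) = cis (2 * pi * real 0 / real n)"
      by (simp add: \<omega>_def)
    moreover have "inj_on (\<lambda>k. cis (2 * pi * real k / real n)) {..<n}"
      using bij_betw_roots_unity[of n] assms by (simp add: bij_betw_def)
    ultimately show False
      using assms by (auto dest: inj_onD[of _ _ j 0])
  qed
  have "(\<Sum>k<n. cis (2 * pi * real k / real n) ^ j) = (\<Sum>k<n. \<omega> ^ k)"
    by (intro sum.cong) (simp_all add: \<omega>_def DeMoivre mult_ac)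
  also have "\<dots> = (\<omega> ^ n - 1) / (\<omega> - 1)"
    using \<open>\<omega> \<noteq> 1\<close> by (rule geometric_sum)
  also have "\<omega> ^ n = cis (2 * pi * real j)"
    using assms by (simp add: \<omega>_def DeMoivre)
  also have "\<dots> = 1"
    by simp
  finally show ?thesis by simp
qed

context submult_seminorm
begin

text \<open>
  A single coarse approximate inverse of \<open>x - \<zeta>\<close> serves all points near \<open>\<zeta>\<close> and controls the norm of
  every finer one. Compactness of \<open>K\<close> then gives a bound that is uniform in the point and in the
  precision. It replaces the continuity of the resolvent in a completion of the algebra.
\<close>

lemma approx_inverses_bounded:
  assumes one: "N 1 \<noteq> 0" and K: "compact K"
    and inv: "\<And>\<zeta> \<eta>. \<zeta> \<in> K \<Longrightarrow> 0 < \<eta> \<Longrightarrow> \<exists>g. N (1 - (x - \<iota> \<zeta>) * g) < \<eta>"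
  obtains B where "0 < B"
    "\<And>\<zeta> \<eta>. \<zeta> \<in> K \<Longrightarrow> 0 < \<eta> \<Longrightarrow> \<exists>g. N (1 - (x - \<iota> \<zeta>) * g) < \<eta> \<and> N g \<le> B"
proof -
  have "\<exists>g. N (1 - (x - \<iota> \<zeta>) * g) < 1 / 4" if "\<zeta> \<in> K" for \<zeta>
    using inv[OF that, of "1 / 4"] by simp
  then obtain g where g: "\<And>\<zeta>. \<zeta> \<in> K \<Longrightarrow> N (1 - (x - \<iota> \<zeta>) * g \<zeta>) < 1 / 4" by metis
  define r where "r \<zeta> = 1 / (4 * (N (g \<zeta>) + 1))" for \<zeta>
  have r: "0 < r \<zeta>" for \<zeta>
    using nonneg[of "g \<zeta>"] by (simp add: r_def add_nonneg_pos)
  have near: "N (1 - (x - \<iota> \<mu>) * g \<zeta>) < 1 / 2" if "\<zeta> \<in> K" "dist \<zeta> \<mu> < r \<zeta>" for \<zeta> \<mu>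
  proof -
    have eq: "1 - (x - \<iota> \<mu>) * g \<zeta> = (1 - (x - \<iota> \<zeta>) * g \<zeta>) + \<iota> (\<mu> - \<zeta>) * g \<zeta>"
      by (simp add: scalar.hom_minus algebra_simps)
    have "N (\<iota> (\<mu> - \<zeta>) * g \<zeta>) \<le> 1 / 4"
    proof -
      have "N (\<iota> (\<mu> - \<zeta>) * g \<zeta>) \<le> r \<zeta> * N (g \<zeta>)"
        unfolding scale using that(2) nonneg[of "g \<zeta>"]
        by (intro mult_right_mono) (auto simp: dist_norm norm_minus_commute)
      also have "\<dots> \<le> 1 / 4"
        using nonneg[of "g \<zeta>"] by (simp add: r_def field_simps add_nonneg_pos)
      finally show ?thesis .
    qed
    then show ?thesis
      unfolding eq
      using add[of "1 - (x - \<iota> \<zeta>) * g \<zeta>" "\<iota> (\<mu> - \<zeta>) * g \<zeta>"] g[OF that(1)] by linarith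
  qed
  have "K \<subseteq> (\<Union>\<zeta>\<in>K. ball \<zeta> (r \<zeta>))"
    using r by (auto intro: UN_I centre_in_ball[THEN iffD2])
  then obtain D where D: "D \<subseteq> K" "finite D" "K \<subseteq> (\<Union>\<zeta>\<in>D. ball \<zeta> (r \<zeta>))"
    using compactE_image[OF K, of K "\<lambda>\<zeta>. ball \<zeta> (r \<zeta>)"] by auto
  define B where "B = 4 * (\<Sum>\<zeta>\<in>D. N (g \<zeta>)) + 1"
  have B: "4 * N (g \<zeta>) \<le> B" if "\<zeta> \<in> D" for \<zeta>
    using member_le_sum[OF that, of "\<lambda>\<zeta>. N (g \<zeta>)"] D nonneg by (simp add: B_def)
  show ?thesis
  proof
    show "0 < B"
      unfolding B_def using sum_nonneg[of D "\<lambda>\<zeta>. N (g \<zeta>)"] nonneg by simp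
  next
    fix \<mu> \<eta> assume \<mu>: "\<mu> \<in> K" and \<eta>: "0 < (\<eta> :: real)"
    then obtain \<zeta> where \<zeta>: "\<zeta> \<in> D" "dist \<zeta> \<mu> < r \<zeta>"
      using D by auto
    obtain h where h: "N (1 - (x - \<iota> \<mu>) * h) < min \<eta> 1"
      using inv[OF \<mu>, of "min \<eta> 1"] \<eta> by auto
    let ?a = "1 - (x - \<iota> \<mu>) * g \<zeta>" and ?e = "1 - (x - \<iota> \<mu>) * h"
    \<comment> \<open>Comparing \<open>h\<close> with \<open>g \<zeta>\<close>, a coarse inverse whose error \<open>?a\<close> is at most one half, bounds \<open>h\<close>
      independently of \<open>\<eta>\<close>.\<close>
    have "h = g \<zeta> + h * ?a - g \<zeta> * ?e"
      by (simp add: algebra_simps)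
    then have "N h \<le> N (g \<zeta>) + N (h * ?a) + N (g \<zeta> * ?e)"
      using diff[of "g \<zeta> + h * ?a" "g \<zeta> * ?e"] add[of "g \<zeta>" "h * ?a"] by simp
    also have "\<dots> \<le> N (g \<zeta>) + N h * (1 / 2) + N (g \<zeta>) * 1"
    proof -
      have "N ?a \<le> 1 / 2" "N ?e \<le> 1"
        using near[of \<zeta> \<mu>] \<zeta> D(1) h by auto
      then have "N h * N ?a \<le> N h * (1 / 2)" and "N (g \<zeta>) * N ?e \<le> N (g \<zeta>) * 1"
        by (simp_all only: mult_left_mono nonneg)
      then show ?thesis
        using mult[of h ?a] mult[of "g \<zeta>" ?e] by linarith
    qed
    finally have "N h \<le> 4 * N (g \<zeta>)" by simp
    then show "\<exists>g. N (1 - (x - \<iota> \<mu>) * g) < \<eta> \<and> N g \<le> B"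
      using h B[OF \<zeta>(1)] by auto
  qed
qed

text \<open>
  The averages of \<open>\<zeta> (\<zeta> - x)\<inverse>\<close> over the vertices of a regular \<open>n\<close>-gon of radius \<open>\<rho>\<close> equal
  \<open>(1 - (x / \<rho>)\<^sup>n)\<inverse>\<close>, since the powers of the roots of unity average to zero. The lemma is the
  version of this for approximate inverses. The Lipschitz constant in \<open>\<rho>\<close> does not depend on \<open>n\<close>;
  this is the point of averaging.
\<close>

lemma approx_resolvent_average:
  assumes B: "0 < B" and R: "0 \<le> R"
    and inv: "\<And>\<zeta> \<eta>. cmod \<zeta> \<le> R \<Longrightarrow> 0 < \<eta> \<Longrightarrow> \<exists>g. N (1 - (x - \<iota> \<zeta>) * g) < \<eta> \<and> N g \<le> B"
    and n: "0 < n" and \<epsilon>: "0 < \<epsilon>"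
  shows "\<exists>a. \<forall>\<rho> \<sigma>. 0 \<le> \<rho> \<longrightarrow> \<rho> \<le> R \<longrightarrow> 0 \<le> \<sigma> \<longrightarrow> \<sigma> \<le> R \<longrightarrow>
    N (a \<rho> * (\<iota> (of_real (\<rho> ^ n)) - x ^ n) - \<iota> (of_real (\<rho> ^ n))) \<le> \<epsilon> \<and>
    N (a \<rho> - a \<sigma>) \<le> (B + R * B\<^sup>2) * \<bar>\<rho> - \<sigma>\<bar> + \<epsilon> \<and> N (a \<rho>) \<le> \<rho> * B"
proof -
  define C where "C = (\<Sum>j<n. R ^ (n - Suc j) * N (x ^ j))"
  have C: "0 \<le> C"
    unfolding C_def using R nonneg by (intro sum_nonneg mult_nonneg_nonneg) auto
  \<comment> \<open>The errors below are at most \<open>\<eta> R C\<close> and \<open>2 \<eta> R B\<close>. The constant \<open>C\<close> depends on \<open>n\<close>, which is harmless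
    because the precision \<open>\<eta>\<close> is chosen after \<open>n\<close>.\<close>
  define \<eta> where "\<eta> = \<epsilon> / (R * C + 2 * R * B + 1)"
  have D: "0 < R * C + 2 * R * B + 1"
    using C B R by (intro add_nonneg_pos add_nonneg_nonneg mult_nonneg_nonneg) auto
  have \<eta>: "0 < \<eta>"
    using D \<epsilon> by (simp add: \<eta>_def)
  have "\<eta> * (R * C + 2 * R * B) \<le> \<eta> * (R * C + 2 * R * B + 1)"
    using \<eta> by (intro mult_left_mono) auto
  also have "\<dots> = \<epsilon>"
    using D by (simp add: \<eta>_def)
  finally have \<eta>_le: "\<eta> * (R * C) + \<eta> * (2 * R * B) \<le> \<epsilon>"
    by (simp add: algebra_simps)
  have nn: "0 \<le> \<eta> * (R * C)" "0 \<le> \<eta> * (2 * R * B)"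
    using \<eta> C B R by auto
  obtain g where g: "\<And>\<zeta>. cmod \<zeta> \<le> R \<Longrightarrow> N (1 - (x - \<iota> \<zeta>) * g \<zeta>) < \<eta>"
    and gB: "\<And>\<zeta>. cmod \<zeta> \<le> R \<Longrightarrow> N (g \<zeta>) \<le> B"
  proof -
    have "\<exists>g. cmod \<zeta> \<le> R \<longrightarrow> N (1 - (x - \<iota> \<zeta>) * g) < \<eta> \<and> N g \<le> B" for \<zeta>
      using inv[OF _ \<eta>] by blast
    then show ?thesis
      using that by metis
  qed
  \<comment> \<open>\<open>F \<zeta>\<close> approximates \<open>\<zeta> (\<zeta> - x)\<inverse>\<close>.\<close>
  define F where "F \<zeta> = - (\<iota> \<zeta> * g \<zeta>)" for \<zeta>
  define S where "S \<zeta> = (\<Sum>j<n. \<iota> (\<zeta> ^ (n - Suc j)) * x ^ j)" for \<zeta>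
  have F_lip: "N (F \<zeta> - F \<mu>) \<le> (B + R * B\<^sup>2) * cmod (\<zeta> - \<mu>) + \<epsilon>"
    if "cmod \<zeta> \<le> R" "cmod \<mu> \<le> R" for \<zeta> \<mu>
  proof -
    let ?e = "\<lambda>\<zeta>. 1 - (x - \<iota> \<zeta>) * g \<zeta>"
    let ?d = "\<iota> (\<zeta> - \<mu>) * (g \<zeta> * g \<mu>) + (g \<zeta> * ?e \<mu> - g \<mu> * ?e \<zeta>)"
    have "F \<mu> - F \<zeta> = \<iota> (\<zeta> - \<mu>) * g \<zeta> + \<iota> \<mu> * ?d"
      by (simp add: F_def scalar.hom_minus algebra_simps)
    then have "N (F \<zeta> - F \<mu>) \<le> N (\<iota> (\<zeta> - \<mu>) * g \<zeta>) + N (\<iota> \<mu> * ?d)"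
      using add[of "\<iota> (\<zeta> - \<mu>) * g \<zeta>" "\<iota> \<mu> * ?d"] diff_commute[of "F \<zeta>" "F \<mu>"] by simp
    also have "\<dots> = cmod (\<zeta> - \<mu>) * N (g \<zeta>) + cmod \<mu> * N ?d"
      by (simp only: scale)
    also have "\<dots> \<le> cmod (\<zeta> - \<mu>) * B + R * N ?d"
      using that gB nonneg R by (intro add_mono mult_mono) auto
    also have "N ?d \<le> N (\<iota> (\<zeta> - \<mu>) * (g \<zeta> * g \<mu>)) + (N (g \<zeta> * ?e \<mu>) + N (g \<mu> * ?e \<zeta>))"
      using add[of "\<iota> (\<zeta> - \<mu>) * (g \<zeta> * g \<mu>)" "g \<zeta> * ?e \<mu> - g \<mu> * ?e \<zeta>"]
        diff[of "g \<zeta> * ?e \<mu>" "g \<mu> * ?e \<zeta>"] by linarith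
    also have "\<dots> \<le> cmod (\<zeta> - \<mu>) * (B * B) + (B * \<eta> + B * \<eta>)"
    proof -
      have "N (g \<zeta> * g \<mu>) \<le> B * B"
        using mult[of "g \<zeta>" "g \<mu>"] mult_mono[of "N (g \<zeta>)" B "N (g \<mu>)" B] gB that nonneg B
        by (auto intro: order.trans)
      moreover have "N (g \<zeta> * ?e \<mu>) \<le> B * \<eta>"
        using mult[of "g \<zeta>" "?e \<mu>"] mult_mono[of "N (g \<zeta>)" B "N (?e \<mu>)" \<eta>] gB[of \<zeta>] g[of \<mu>] that
          nonneg B \<eta> by (auto intro: order.trans)
      moreover have "N (g \<mu> * ?e \<zeta>) \<le> B * \<eta>"
        using mult[of "g \<mu>" "?e \<zeta>"] mult_mono[of "N (g \<mu>)" B "N (?e \<zeta>)" \<eta>] gB[of \<mu>] g[of \<zeta>] that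
          nonneg B \<eta> by (auto intro: order.trans)
      ultimately show ?thesis
        unfolding scale by (intro add_mono mult_left_mono) auto
    qed
    finally have "N (F \<zeta> - F \<mu>) \<le> cmod (\<zeta> - \<mu>) * B
        + R * (cmod (\<zeta> - \<mu>) * (B * B) + (B * \<eta> + B * \<eta>))"
      using R by (simp add: mult_left_mono)
    also have "\<dots> = (B + R * B\<^sup>2) * cmod (\<zeta> - \<mu>) + \<eta> * (2 * R * B)"
      by (simp add: algebra_simps power2_eq_square)
    also have "\<dots> \<le> (B + R * B\<^sup>2) * cmod (\<zeta> - \<mu>) + \<epsilon>"
      using \<eta>_le nn by simp
    finally show ?thesis .
  qed
  have F_inv: "N (F \<zeta> * (\<iota> (\<zeta> ^ n) - x ^ n) - \<iota> \<zeta> * S \<zeta>) \<le> \<epsilon>" if "cmod \<zeta> \<le> R" for \<zeta>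
  proof -
    let ?e = "1 - (x - \<iota> \<zeta>) * g \<zeta>"
    have "x ^ n - \<iota> (\<zeta> ^ n) = (x - \<iota> \<zeta>) * S \<zeta>"
      unfolding S_def scalar.hom_power by (subst power_diff_sumr2) (simp add: mult.commute)
    then have eq: "\<iota> (\<zeta> ^ n) - x ^ n = - ((x - \<iota> \<zeta>) * S \<zeta>)"
      by (metis minus_diff_eq)
    have "F \<zeta> * (\<iota> (\<zeta> ^ n) - x ^ n) - \<iota> \<zeta> * S \<zeta> = - (\<iota> \<zeta> * (?e * S \<zeta>))"
      unfolding eq F_def by (simp add: algebra_simps)
    then have "N (F \<zeta> * (\<iota> (\<zeta> ^ n) - x ^ n) - \<iota> \<zeta> * S \<zeta>) = cmod \<zeta> * N (?e * S \<zeta>)"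
      by (simp only: minus scale)
    also have "\<dots> \<le> R * (\<eta> * C)"
    proof -
      have "N (S \<zeta>) \<le> C"
      proof -
        have "N (S \<zeta>) \<le> (\<Sum>j<n. N (\<iota> (\<zeta> ^ (n - Suc j)) * x ^ j))"
          unfolding S_def by (rule sum_le)
        also have "\<dots> \<le> C"
          unfolding C_def scale norm_power using that nonneg
          by (intro sum_mono mult_right_mono power_mono) auto
        finally show ?thesis .
      qed
      then have "N ?e * N (S \<zeta>) \<le> \<eta> * C"
        using g[OF that] nonneg C \<eta> by (intro mult_mono) auto
      then have "N (?e * S \<zeta>) \<le> \<eta> * C"
        using mult[of ?e "S \<zeta>"] by linarith
      then show ?thesis
        using that R nonneg by (intro mult_mono) auto
    qed
    also have "\<dots> \<le> \<epsilon>"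
      using \<eta>_le nn by (simp add: mult_ac)
    finally show ?thesis .
  qed
  define \<omega> where "\<omega> k = cis (2 * pi * real k / real n)" for k
  have \<omega>: "cmod (of_real \<rho> * \<omega> k) = \<rho>" if "0 \<le> \<rho>" for \<rho> k
    using that by (simp add: \<omega>_def norm_mult)
  have \<omega>n: "\<omega> k ^ n = 1" for k
    using n by (simp add: \<omega>_def DeMoivre mult.commute[of _ "real n"] del: of_nat_mult)
  define a where "a \<rho> = \<iota> (1 / of_nat n) * (\<Sum>k<n. F (of_real \<rho> * \<omega> k))" for \<rho>
  have average: "N (\<iota> (1 / of_nat n) * (\<Sum>k<n. f k)) \<le> c" if "\<And>k. N (f k) \<le> c" for f c
  proof -
    have "N (\<Sum>k<n. f k) \<le> (\<Sum>k<n. c)"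
      by (rule order.trans[OF sum_le]) (intro sum_mono that)
    then show ?thesis
      unfolding scale using n by (simp add: norm_divide field_simps)
  qed
  have mean: "\<iota> (1 / of_nat n) * (\<Sum>k<n. \<iota> (of_real \<rho> * \<omega> k) * S (of_real \<rho> * \<omega> k)) =
      \<iota> (of_real (\<rho> ^ n))" for \<rho>
  proof -
    have "(\<Sum>k<n. \<iota> (of_real \<rho> * \<omega> k) * S (of_real \<rho> * \<omega> k)) =
        (\<Sum>k<n. \<Sum>j<n. \<iota> ((of_real \<rho> * \<omega> k) ^ (n - j)) * x ^ j)"
      unfolding S_def sum_distrib_left
      by (intro sum.cong refl)
         (simp add: Suc_diff_Suc flip: mult.assoc scalar.hom_mult power_Suc)
    also have "\<dots> = (\<Sum>j<n. \<iota> (of_real \<rho> ^ (n - j) * (\<Sum>k<n. \<omega> k ^ (n - j))) * x ^ j)"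
      by (subst sum.swap)
         (simp add: sum_distrib_right sum_distrib_left scalar.hom_sum power_mult_distrib)
    also have "\<dots> = (\<Sum>j<n. if j = 0 then \<iota> (of_real \<rho> ^ n * of_nat n) else 0)"
    proof (intro sum.cong refl)
      fix j assume "j \<in> {..<n}"
      then have "(\<Sum>k<n. \<omega> k ^ (n - j)) = 0" if "j \<noteq> 0"
        using that unfolding \<omega>_def by (intro sum_root_of_unity_powers) auto
      then show "\<iota> (of_real \<rho> ^ (n - j) * (\<Sum>k<n. \<omega> k ^ (n - j))) * x ^ j =
          (if j = 0 then \<iota> (of_real \<rho> ^ n * of_nat n) else 0)"
        by (simp add: \<omega>n)
    qed
    also have "\<dots> = \<iota> (of_real \<rho> ^ n * of_nat n)"
      using n by simp
    finally show ?thesis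
      using n by (simp flip: scalar.hom_mult)
  qed
  show ?thesis
  proof (intro exI[of _ a] allI impI conjI)
    fix \<rho> \<sigma> assume \<rho>: "0 \<le> \<rho>" "\<rho> \<le> R" and \<sigma>: "0 \<le> \<sigma>" "\<sigma> \<le> R"
    let ?z = "\<lambda>\<rho> k. of_real \<rho> * \<omega> k"
    have pow: "?z \<rho> k ^ n = of_real (\<rho> ^ n)" for k
      by (simp add: power_mult_distrib \<omega>n)
    have "a \<rho> * (\<iota> (of_real (\<rho> ^ n)) - x ^ n) - \<iota> (of_real (\<rho> ^ n)) =
      \<iota> (1 / of_nat n) * (\<Sum>k<n. F (?z \<rho> k) * (\<iota> (?z \<rho> k ^ n) - x ^ n) - \<iota> (?z \<rho> k) * S (?z \<rho> k))"
      unfolding pow sum_subtractf right_diff_distrib[of "\<iota> (1 / of_nat n)"] mean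
      by (simp add: a_def sum_distrib_right mult.assoc)
    then show "N (a \<rho> * (\<iota> (of_real (\<rho> ^ n)) - x ^ n) - \<iota> (of_real (\<rho> ^ n))) \<le> \<epsilon>"
      using \<rho> by (auto intro!: average F_inv simp: \<omega>)
    have "a \<rho> - a \<sigma> = \<iota> (1 / of_nat n) * (\<Sum>k<n. F (?z \<rho> k) - F (?z \<sigma> k))"
      by (simp add: a_def sum_subtractf right_diff_distrib)
    moreover have "N (F (?z \<rho> k) - F (?z \<sigma> k)) \<le> (B + R * B\<^sup>2) * \<bar>\<rho> - \<sigma>\<bar> + \<epsilon>" for k
    proof -
      have "cmod (?z \<rho> k - ?z \<sigma> k) = \<bar>\<rho> - \<sigma>\<bar>"
        by (simp add: \<omega>_def norm_mult flip: left_diff_distrib of_real_diff)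
      then show ?thesis
        using F_lip[of "?z \<rho> k" "?z \<sigma> k"] \<rho> \<sigma> by (simp add: \<omega>)
    qed
    ultimately show "N (a \<rho> - a \<sigma>) \<le> (B + R * B\<^sup>2) * \<bar>\<rho> - \<sigma>\<bar> + \<epsilon>"
      by (simp only: average)
    show "N (a \<rho>) \<le> \<rho> * B"
      unfolding a_def
    proof (rule average)
      fix k
      have "N (F (?z \<rho> k)) = \<rho> * N (g (?z \<rho> k))"
        using \<rho> by (simp only: F_def minus scale \<omega>)
      also have "\<dots> \<le> \<rho> * B"
        using \<rho> by (intro mult_left_mono gB) (auto simp: \<omega>)
      finally show "N (F (?z \<rho> k)) \<le> \<rho> * B" .
    qed
  qed
qed

text \<open>
  The theorem that every element of a complex Banach algebra has nonempty spectrum, for seminorms and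
  without a completion: some \<open>x - \<zeta>\<close> generates an ideal whose closure is proper. Otherwise let \<open>\<rho>\<close> be a
  radius for which the powers of \<open>x / \<rho>\<close> tend to zero. By the averages above such radii can be
  lowered by a fixed amount \<open>\<delta> / 4\<close>, which cannot go on for ever, because at radius zero the
  average is zero while it has to be close to \<open>1\<close>. This follows Rickart's elementary proof, which
  uses neither linear functionals nor Liouville's theorem.
\<close>

lemma spectrum_nonempty:
  assumes one: "N 1 \<noteq> 0"
  shows "\<exists>\<zeta>. quotient_seminorm N (x - \<iota> \<zeta>) 1 \<noteq> 0"
proof (rule ccontr)
  assume contr: "\<not> ?thesis"
  have inv: "\<exists>g. N (1 - (x - \<iota> \<zeta>) * g) < \<eta>" if "0 < \<eta>" for \<zeta> \<eta>
  proof -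
    have "quotient_seminorm N (x - \<iota> \<zeta>) 1 = 0"
      using contr that by blast
    then show ?thesis
      using that by (intro quotient_seminorm_lessD) simp
  qed
  define R where "R = N x + 1"
  have R: "0 < R"
    using nonneg[of x] by (simp add: R_def)
  obtain B where B: "0 < B" and invB: "\<And>\<zeta> \<eta>. \<zeta> \<in> cball 0 R \<Longrightarrow> 0 < \<eta> \<Longrightarrow>
      \<exists>g. N (1 - (x - \<iota> \<zeta>) * g) < \<eta> \<and> N g \<le> B"
    using approx_inverses_bounded[OF one compact_cball inv] by metis
  have invB': "\<exists>g. N (1 - (x - \<iota> \<zeta>) * g) < \<eta> \<and> N g \<le> B" if "cmod \<zeta> \<le> R" "0 < \<eta>" for \<zeta> \<eta>
    using invB[of \<zeta> \<eta>] that by simp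
  define \<delta> where "\<delta> = 1 / (4 * (B + R * B\<^sup>2))"
  have L: "0 < B + R * B\<^sup>2"
    using B R by (intro add_pos_nonneg) auto
  then have \<delta>: "0 < \<delta>" "(B + R * B\<^sup>2) * \<delta> = 1 / 4"
    by (simp_all add: \<delta>_def)
  define good where "good \<rho> \<longleftrightarrow> 0 < \<rho> \<and> \<rho> \<le> R \<and> (\<lambda>n. N (x ^ n) / \<rho> ^ n) \<longlonglongrightarrow> 0" for \<rho>
  \<comment> \<open>If the powers of \<open>x / \<rho>\<close> tend to \<open>0\<close>, then the averages \<open>(1 - (x / \<rho>)\<^sup>n)\<inverse>\<close> of the resolvent
    over the circle of radius \<open>\<rho>\<close> tend to \<open>1\<close>, so that those over the circle of radius \<open>\<sigma>\<close> stay
    within one half of \<open>1\<close>.\<close>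
  have step: "\<forall>\<^sub>F n in sequentially. \<exists>b. N (1 - b) \<le> 1 / 2 \<and> N b \<le> \<sigma> * B \<and>
      N (b * (\<iota> (of_real (\<sigma> ^ n)) - x ^ n) - \<iota> (of_real (\<sigma> ^ n))) \<le> e n"
    if \<rho>: "good \<rho>" and \<sigma>: "0 \<le> \<sigma>" "\<sigma> \<le> \<rho>" "\<rho> - \<sigma> \<le> \<delta>" and e: "\<And>n. 0 < e n" for \<rho> \<sigma> and e :: "nat \<Rightarrow> real"
  proof -
    have "(\<lambda>n. R * B * (N (x ^ n) / \<rho> ^ n)) \<longlonglongrightarrow> R * B * 0"
      using \<rho> unfolding good_def by (intro tendsto_mult_left) auto
    then have "\<forall>\<^sub>F n in sequentially. R * B * (N (x ^ n) / \<rho> ^ n) < 1 / 16"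
      by (rule order_tendstoD) simp
    then show ?thesis
      using eventually_gt_at_top[of 0]
    proof eventually_elim
      case (elim n)
      have \<rho>0: "0 < \<rho>" "0 \<le> \<rho>" "\<rho> \<le> R"
        using \<rho> by (auto simp: good_def)
      define \<epsilon> where "\<epsilon> = min (min (e n) (1 / 16)) (\<rho> ^ n / 16)"
      have \<epsilon>: "0 < \<epsilon>" "\<epsilon> \<le> e n" "\<epsilon> \<le> 1 / 16" "\<epsilon> / \<rho> ^ n \<le> 1 / 16"
        using e \<rho>0 by (auto simp: \<epsilon>_def min_def field_simps)
      obtain a where a: "\<And>\<rho> \<sigma>. 0 \<le> \<rho> \<Longrightarrow> \<rho> \<le> R \<Longrightarrow> 0 \<le> \<sigma> \<Longrightarrow> \<sigma> \<le> R \<Longrightarrow>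
          N (a \<rho> * (\<iota> (of_real (\<rho> ^ n)) - x ^ n) - \<iota> (of_real (\<rho> ^ n))) \<le> \<epsilon> \<and>
          N (a \<rho> - a \<sigma>) \<le> (B + R * B\<^sup>2) * \<bar>\<rho> - \<sigma>\<bar> + \<epsilon> \<and> N (a \<rho>) \<le> \<rho> * B"
        using approx_resolvent_average[OF B less_imp_le[OF R] invB' elim(2) \<epsilon>(1)] by blast
      note a\<rho> = a[OF \<rho>0(2,3) \<rho>0(2,3)]
      have \<sigma>R: "\<sigma> \<le> R" using \<sigma> \<rho>0 by simp
      let ?r = "\<iota> (of_real (\<rho> ^ n))"
      have "a \<rho> - 1 = \<iota> (of_real (1 / \<rho> ^ n)) * (a \<rho> * (?r - x ^ n) - ?r + a \<rho> * x ^ n)"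
      proof -
        have "\<iota> (of_real (1 / \<rho> ^ n)) * ?r = \<iota> (of_real (1 / \<rho> ^ n * \<rho> ^ n))"
          by (simp only: scalar.hom_mult of_real_mult)
        then have "\<iota> (of_real (1 / \<rho> ^ n)) * ?r = 1"
          using \<rho>0 by simp
        then have "a \<rho> - 1 = (\<iota> (of_real (1 / \<rho> ^ n)) * ?r) * (a \<rho> - 1)"
          by simp
        then show ?thesis by (simp add: algebra_simps)
      qed
      then have "N (a \<rho> - 1) = 1 / \<rho> ^ n * N (a \<rho> * (?r - x ^ n) - ?r + a \<rho> * x ^ n)"
        using \<rho>0 by (simp only: scale norm_of_real) (simp add: power_abs)
      also have "\<dots> \<le> 1 / \<rho> ^ n * (\<epsilon> + R * B * N (x ^ n))"
      proof -
        have "N (a \<rho> * x ^ n) \<le> R * B * N (x ^ n)"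
        proof -
          have "N (a \<rho>) \<le> R * B"
            using a\<rho> mult_right_mono[OF \<rho>0(3) less_imp_le[OF B]] by linarith
          then have "N (a \<rho>) * N (x ^ n) \<le> R * B * N (x ^ n)"
            using nonneg by (intro mult_right_mono) auto
          then show ?thesis using mult[of "a \<rho>" "x ^ n"] by linarith
        qed
        then have "N (a \<rho> * (?r - x ^ n) - ?r + a \<rho> * x ^ n) \<le> \<epsilon> + R * B * N (x ^ n)"
          using a\<rho> add[of "a \<rho> * (?r - x ^ n) - ?r" "a \<rho> * x ^ n"] by linarith
        then show ?thesis
          using \<rho>0 by (intro mult_left_mono) auto
      qed
      also have "\<dots> \<le> 1 / 8"
      proof -
        have "1 / \<rho> ^ n * (\<epsilon> + R * B * N (x ^ n)) = \<epsilon> / \<rho> ^ n + R * B * (N (x ^ n) / \<rho> ^ n)"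
          by (simp add: add_divide_distrib)
        then show ?thesis using \<epsilon>(4) elim(1) by linarith
      qed
      finally have a1: "N (a \<rho> - 1) \<le> 1 / 8" .
      have "(B + R * B\<^sup>2) * \<bar>\<rho> - \<sigma>\<bar> \<le> (B + R * B\<^sup>2) * \<delta>"
        using \<sigma> L by (intro mult_left_mono) auto
      then have "N (a \<rho> - a \<sigma>) \<le> 1 / 4 + 1 / 16"
        using a[OF \<rho>0(2,3) \<sigma>(1) \<sigma>R] \<epsilon>(3) \<delta>(2) by linarith
      then have "N (1 - a \<sigma>) \<le> 1 / 2"
        using a1 diff[of "a \<rho> - a \<sigma>" "a \<rho> - 1"] by simp
      then show ?case
        using a[OF \<sigma>(1) \<sigma>R \<sigma>(1) \<sigma>R] \<epsilon>(2) by (intro exI[of _ "a \<sigma>"]) auto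
    qed
  qed
  have not_small: "\<delta> < \<rho>" if "good \<rho>" for \<rho>
  proof (rule ccontr)
    assume "\<not> \<delta> < \<rho>"
    then have "\<forall>\<^sub>F n in sequentially. \<exists>b. N (1 - b) \<le> 1 / 2 \<and> N b \<le> 0 * B \<and>
        N (b * (\<iota> (of_real (0 ^ n)) - x ^ n) - \<iota> (of_real (0 ^ n))) \<le> 1"
      using that by (intro step) (auto simp: good_def)
    then obtain b where b: "N (1 - b) \<le> 1 / 2" "N b \<le> 0"
      by (auto dest: eventually_happens)
    then have "N 1 \<le> 1 / 2"
      using add[of "1 - b" b] by simp
    with one_ge[OF one] show False by simp
  qed
  have descend: "good (\<rho> - \<delta> / 4)" if \<rho>: "good \<rho>" for \<rho>
  proof -
    \<comment> \<open>The averages at radius \<open>\<sigma>\<close> stay close to \<open>1\<close>, so that their inverses \<open>1 - (x / \<sigma>)\<^sup>n\<close> are bounded. Then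
      the powers of \<open>x / \<tau>\<close> tend to zero for every \<open>\<tau> > \<sigma>\<close>, in particular for \<open>\<tau> = \<rho> - \<delta> / 4\<close>.\<close>
    define \<sigma> where "\<sigma> = \<rho> - \<delta> / 2"
    have \<sigma>: "0 < \<sigma>" "\<sigma> \<le> \<rho>" "\<rho> - \<sigma> \<le> \<delta>" "\<sigma> < \<rho> - \<delta> / 4"
      using \<delta> not_small[OF \<rho>] by (auto simp: \<sigma>_def)
    have "\<forall>\<^sub>F n in sequentially. \<exists>b. N (1 - b) \<le> 1 / 2 \<and> N b \<le> \<sigma> * B \<and>
        N (b * (\<iota> (of_real (\<sigma> ^ n)) - x ^ n) - \<iota> (of_real (\<sigma> ^ n))) \<le> \<sigma> ^ n"
      using \<rho> \<sigma> by (intro step) auto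
    then have bound: "\<forall>\<^sub>F n in sequentially. N (x ^ n) \<le> (3 * N 1 + 2) * \<sigma> ^ n"
    proof eventually_elim
      case (elim n)
      then obtain b where b: "N (1 - b) \<le> 1 / 2"
        "N (b * (\<iota> (of_real (\<sigma> ^ n)) - x ^ n) - \<iota> (of_real (\<sigma> ^ n))) \<le> \<sigma> ^ n" by blast
      let ?s = "\<iota> (of_real (\<sigma> ^ n))"
      let ?u = "?s - x ^ n"
      have Ns: "N ?s = \<sigma> ^ n * N 1"
        using \<sigma> by (simp only: const norm_of_real) (simp add: power_abs)
      have eq: "(b * ?u - ?s) + ?s + (1 - b) * ?u = ?u"
        by (simp add: algebra_simps)
      have "N ?u \<le> N (b * ?u - ?s) + N ?s + N ((1 - b) * ?u)"
        using add[of "(b * ?u - ?s) + ?s" "(1 - b) * ?u"] add[of "b * ?u - ?s" ?s]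
        unfolding eq by linarith
      also have "\<dots> \<le> \<sigma> ^ n + \<sigma> ^ n * N 1 + 1 / 2 * N ?u"
        using b Ns mult[of "1 - b" ?u] mult_right_mono[OF b(1) nonneg[of ?u]] by linarith
      finally have "N ?u \<le> 2 * \<sigma> ^ n + 2 * (\<sigma> ^ n * N 1)" by (simp add: distrib_left)
      moreover have "N (x ^ n) \<le> \<sigma> ^ n * N 1 + N ?u"
        using diff[of ?s ?u] unfolding Ns by simp
      ultimately have "N (x ^ n) \<le> 3 * (\<sigma> ^ n * N 1) + 2 * \<sigma> ^ n" by linarith
      moreover have "(3 * c + 2) * s = 3 * (s * c) + 2 * s" for c s :: real
        by (simp add: algebra_simps)
      ultimately show ?case by (simp only:)
    qed
    let ?\<tau> = "\<rho> - \<delta> / 4"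
    have \<tau>: "0 < ?\<tau>" "?\<tau> \<le> R"
      using \<sigma> \<rho> \<delta> by (auto simp: good_def)
    have "(\<lambda>n. (3 * N 1 + 2) * (\<sigma> / ?\<tau>) ^ n) \<longlonglongrightarrow> (3 * N 1 + 2) * 0"
      using \<sigma> \<tau> by (intro tendsto_mult_left LIMSEQ_power_zero) simp
    then have lim: "(\<lambda>n. (3 * N 1 + 2) * (\<sigma> / ?\<tau>) ^ n) \<longlonglongrightarrow> 0" by simp
    have "(\<lambda>n. N (x ^ n) / ?\<tau> ^ n) \<longlonglongrightarrow> 0"
    proof (rule tendsto_sandwich[OF _ _ tendsto_const lim])
      show "\<forall>\<^sub>F n in sequentially. 0 \<le> N (x ^ n) / ?\<tau> ^ n"
        using \<tau> nonneg by simp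
      show "\<forall>\<^sub>F n in sequentially. N (x ^ n) / ?\<tau> ^ n \<le> (3 * N 1 + 2) * (\<sigma> / ?\<tau>) ^ n"
        using bound by eventually_elim (use \<tau> in \<open>simp add: power_divide divide_right_mono\<close>)
    qed
    with \<tau> show ?thesis by (simp add: good_def)
  qed
  have "good R"
  proof -
    have "(\<lambda>n. N 1 * (N x / R) ^ n) \<longlonglongrightarrow> N 1 * 0"
      using R nonneg[of x] by (intro tendsto_mult_left LIMSEQ_power_zero) (simp add: R_def)
    then have lim: "(\<lambda>n. N 1 * (N x / R) ^ n) \<longlonglongrightarrow> 0" by simp
    have "(\<lambda>n. N (x ^ n) / R ^ n) \<longlonglongrightarrow> 0"
    proof (rule tendsto_sandwich[OF _ _ tendsto_const lim])
      show "\<forall>\<^sub>F n in sequentially. 0 \<le> N (x ^ n) / R ^ n"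
        using R nonneg by simp
      show "\<forall>\<^sub>F n in sequentially. N (x ^ n) / R ^ n \<le> N 1 * (N x / R) ^ n"
        using R power_le[of x] by (simp add: power_divide divide_right_mono)
    qed
    then show ?thesis using R by (simp add: good_def)
  qed
  then have "good (R - real i * (\<delta> / 4))" for i
  proof (induction i)
    case (Suc i)
    have "R - real (Suc i) * (\<delta> / 4) = R - real i * (\<delta> / 4) - \<delta> / 4"
      by (simp add: algebra_simps)
    then show ?case using descend[OF Suc.IH[OF Suc.prems]] by (simp only:)
  qed simp
  moreover obtain i where "R < real i * (\<delta> / 4)"
    using reals_Archimedean3[of "\<delta> / 4"] \<delta> by auto
  ultimately show False
    using not_small[of "R - real i * (\<delta> / 4)"] \<delta> by simp
qed

end

section \<open>The Hermitian quadratic module\<close>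

text \<open>
  The polynomial \<open>h\<^sup>*(w) (I - Q\<^sup>*(w) Q(z)) h(z)\<close>, for a column \<open>h\<close> of polynomials.
\<close>

definition poly_form :: "'d cpoly mat \<Rightarrow> (nat \<Rightarrow> 'd cpoly) \<Rightarrow> ('d + 'd) cpoly"
  where "poly_form Q h =
    (\<Sum>a<dim_col Q. hsq (h a)) - (\<Sum>r<dim_row Q. hsq (\<Sum>a<dim_col Q. Q $$ (r, a) * h a))"

text \<open>
  The polynomials with a representation as in the Archimedean condition. Generating them inductively
  postpones all Kronecker products to the end of the proof.
\<close>

inductive_set quad_module :: "nat \<Rightarrow> (nat \<Rightarrow> 'd cpoly mat) \<Rightarrow> ('d + 'd) cpoly set"
  for k :: nat and P :: "nat \<Rightarrow> 'd cpoly mat"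
  where
    zero: "0 \<in> quad_module k P"
  | add: "f \<in> quad_module k P \<Longrightarrow> g \<in> quad_module k P \<Longrightarrow> f + g \<in> quad_module k P"
  | square: "hsq f \<in> quad_module k P"
  | form: "j < k \<Longrightarrow> poly_form (P j) h \<in> quad_module k P"

lemma quad_module_sum:
  assumes "\<And>i. i \<in> S \<Longrightarrow> f i \<in> quad_module k P"
  shows "(\<Sum>i\<in>S. f i) \<in> quad_module k P"
  using assms by (induction S rule: infinite_finite_induct) (auto intro: quad_module.intros)

lemma poly_form_times_hsq: "poly_form Q h * hsq f = poly_form Q (\<lambda>a. h a * f)"
  by (simp only: poly_form_def left_diff_distrib sum_distrib_right hsq_mult[symmetric] mult.assoc)

text \<open>
  Multiplication by \<open>f\<^sup>*(w) f(z)\<close> replaces each column in a representation by its multiple with \<open>f\<close>.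
\<close>

lemma quad_module_congruence:
  assumes "u \<in> quad_module k P"
  shows "u * hsq f \<in> quad_module k P"
  using assms
proof induction
  case (add f g)
  then show ?case by (auto simp: distrib_right intro: quad_module.add)
qed (auto simp: poly_form_times_hsq hsq_mult[symmetric] intro: quad_module.intros)

lemma quad_module_scale:
  assumes "u \<in> quad_module k P" "0 \<le> r"
  shows "cpoly_const (of_real r) * u \<in> quad_module k P"
  using quad_module_congruence[OF assms(1), of "cpoly_const (of_real (sqrt r))"] assms(2)
  by (simp add: hsq_const mult.commute)

lemma quad_module_const:
  assumes "0 \<le> r"
  shows "cpoly_const (of_real r) \<in> quad_module k P"
  using quad_module_scale[OF quad_module.square[of 1] assms] by (simp add: hsq_def)

text \<open>
  If multiplication operators on \<open>\<complex>[z]\<close> are measured in a semi-inner product \<open>\<langle>f, g\<rangle> = \<Lambda>(g\<^sup>*(w) f(z))\<close> with \<open>\<Lambda>\<close>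
  nonnegative on the quadratic module, then membership of \<open>t\<^sup>2 - f\<^sup>*(w) f(z)\<close> forces the operator of
  multiplication by \<open>f\<close> to have norm at most \<open>t\<close>. Bounds in this sense obey the rules for operator
  norms, by explicit identities, and so no functional has to be constructed.
\<close>

definition qm_bound :: "nat \<Rightarrow> (nat \<Rightarrow> 'd cpoly mat) \<Rightarrow> 'd cpoly \<Rightarrow> real \<Rightarrow> bool"
  where "qm_bound k P f t \<longleftrightarrow>
    0 < t \<and> cpoly_const (of_real (t\<^sup>2)) - hsq f \<in> quad_module k P"

lemma qm_bound_add:
  assumes f: "qm_bound k P f s" and g: "qm_bound k P g t"
  shows "qm_bound k P (f + g) (s + t)"
proof -
  have s: "0 < s" and t: "0 < t"
    using f g by (auto simp: qm_bound_def)
  \<comment> \<open>The Hermitian square of \<open>r f - g / r\<close> cancels the mixed terms in that of \<open>f + g\<close>, and for this \<open>r\<close> the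
    constants add up to \<open>(1 + t / s) s\<^sup>2 + (1 + s / t) t\<^sup>2 = (s + t)\<^sup>2\<close>.\<close>
  define r where "r = sqrt (t / s)"
  have r: "r \<noteq> 0" "r\<^sup>2 = t / s" "(1 / r)\<^sup>2 = s / t"
    using s t by (auto simp: r_def power_divide)
  let ?c = "\<lambda>r. cpoly_const (of_real r)"
  let ?d = "?c r * f - ?c (1 / r) * g"
  have rr: "?c r * ?c (1 / r) = 1"
    using r(1) by (simp flip: cpoly_const.hom_mult of_real_mult)
  have "hsq ?d = ?c (r * r) * hsq f + ?c (1 / r * (1 / r)) * hsq g
      - ?c r * ?c (1 / r) * (adj_w f * in_z g + adj_w g * in_z f)"
    by (simp add: hsq_def adj_w.hom_minus in_z.hom_minus adj_w.hom_mult in_z.hom_mult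
        cpoly_const.hom_mult algebra_simps del: of_real_divide times_divide_eq_right times_divide_eq_left)
  then have d: "hsq ?d = ?c (t / s) * hsq f + ?c (s / t) * hsq g
      - (adj_w f * in_z g + adj_w g * in_z f)"
    using r(2,3) by (simp only: rr power2_eq_square mult_1_left)
  have sum: "hsq (f + g) = hsq f + hsq g + (adj_w f * in_z g + adj_w g * in_z f)"
    by (simp add: hsq_def adj_w.hom_add in_z.hom_add algebra_simps)
  have "(s + t)\<^sup>2 = (1 + t / s) * s\<^sup>2 + (1 + s / t) * t\<^sup>2"
    using s t by (simp add: field_simps power2_eq_square)
  then have const: "?c ((s + t)\<^sup>2) = (1 + ?c (t / s)) * ?c (s\<^sup>2) + (1 + ?c (s / t)) * ?c (t\<^sup>2)"
    by (simp add: cpoly_const.hom_add cpoly_const.hom_mult del: of_real_power of_real_divide)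
  have "?c ((s + t)\<^sup>2) - hsq (f + g) =
      ?c (1 + t / s) * (?c (s\<^sup>2) - hsq f) + ?c (1 + s / t) * (?c (t\<^sup>2) - hsq g) + hsq ?d"
    unfolding d sum const
    by (simp add: cpoly_const.hom_add algebra_simps del: of_real_power of_real_divide)
  moreover have "\<dots> \<in> quad_module k P"
    using f g s t
    by (intro quad_module.add quad_module_scale quad_module.square) (auto simp: qm_bound_def)
  ultimately show ?thesis
    using s t by (simp add: qm_bound_def)
qed

lemma qm_bound_mult:
  assumes f: "qm_bound k P f s" and g: "qm_bound k P g t"
  shows "qm_bound k P (f * g) (s * t)"
proof -
  let ?c = "\<lambda>r. cpoly_const (of_real r)"
  have "?c ((s * t)\<^sup>2) - hsq (f * g) = ?c (s\<^sup>2) * (?c (t\<^sup>2) - hsq g) + (?c (s\<^sup>2) - hsq f) * hsq g"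
    by (simp add: hsq_mult power_mult_distrib cpoly_const.hom_mult algebra_simps del: of_real_power)
  moreover have "\<dots> \<in> quad_module k P"
    using f g
    by (intro quad_module.add quad_module_scale quad_module_congruence) (auto simp: qm_bound_def)
  ultimately show ?thesis
    using f g by (simp add: qm_bound_def)
qed

lemma qm_bound_scale:
  assumes f: "qm_bound k P f t" and c: "c \<noteq> 0"
  shows "qm_bound k P (cpoly_const c * f) (cmod c * t)"
proof -
  have "cpoly_const (of_real ((cmod c * t)\<^sup>2)) - hsq (cpoly_const c * f) =
      cpoly_const (of_real ((cmod c)\<^sup>2)) * (cpoly_const (of_real (t\<^sup>2)) - hsq f)"
    by (simp add: hsq_mult hsq_const power_mult_distrib cpoly_const.hom_mult algebra_simps
        del: of_real_power)
  also have "\<dots> \<in> quad_module k P"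
    using f by (intro quad_module_scale) (auto simp: qm_bound_def)
  finally show ?thesis
    using f c by (simp add: qm_bound_def)
qed

lemma qm_bound_const:
  assumes "cmod c \<le> t" "0 < t"
  shows "qm_bound k P (cpoly_const c) t"
proof -
  have "cpoly_const (of_real (t\<^sup>2 - (cmod c)\<^sup>2)) \<in> quad_module k P"
    using assms by (intro quad_module_const) (simp add: power_mono)
  then show ?thesis
    using assms by (simp add: qm_bound_def hsq_const cpoly_const.hom_minus)
qed

definition archimedean_module :: "nat \<Rightarrow> (nat \<Rightarrow> 'd cpoly mat) \<Rightarrow> bool"
  where "archimedean_module k P \<longleftrightarrow> (\<forall>i. \<exists>t. qm_bound k P (cpoly_var i) t)"

lemma qm_bound_exists:
  assumes "archimedean_module k P"
  shows "\<exists>t. qm_bound k P f t"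
proof (induction f rule: cpoly_induct)
  case (const c)
  have "qm_bound k P (cpoly_const c) (cmod c + 1)"
    by (rule qm_bound_const) (simp_all add: add_nonneg_pos)
  then show ?case by blast
next
  case (var v)
  then show ?case using assms by (simp add: archimedean_module_def)
qed (blast intro: qm_bound_add qm_bound_mult)+

definition qm_norm :: "nat \<Rightarrow> (nat \<Rightarrow> 'd cpoly mat) \<Rightarrow> 'd cpoly \<Rightarrow> real"
  where "qm_norm k P f = Inf {t. qm_bound k P f t}"

lemma submult_seminorm_qm_norm:
  assumes "archimedean_module k P"
  shows "submult_seminorm cpoly_const (qm_norm k P)"
  unfolding qm_norm_def
proof (rule submult_seminorm_Inf)
  show "comm_ring_hom cpoly_const"
    by (rule comm_ring_hom_cpoly_const)
  show "qm_bound k P f t \<Longrightarrow> 0 < t" for f t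
    by (simp add: qm_bound_def)
  show "\<exists>t. qm_bound k P f t" for f
    using assms by (rule qm_bound_exists)
  show "0 < t \<Longrightarrow> qm_bound k P 0 t" for t
    using qm_bound_const[of 0 t k P] by simp
qed (fact qm_bound_add qm_bound_mult qm_bound_scale)+

lemma qm_norm_le:
  assumes "qm_bound k P f t"
  shows "qm_norm k P f \<le> t"
  unfolding qm_norm_def using assms
  by (intro cInf_lower bdd_belowI[of _ 0]) (auto simp: qm_bound_def intro: less_imp_le)

lemma qm_norm_lessD:
  assumes "archimedean_module k P" "qm_norm k P f < t"
  shows "\<exists>s<t. qm_bound k P f s"
proof -
  have "{t. qm_bound k P f t} \<noteq> {}"
    using qm_bound_exists[OF assms(1)] by blast
  from cInf_lessD[OF this assms(2)[unfolded qm_norm_def]] show ?thesis by blast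
qed

section \<open>Contractive point evaluations and the Positivstellensatz\<close>

text \<open>
  If \<open>1\<close> is not a limit of multiples of \<open>p\<close>, pass to the quotient seminorm by \<open>p\<close> and then,
  one variable after the other, to the quotients by \<open>z\<^sub>i - \<zeta>\<^sub>i\<close>, where \<open>\<zeta>\<^sub>i\<close> is a spectral
  value of \<open>z\<^sub>i\<close> in the previous quotient. In the end each \<open>f\<close> is identified with the constant \<open>f(\<zeta>)\<close>,
  which gives a common point of the spectrum at which \<open>p\<close> vanishes. As there are finitely many
  variables, maximal ideals are avoided.
\<close>

lemma evaluation_bounded_by_seminorm:
  fixes N :: "'d :: finite cpoly \<Rightarrow> real" and p :: "'d cpoly"
  assumes "submult_seminorm cpoly_const N" and p: "quotient_seminorm N p 1 \<noteq> 0"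
  obtains z where "cpoly_eval p z = 0" "\<And>f. cmod (cpoly_eval f z) \<le> N f"
proof -
  interpret N: submult_seminorm cpoly_const N by fact
  have "\<exists>\<zeta> M. submult_seminorm cpoly_const M \<and> M 1 \<noteq> 0 \<and> (\<forall>f. M f \<le> N f) \<and> M p = 0 \<and>
      (\<forall>i\<in>S. M (cpoly_var i - cpoly_const (\<zeta> i)) = 0)" for S :: "'d set"
    using finite[of S]
  proof (induction S rule: finite_induct)
    case empty
    show ?case
      using N.submult_seminorm_quotient[of p] p N.quotient_seminorm_le[of p _ 0]
        N.quotient_seminorm_self
      by (intro exI[of _ "\<lambda>_. 0"] exI[of _ "quotient_seminorm N p"]) auto
  next
    case (insert i S)
    then obtain \<zeta> M where M: "submult_seminorm cpoly_const M" "M 1 \<noteq> 0" "\<And>f. M f \<le> N f" "M p = 0"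
      "\<And>i. i \<in> S \<Longrightarrow> M (cpoly_var i - cpoly_const (\<zeta> i)) = 0" by blast
    interpret M: submult_seminorm cpoly_const M by fact
    obtain c where c: "quotient_seminorm M (cpoly_var i - cpoly_const c) 1 \<noteq> 0"
      using M.spectrum_nonempty[OF M(2)] by blast
    let ?M = "quotient_seminorm M (cpoly_var i - cpoly_const c)"
    interpret q: submult_seminorm cpoly_const ?M
      by (rule M.submult_seminorm_quotient)
    have le: "?M f \<le> M f" for f
      using M.quotient_seminorm_le[of _ f 0] by simp
    have null: "?M f = 0" if "M f = 0" for f
      using le[of f] q.nonneg[of f] that by simp
    have "?M f \<le> N f" for f
      using le[of f] M(3)[of f] by simp
    then show ?case
      using c M null q.submult_seminorm_axioms M.quotient_seminorm_self insert.hyps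
      by (intro exI[of _ "\<zeta>(i := c)"] exI[of _ ?M]) auto
  qed
  from this[of UNIV] obtain \<zeta> M where M: "submult_seminorm cpoly_const M" "M 1 \<noteq> 0"
    "\<And>f. M f \<le> N f" "M p = 0" "\<And>i. M (cpoly_var i - cpoly_const (\<zeta> i)) = 0" by auto
  interpret M: submult_seminorm cpoly_const M by fact
  define z where "z = vec_lambda \<zeta>"
  have eval: "M (f - cpoly_const (cpoly_eval f z)) = 0" for f
  proof (induction f rule: cpoly_induct)
    case (const c)
    then show ?case by (simp add: M.zero)
  next
    case (var v)
    then show ?case by (simp add: z_def M)
  next
    case (add f g)
    have eq: "f + g - cpoly_const (cpoly_eval (f + g) z) =
        (f - cpoly_const (cpoly_eval f z)) + (g - cpoly_const (cpoly_eval g z))"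
      by (simp add: cpoly_eval.hom_add cpoly_const.hom_add)
    show ?case
      unfolding eq
      using M.add[of "f - cpoly_const (cpoly_eval f z)" "g - cpoly_const (cpoly_eval g z)"] add
        M.nonneg[of "(f - cpoly_const (cpoly_eval f z)) + (g - cpoly_const (cpoly_eval g z))"]
      by linarith
  next
    case (mult f g)
    let ?f = "f - cpoly_const (cpoly_eval f z)" and ?g = "g - cpoly_const (cpoly_eval g z)"
    have "f * g - cpoly_const (cpoly_eval (f * g) z) = ?f * g + cpoly_const (cpoly_eval f z) * ?g"
      by (simp add: cpoly_eval.hom_mult cpoly_const.hom_mult algebra_simps)
    then have "M (f * g - cpoly_const (cpoly_eval (f * g) z)) \<le>
        M (?f * g) + M (cpoly_const (cpoly_eval f z) * ?g)"
      using M.add[of "?f * g" "cpoly_const (cpoly_eval f z) * ?g"] by simp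
    also have "\<dots> \<le> M ?f * M g + cmod (cpoly_eval f z) * M ?g"
      using M.mult[of ?f g] by (simp only: M.scale)
    finally show ?case
      using mult M.nonneg[of "f * g - cpoly_const (cpoly_eval (f * g) z)"] by simp
  qed
  have bound: "cmod (cpoly_eval f z) \<le> M f" for f
  proof -
    have "cmod (cpoly_eval f z) * 1 \<le> cmod (cpoly_eval f z) * M 1"
      using M.one_ge[OF M(2)] by (intro mult_left_mono) auto
    also have "\<dots> = M (cpoly_const (cpoly_eval f z))"
      by (simp add: M.const)
    also have "\<dots> \<le> M f"
      using M.diff[of f "f - cpoly_const (cpoly_eval f z)"] eval[of f] by simp
    finally show ?thesis by simp
  qed
  show ?thesis
  proof
    show "cpoly_eval p z = 0"
      using bound[of p] M by simp
    show "cmod (cpoly_eval f z) \<le> N f" for f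
      using bound[of f] M(3)[of f] by simp
  qed
qed

text \<open>
  Let \<open>s\<close> be the linear combination whose Hermitian square is subtracted, and \<open>U = \<Sum> |u\<^sub>r|\<^sup>2\<close>. The
  difference equals the sum of the Hermitian squares of the \<open>q\<^sub>r - u\<^sub>r s\<close> plus \<open>1 - U\<close> times that of \<open>s\<close>.
\<close>

lemma quad_module_cauchy_schwarz:
  fixes u :: "'i \<Rightarrow> complex" and q :: "'i \<Rightarrow> 'd cpoly"
  assumes u: "(\<Sum>r\<in>S. (cmod (u r))\<^sup>2) \<le> 1"
  shows "(\<Sum>r\<in>S. hsq (q r)) - hsq (\<Sum>r\<in>S. cpoly_const (cnj (u r)) * q r) \<in> quad_module k P"
proof -
  define s where "s = (\<Sum>r\<in>S. cpoly_const (cnj (u r)) * q r)"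
  let ?U = "\<Sum>r\<in>S. (cmod (u r))\<^sup>2"
  have "hsq (q r - cpoly_const (u r) * s) = hsq (q r) - adj_w s * (cpoly_const (cnj (u r)) * in_z (q r))
      - cpoly_const (u r) * adj_w (q r) * in_z s + hsq s * hsq (cpoly_const (u r))
      + (adj_w s * (cpoly_const (cnj (u r)) * in_z (q r)) - cpoly_const (cnj (u r)) * adj_w s * in_z (q r))" for r
    by (simp add: hsq_def adj_w.hom_minus in_z.hom_minus adj_w.hom_mult in_z.hom_mult algebra_simps)
  then have expand: "hsq (q r - cpoly_const (u r) * s) =
      hsq (q r) - adj_w s * (cpoly_const (cnj (u r)) * in_z (q r))
      - cpoly_const (u r) * adj_w (q r) * in_z s + hsq s * hsq (cpoly_const (u r))" for r
    by (simp add: mult_ac)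
  have "(\<Sum>r\<in>S. hsq (q r - cpoly_const (u r) * s)) =
      (\<Sum>r\<in>S. hsq (q r)) - adj_w s * in_z s - adj_w s * in_z s + hsq s * cpoly_const (of_real ?U)"
  proof -
    have "in_z s = (\<Sum>r\<in>S. cpoly_const (cnj (u r)) * in_z (q r))"
      by (simp add: s_def in_z.hom_sum in_z.hom_mult)
    moreover have "adj_w s = (\<Sum>r\<in>S. cpoly_const (u r) * adj_w (q r))"
      by (simp add: s_def adj_w.hom_sum adj_w.hom_mult)
    moreover have "(\<Sum>r\<in>S. hsq (cpoly_const (u r) :: 'd cpoly)) = cpoly_const (of_real ?U)"
      by (simp add: hsq_const cpoly_const.hom_sum)
    ultimately show ?thesis
      unfolding expand sum.distrib sum_subtractf
      by (simp only: sum_distrib_left[symmetric] sum_distrib_right[symmetric])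
  qed
  then have "(\<Sum>r\<in>S. hsq (q r)) - hsq s =
      (\<Sum>r\<in>S. hsq (q r - cpoly_const (u r) * s)) + cpoly_const (of_real (1 - ?U)) * hsq s"
    by (simp add: hsq_def cpoly_const.hom_minus algebra_simps)
  moreover have "\<dots> \<in> quad_module k P"
    using u by (intro quad_module.add quad_module_sum quad_module_scale quad_module.square) auto
  ultimately show ?thesis
    unfolding s_def by simp
qed

lemma qm_bound_bilinear:
  fixes u v :: "nat \<Rightarrow> complex"
  assumes j: "j < k"
    and u: "(\<Sum>r<dim_row (P j). (cmod (u r))\<^sup>2) \<le> 1" and v: "(\<Sum>a<dim_col (P j). (cmod (v a))\<^sup>2) \<le> 1"
  shows "qm_bound k P (\<Sum>r<dim_row (P j). cpoly_const (cnj (u r)) *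
    (\<Sum>a<dim_col (P j). P j $$ (r, a) * cpoly_const (v a))) 1"
proof -
  let ?V = "\<Sum>a<dim_col (P j). (cmod (v a))\<^sup>2"
  define q where "q r = (\<Sum>a<dim_col (P j). P j $$ (r, a) * cpoly_const (v a))" for r
  let ?f = "\<Sum>r<dim_row (P j). cpoly_const (cnj (u r)) * q r"
  have "(\<Sum>a<dim_col (P j). hsq (cpoly_const (v a))) = cpoly_const (of_real ?V)"
    by (simp add: hsq_const cpoly_const.hom_sum)
  then have eq: "1 - hsq ?f = cpoly_const (of_real (1 - ?V)) + poly_form (P j) (\<lambda>a. cpoly_const (v a))
      + ((\<Sum>r<dim_row (P j). hsq (q r)) - hsq ?f)"
    by (simp add: poly_form_def q_def cpoly_const.hom_minus)
  have "\<dots> \<in> quad_module k P"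
    using v u j
    by (intro quad_module.add quad_module_const quad_module.form quad_module_cauchy_schwarz) auto
  then have "1 - hsq ?f \<in> quad_module k P"
    unfolding eq .
  then show ?thesis
    by (simp add: qm_bound_def q_def)
qed

lemma cauchy_schwarz_dual:
  fixes y :: "nat \<Rightarrow> complex"
  assumes "\<And>u. (\<Sum>r<n. (cmod (u r))\<^sup>2) \<le> 1 \<Longrightarrow> cmod (\<Sum>r<n. cnj (u r) * y r) \<le> 1"
  shows "(\<Sum>r<n. (cmod (y r))\<^sup>2) \<le> 1"
proof (rule ccontr)
  let ?Y = "\<Sum>r<n. (cmod (y r))\<^sup>2"
  assume "\<not> ?thesis"
  then have Y: "1 < ?Y" by simp
  define s where "s = sqrt ?Y"
  have s: "1 < s" "s * s = ?Y"
    using Y by (simp_all add: s_def)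
  have "(\<Sum>r<n. (cmod (y r / of_real s))\<^sup>2) = ?Y / s\<^sup>2"
    by (simp add: norm_divide power_divide sum_divide_distrib)
  also have "\<dots> = 1"
    unfolding s(2)[symmetric] power2_eq_square[of s] using s(1) by simp
  finally have "cmod (\<Sum>r<n. cnj (y r / of_real s) * y r) \<le> 1"
    by (intro assms) simp
  moreover have "(\<Sum>r<n. cnj (y r / of_real s) * y r) = of_real s"
  proof -
    have "cnj (y r / of_real s) * y r = of_real ((cmod (y r))\<^sup>2) / of_real s" for r
      by (subst complex_norm_square) (simp add: mult.commute)
    then have "(\<Sum>r<n. cnj (y r / of_real s) * y r) = of_real ?Y / of_real s"
      by (simp only: of_real_sum sum_divide_distrib)
    also have "\<dots> = of_real s"
      unfolding s(2)[symmetric] using s(1) by simp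
    finally show ?thesis .
  qed
  ultimately show False
    using s(1) by simp
qed

text \<open>
  A bounded evaluation maps the scalar polynomials \<open>u\<^sup>* P\<^sub>j(z) v\<close>, for unit vectors \<open>u\<close> and \<open>v\<close>, into the unit
  disc; the supremum over \<open>u\<close> and \<open>v\<close> is the norm of the matrix \<open>P\<^sub>j\<close> at the point.
\<close>

lemma evaluation_contractive:
  fixes z :: "complex ^ 'd :: finite"
  assumes eval: "\<And>f. cmod (cpoly_eval f z) \<le> qm_norm k P f" and j: "j < k"
  shows "(\<Sum>r<dim_row (P j). (cmod (\<Sum>a<dim_col (P j). cpoly_eval (P j $$ (r, a)) z * v a))\<^sup>2)
    \<le> (\<Sum>a<dim_col (P j). (cmod (v a))\<^sup>2)"
proof -
  let ?y = "\<lambda>v r. \<Sum>a<dim_col (P j). cpoly_eval (P j $$ (r, a)) z * v a"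
  have unit: "(\<Sum>r<dim_row (P j). (cmod (?y v r))\<^sup>2) \<le> 1"
    if v: "(\<Sum>a<dim_col (P j). (cmod (v a))\<^sup>2) \<le> 1" for v
  proof (rule cauchy_schwarz_dual)
    fix u :: "nat \<Rightarrow> complex" assume u: "(\<Sum>r<dim_row (P j). (cmod (u r))\<^sup>2) \<le> 1"
    let ?f = "\<Sum>r<dim_row (P j). cpoly_const (cnj (u r)) *
      (\<Sum>a<dim_col (P j). P j $$ (r, a) * cpoly_const (v a))"
    have "cmod (cpoly_eval ?f z) \<le> 1"
      using eval[of ?f] qm_norm_le[OF qm_bound_bilinear[where k = k and P = P and j = j and u = u and v = v]] j u v by auto
    then show "cmod (\<Sum>r<dim_row (P j). cnj (u r) * ?y v r) \<le> 1"
      by (simp add: cpoly_eval.hom_sum cpoly_eval.hom_mult)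
  qed
  let ?V = "\<Sum>a<dim_col (P j). (cmod (v a))\<^sup>2"
  show ?thesis
  proof (cases "?V = 0")
    case True
    then have "v a = 0" if "a < dim_col (P j)" for a
      using that by (subst (asm) sum_nonneg_eq_0_iff) auto
    then show ?thesis by simp
  next
    case False
    then have V: "0 < ?V"
      using sum_nonneg[of "{..<dim_col (P j)}" "\<lambda>a. (cmod (v a))\<^sup>2"] by simp
    define s where "s = sqrt ?V"
    have s: "0 < s" "s\<^sup>2 = ?V"
      using V by (simp_all add: s_def)
    have "(\<Sum>a<dim_col (P j). (cmod (v a / of_real s))\<^sup>2) \<le> 1"
      using s V by (simp add: norm_divide power_divide flip: sum_divide_distrib)
    from unit[OF this] have "(\<Sum>r<dim_row (P j). (cmod (?y v r / of_real s))\<^sup>2) \<le> 1"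
      by (simp add: sum_divide_distrib)
    then show ?thesis
      using s V by (simp add: norm_divide power_divide flip: sum_divide_distrib)
  qed
qed

text \<open>
  The Positivstellensatz for \<open>p\<^sup>*(w) p(z) - c\<^sup>2\<close>. Since \<open>p\<close> has no zero at a bounded evaluation, some \<open>p g\<close>
  is close to \<open>1\<close> in norm; a bound for \<open>g\<close> turns this into a lower bound for \<open>p\<close>, as for operators.
\<close>

lemma hsq_bounded_below:
  fixes p :: "'d :: finite cpoly"
  assumes arch: "archimedean_module k P"
    and nonzero: "\<And>z. (\<And>f. cmod (cpoly_eval f z) \<le> qm_norm k P f) \<Longrightarrow> cpoly_eval p z \<noteq> 0"
  obtains c where "0 < c" "hsq p - cpoly_const (of_real (c\<^sup>2)) \<in> quad_module k P"
proof -
  interpret N: submult_seminorm cpoly_const "qm_norm k P"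
    by (rule submult_seminorm_qm_norm[OF arch])
  have "quotient_seminorm (qm_norm k P) p 1 = 0"
    using evaluation_bounded_by_seminorm[OF N.submult_seminorm_axioms] nonzero by metis
  then obtain g where "qm_norm k P (1 - p * g) < 1 / 2"
    using N.quotient_seminorm_lessD[of p 1 "1 / 2"] by auto
  then obtain t where t: "t < 1 / 2" "qm_bound k P (1 - p * g) t"
    using qm_norm_lessD[OF arch] by blast
  obtain s where s: "qm_bound k P g s"
    using qm_bound_exists[OF arch] by blast
  then have s0: "0 < s"
    by (simp add: qm_bound_def)
  let ?c = "\<lambda>r. cpoly_const (of_real r)"
  let ?r = "1 - p * g"
  \<comment> \<open>The lower bound \<open>2 |p g|\<^sup>2 \<ge> 1 - 2 |1 - p g|\<^sup>2 \<ge> 1 - 2 t\<^sup>2\<close>, divided by \<open>2 |g|\<^sup>2 \<le> 2 s\<^sup>2\<close>.\<close>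
  define c where "c = sqrt (1 - 2 * t\<^sup>2) / (sqrt 2 * s)"
  have t2: "2 * t\<^sup>2 < 1"
    using t power_strict_mono[of t "1 / 2" 2] by (auto simp: qm_bound_def power2_eq_square)
  have c: "0 < c" "2 * s\<^sup>2 * c\<^sup>2 = 1 - 2 * t\<^sup>2"
    using t2 s0 by (auto simp: c_def power_divide power_mult_distrib)
  have two: "?c 2 = 2"
    using cpoly_const.hom_numeral[of "num.Bit0 num.One"] by simp
  \<comment> \<open>\<open>2 (p g)\<^sup>* (p g) - 1 + 2 (1 - p g)\<^sup>* (1 - p g)\<close> is the Hermitian square of \<open>2 p g - 1\<close>.\<close>
  have "2 * hsq (p * g) + 2 * hsq ?r - 1 = hsq (2 * (p * g) - 1)"
    by (simp add: hsq_def adj_w.hom_minus in_z.hom_minus adj_w.hom_mult in_z.hom_mult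
        adj_w.hom_numeral in_z.hom_numeral algebra_simps)
  then have eq: "?c 2 * (hsq p * ?c (s\<^sup>2)) - ?c (1 - 2 * t\<^sup>2) =
      ?c 2 * ((?c (s\<^sup>2) - hsq g) * hsq p) + ?c 2 * (?c (t\<^sup>2) - hsq ?r) + hsq (2 * (p * g) - 1)"
    by (simp add: two hsq_mult cpoly_const.hom_minus cpoly_const.hom_mult cpoly_const.hom_numeral
        algebra_simps del: of_real_power)
  have "\<dots> \<in> quad_module k P"
    using s t(2)
    by (intro quad_module.add quad_module.square quad_module_scale quad_module_congruence)
      (auto simp: qm_bound_def)
  then have "?c (1 / (2 * s\<^sup>2)) * (?c 2 * (hsq p * ?c (s\<^sup>2)) - ?c (1 - 2 * t\<^sup>2)) \<in> quad_module k P"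
    unfolding eq by (intro quad_module_scale) auto
  moreover have "?c (1 / (2 * s\<^sup>2)) * (?c 2 * (hsq p * ?c (s\<^sup>2)) - ?c (1 - 2 * t\<^sup>2)) =
      ?c (1 / (2 * s\<^sup>2) * (2 * s\<^sup>2)) * hsq p - ?c (1 / (2 * s\<^sup>2) * (1 - 2 * t\<^sup>2))"
    by (simp only: right_diff_distrib cpoly_const.hom_mult of_real_mult mult_ac)
  moreover have "1 / (2 * s\<^sup>2) * (2 * s\<^sup>2) = 1" "1 / (2 * s\<^sup>2) * (1 - 2 * t\<^sup>2) = c\<^sup>2"
    using s0 by (simp_all flip: c(2))
  ultimately have "hsq p - ?c (c\<^sup>2) \<in> quad_module k P"
    by (simp only: of_real_1 cpoly_const.hom_one mult_1_left)
  with c(1) show ?thesis by (rule that)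
qed

section \<open>Contractions between vectors with equal Gram matrices\<close>

definition coord_inner :: "nat \<Rightarrow> (nat \<Rightarrow> complex) \<Rightarrow> (nat \<Rightarrow> complex) \<Rightarrow> complex"
  where "coord_inner n f g = (\<Sum>i<n. f i * cnj (g i))"

lemma coord_inner_add_left: "coord_inner n (\<lambda>i. f i + g i) h = coord_inner n f h + coord_inner n g h"
  by (simp add: coord_inner_def distrib_right sum.distrib)

lemma coord_inner_scale_left: "coord_inner n (\<lambda>i. c * f i) h = c * coord_inner n f h"
  by (simp add: coord_inner_def sum_distrib_left mult.assoc)

lemma coord_inner_sum_left: "coord_inner n (\<lambda>i. \<Sum>t\<in>T. f t i) h = (\<Sum>t\<in>T. coord_inner n (f t) h)"
  unfolding coord_inner_def sum_distrib_right by (rule sum.swap)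

lemma coord_inner_diff_left: "coord_inner n (\<lambda>i. f i - g i) h = coord_inner n f h - coord_inner n g h"
  by (simp add: coord_inner_def left_diff_distrib sum_subtractf)

lemma coord_inner_cnj: "cnj (coord_inner n f g) = coord_inner n g f"
  by (simp add: coord_inner_def mult.commute)

lemma coord_inner_self: "coord_inner n f f = of_real (\<Sum>i<n. (cmod (f i))\<^sup>2)"
  by (simp add: coord_inner_def complex_norm_square del: of_real_power)

lemma coord_inner_self_eq_0_iff: "coord_inner n f f = 0 \<longleftrightarrow> (\<forall>i<n. f i = 0)"
  unfolding coord_inner_self of_real_eq_0_iff
  by (subst sum_nonneg_eq_0_iff) auto

lemma coord_inner_cong:
  "(\<And>i. i < n \<Longrightarrow> f i = f' i) \<Longrightarrow> (\<And>i. i < n \<Longrightarrow> g i = g' i) \<Longrightarrow>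
    coord_inner n f g = coord_inner n f' g'"
  by (simp add: coord_inner_def)

text \<open>
  The graph of a linear isometry between subspaces of \<open>\<complex>\<^sup>A\<close> and \<open>\<complex>\<^sup>B\<close>, up to the coordinates
  beyond \<open>A\<close> and \<open>B\<close>, which are ignored.
\<close>

definition isometric_graph :: "nat \<Rightarrow> nat \<Rightarrow> ((nat \<Rightarrow> complex) \<times> (nat \<Rightarrow> complex)) set \<Rightarrow> bool"
  where "isometric_graph A B W \<longleftrightarrow>
    (\<lambda>_. 0, \<lambda>_. 0) \<in> W \<and>
    (\<forall>x y x' y' c. (x, y) \<in> W \<longrightarrow> (x', y') \<in> W \<longrightarrow>
      (\<lambda>i. x i + c * x' i, \<lambda>i. y i + c * y' i) \<in> W) \<and>
    (\<forall>x y. (x, y) \<in> W \<longrightarrow> coord_inner A x x = coord_inner B y y)"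

lemma isometric_graphD:
  assumes "isometric_graph A B W" "(x, y) \<in> W"
  shows "(x', y') \<in> W \<Longrightarrow> (\<lambda>i. x i + c * x' i, \<lambda>i. y i + c * y' i) \<in> W"
    and "coord_inner A x x = coord_inner B y y"
  using assms unfolding isometric_graph_def by simp_all

lemma isometric_graph_lincomb:
  assumes W: "isometric_graph A B W" and "(x, y) \<in> W" "\<And>t. t < (N :: nat) \<Longrightarrow> (e t, f t) \<in> W"
  shows "(\<lambda>i. x i + (\<Sum>t<N. c t * e t i), \<lambda>i. y i + (\<Sum>t<N. c t * f t i)) \<in> W"
  using assms(3)
proof (induction N)
  case 0
  then show ?case using assms(2) by simp
next
  case (Suc N)
  let ?x = "\<lambda>i. x i + (\<Sum>t<N. c t * e t i)" and ?y = "\<lambda>i. y i + (\<Sum>t<N. c t * f t i)"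
  have "(?x, ?y) \<in> W" "(e N, f N) \<in> W"
    using Suc by auto
  then have "(\<lambda>i. ?x i + c N * e N i, \<lambda>i. ?y i + c N * f N i) \<in> W"
    by (rule isometric_graphD(1)[OF W])
  then show ?case by (simp add: add.assoc)
qed

text \<open>
  Gram--Schmidt orthogonalization of the first components, with the same operations carried out on
  the second ones. If the residual of a first component vanishes, so does that of the second one,
  because both have the same norm.
\<close>

lemma isometric_graph_basis:
  assumes W: "isometric_graph A B W" and "finite S" and "\<forall>\<mu>\<in>S. (x \<mu>, y \<mu>) \<in> W"
  shows "\<exists>(N :: nat) e f. (\<forall>t<N. (e t, f t) \<in> W) \<and>
    (\<forall>s<N. \<forall>t<N. coord_inner A (e s) (e t) = (if s = t then 1 else 0)) \<and>
    (\<forall>\<mu>\<in>S. (\<forall>a<A. x \<mu> a = (\<Sum>t<N. coord_inner A (x \<mu>) (e t) * e t a)) \<and>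
      (\<forall>b<B. y \<mu> b = (\<Sum>t<N. coord_inner A (x \<mu>) (e t) * f t b)))"
  using assms(2,3)
proof (induction S rule: finite_induct)
  case empty
  show ?case by (rule exI[of _ 0]) simp
next
  case (insert \<mu> S)
  have xyS: "\<forall>\<nu>\<in>S. (x \<nu>, y \<nu>) \<in> W"
    using insert.prems by simp
  from insert.IH[OF xyS]
  obtain N :: nat and e f where basis: "(\<forall>t<N. (e t, f t) \<in> W) \<and>
    (\<forall>s<N. \<forall>t<N. coord_inner A (e s) (e t) = (if s = t then 1 else 0)) \<and>
    (\<forall>\<mu>\<in>S. (\<forall>a<A. x \<mu> a = (\<Sum>t<N. coord_inner A (x \<mu>) (e t) * e t a)) \<and>
      (\<forall>b<B. y \<mu> b = (\<Sum>t<N. coord_inner A (x \<mu>) (e t) * f t b)))"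
    by blast
  then have ef: "\<And>t. t < N \<Longrightarrow> (e t, f t) \<in> W"
    and orth: "\<And>s t. s < N \<Longrightarrow> t < N \<Longrightarrow> coord_inner A (e s) (e t) = (if s = t then 1 else 0)"
    and xS: "\<And>\<nu> a. \<nu> \<in> S \<Longrightarrow> a < A \<Longrightarrow> x \<nu> a = (\<Sum>t<N. coord_inner A (x \<nu>) (e t) * e t a)"
    and yS: "\<And>\<nu> b. \<nu> \<in> S \<Longrightarrow> b < B \<Longrightarrow> y \<nu> b = (\<Sum>t<N. coord_inner A (x \<nu>) (e t) * f t b)"
    by simp_all
  let ?c = "\<lambda>t. coord_inner A (x \<mu>) (e t)"
  define r where "r i = x \<mu> i + (\<Sum>t<N. - ?c t * e t i)" for i
  define q where "q i = y \<mu> i + (\<Sum>t<N. - ?c t * f t i)" for i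
  have rq: "(r, q) \<in> W"
    unfolding r_def[abs_def] q_def[abs_def]
    using insert.prems ef by (intro isometric_graph_lincomb[OF W]) auto
  have rnorm: "coord_inner A r r = coord_inner B q q"
    by (rule isometric_graphD(2)[OF W rq])
  have re: "coord_inner A r (e s) = 0" if "s < N" for s
  proof -
    have "coord_inner A r (e s) = ?c s + (\<Sum>t<N. - ?c t * coord_inner A (e t) (e s))"
      unfolding r_def[abs_def] coord_inner_add_left coord_inner_sum_left coord_inner_scale_left ..
    also have "(\<Sum>t<N. - ?c t * coord_inner A (e t) (e s)) = (\<Sum>t<N. if t = s then - ?c s else 0)"
      using that by (intro sum.cong) (auto simp: orth)
    finally show ?thesis using that by simp
  qed
  have er: "coord_inner A (e s) r = 0" if "s < N" for s
    using re[OF that] coord_inner_cnj[of A r "e s"] by simp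
  show ?case
  proof (cases "coord_inner A r r = 0")
    case True
    then have "\<forall>a<A. r a = 0" "\<forall>b<B. q b = 0"
      using rnorm by (simp_all add: coord_inner_self_eq_0_iff[symmetric])
    then have "\<forall>a<A. x \<mu> a = (\<Sum>t<N. ?c t * e t a)" "\<forall>b<B. y \<mu> b = (\<Sum>t<N. ?c t * f t b)"
      by (auto simp: r_def q_def sum_negf)
    then show ?thesis
      using ef orth xS yS
      by - (rule exI[of _ N], rule exI[of _ e], rule exI[of _ f], auto)
  next
    case False
    define s where "s = sqrt (\<Sum>i<A. (cmod (r i))\<^sup>2)"
    have "0 < (\<Sum>i<A. (cmod (r i))\<^sup>2)"
      using False sum_nonneg[of "{..<A}" "\<lambda>i. (cmod (r i))\<^sup>2"]
      unfolding coord_inner_self by (metis less_eq_real_def of_real_0 zero_le_power2)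
    then have s: "0 < s" "coord_inner A r r = of_real (s * s)"
      by (simp_all add: s_def coord_inner_self)
    define k where "k = complex_of_real (1 / s)"
    have k: "k * of_real s = 1" "cnj k = k"
      using s by (simp_all add: k_def)
    define e' where "e' = e(N := \<lambda>i. 0 + k * r i)"
    define f' where "f' = f(N := \<lambda>i. 0 + k * q i)"
    have e'N: "e' N = (\<lambda>i. k * r i)" "f' N = (\<lambda>i. k * q i)"
      by (simp_all add: e'_def f'_def)
    have e't: "e' t = e t" "f' t = f t" if "t < N" for t
      using that by (simp_all add: e'_def f'_def)
    have kright: "coord_inner A g (\<lambda>i. k * r i) = k * coord_inner A g r" for g
      using coord_inner_scale_left[of A k r g] k(2)
      by (metis coord_inner_cnj complex_cnj_mult)
    have inW: "(e' t, f' t) \<in> W" if "t < Suc N" for t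
    proof (cases "t = N")
      case True
      have "(\<lambda>i. 0 + k * r i, \<lambda>i. 0 + k * q i) \<in> W"
        using W by (intro isometric_graphD(1)[OF W _ rq]) (simp add: isometric_graph_def)
      then show ?thesis using True by (simp add: e'_def f'_def)
    next
      case False
      then show ?thesis using that ef by (simp add: e't)
    qed
    have kk: "k * (k * coord_inner A r r) = 1"
    proof -
      have "k * (k * coord_inner A r r) = (k * of_real s) * (k * of_real s)"
        unfolding s(2) by simp
      then show ?thesis by (simp add: k)
    qed
    have orth': "coord_inner A (e' t) (e' t') = (if t = t' then 1 else 0)"
      if "t < Suc N" "t' < Suc N" for t t'
    proof -
      consider "t < N" "t' < N" | "t = N" "t' < N" | "t < N" "t' = N" | "t = N" "t' = N"
        using \<open>t < Suc N\<close> \<open>t' < Suc N\<close> by linarith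
      then show ?thesis
        by cases (simp_all add: e't orth e'N(1) coord_inner_scale_left kright kk re er)
    qed
    have old: "coord_inner A (x \<nu>) (e' N) = 0" if "\<nu> \<in> S" for \<nu>
    proof -
      have "coord_inner A (x \<nu>) r = coord_inner A (\<lambda>a. \<Sum>t<N. coord_inner A (x \<nu>) (e t) * e t a) r"
        using xS[OF that] by (intro coord_inner_cong) auto
      also have "\<dots> = 0"
        unfolding coord_inner_sum_left coord_inner_scale_left by (simp add: er)
      finally show ?thesis by (simp add: e'N kright)
    qed
    have new: "coord_inner A (x \<mu>) (e' N) = of_real s"
    proof -
      have "coord_inner A (x \<mu>) r = coord_inner A (\<lambda>i. r i + (\<Sum>t<N. ?c t * e t i)) r"
        by (intro coord_inner_cong) (auto simp: r_def sum_negf)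
      also have "\<dots> = of_real (s * s)"
        unfolding coord_inner_add_left coord_inner_sum_left coord_inner_scale_left s(2)
        by (simp add: er)
      finally have "coord_inner A (x \<mu>) (e' N) = k * of_real s * of_real s"
        by (simp add: e'N kright)
      then show ?thesis by (simp add: k)
    qed
    have sk: "of_real s * (k * w) = w" for w
      using k by (metis mult.assoc mult.commute mult_1_left)
    show ?thesis
    proof (rule exI[of _ "Suc N"], rule exI[of _ e'], rule exI[of _ f'], intro conjI allI impI ballI)
      fix \<nu> a assume \<nu>: "\<nu> \<in> insert \<mu> S" and a: "a < A"
      show "x \<nu> a = (\<Sum>t<Suc N. coord_inner A (x \<nu>) (e' t) * e' t a)"
      proof (cases "\<nu> \<in> S")
        case True
        then show ?thesis using xS[OF True a] by (simp add: old e't)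
      next
        case False
        then have "\<nu> = \<mu>" using \<nu> by simp
        then show ?thesis by (simp add: new e't fun_cong[OF e'N(1)] sk) (simp add: r_def sum_negf)
      qed
    next
      fix \<nu> b assume \<nu>: "\<nu> \<in> insert \<mu> S" and b: "b < B"
      show "y \<nu> b = (\<Sum>t<Suc N. coord_inner A (x \<nu>) (e' t) * f' t b)"
      proof (cases "\<nu> \<in> S")
        case True
        then show ?thesis using yS[OF True b] by (simp add: old e't)
      next
        case False
        then have "\<nu> = \<mu>" using \<nu> by simp
        then show ?thesis by (simp add: new e't fun_cong[OF e'N(2)] sk) (simp add: q_def sum_negf)
      qed
    qed (rule inW orth'; assumption)+
  qed
qed

text \<open>
  The isometry \<open>x\<^sub>\<mu> \<mapsto> y\<^sub>\<mu>\<close> between the spans, extended by zero to the orthogonal complement.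
\<close>

lemma contraction_of_equal_gram:
  fixes x y :: "'i \<Rightarrow> nat \<Rightarrow> complex"
  assumes "finite S"
    and gram: "\<And>\<mu> \<nu>. \<mu> \<in> S \<Longrightarrow> \<nu> \<in> S \<Longrightarrow> coord_inner A (x \<mu>) (x \<nu>) = coord_inner B (y \<mu>) (y \<nu>)"
  obtains K :: "nat \<Rightarrow> nat \<Rightarrow> complex"
  where "\<And>\<mu> b. \<mu> \<in> S \<Longrightarrow> b < B \<Longrightarrow> y \<mu> b = (\<Sum>a<A. K b a * x \<mu> a)"
    and "\<And>v. (\<Sum>b<B. (cmod (\<Sum>a<A. K b a * v a))\<^sup>2) \<le> (\<Sum>a<A. (cmod (v a))\<^sup>2)"
proof -
  define W where "W = range (\<lambda>c. (\<lambda>a. \<Sum>\<mu>\<in>S. c \<mu> * x \<mu> a, \<lambda>b. \<Sum>\<mu>\<in>S. c \<mu> * y \<mu> b))"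
  have expand: "coord_inner n (\<lambda>a. \<Sum>\<mu>\<in>S. c \<mu> * g \<mu> a) (\<lambda>a. \<Sum>\<mu>\<in>S. c \<mu> * g \<mu> a) =
      (\<Sum>\<mu>\<in>S. c \<mu> * cnj (\<Sum>\<nu>\<in>S. c \<nu> * coord_inner n (g \<nu>) (g \<mu>)))" for n c and g :: "'i \<Rightarrow> nat \<Rightarrow> complex"
  proof -
    have "coord_inner n (g \<mu>) (\<lambda>a. \<Sum>\<nu>\<in>S. c \<nu> * g \<nu> a) = cnj (\<Sum>\<nu>\<in>S. c \<nu> * coord_inner n (g \<nu>) (g \<mu>))" for \<mu>
      by (subst coord_inner_cnj[symmetric]) (simp only: coord_inner_sum_left coord_inner_scale_left)
    then show ?thesis
      by (simp only: coord_inner_sum_left coord_inner_scale_left)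
  qed
  have W: "isometric_graph A B W"
    unfolding isometric_graph_def
  proof (intro conjI allI impI)
    show "(\<lambda>_. 0, \<lambda>_. 0) \<in> W"
      unfolding W_def by (rule range_eqI[of _ _ "\<lambda>_. 0"]) simp
  next
    fix u v u' v' c assume "(u, v) \<in> W" "(u', v') \<in> W"
    then obtain d d' where "u = (\<lambda>a. \<Sum>\<mu>\<in>S. d \<mu> * x \<mu> a)" "v = (\<lambda>b. \<Sum>\<mu>\<in>S. d \<mu> * y \<mu> b)"
      "u' = (\<lambda>a. \<Sum>\<mu>\<in>S. d' \<mu> * x \<mu> a)" "v' = (\<lambda>b. \<Sum>\<mu>\<in>S. d' \<mu> * y \<mu> b)"
      by (auto simp: W_def)
    then show "(\<lambda>i. u i + c * u' i, \<lambda>i. v i + c * v' i) \<in> W"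
      unfolding W_def
      by (intro range_eqI[of _ _ "\<lambda>\<mu>. d \<mu> + c * d' \<mu>"])
        (simp add: distrib_right sum.distrib sum_distrib_left mult.assoc)
  next
    fix u v assume "(u, v) \<in> W"
    then obtain d where "u = (\<lambda>a. \<Sum>\<mu>\<in>S. d \<mu> * x \<mu> a)" "v = (\<lambda>b. \<Sum>\<mu>\<in>S. d \<mu> * y \<mu> b)"
      by (auto simp: W_def)
    then show "coord_inner A u u = coord_inner B v v"
      by (simp only: expand) (simp add: gram)
  qed
  have "\<forall>\<mu>\<in>S. (x \<mu>, y \<mu>) \<in> W"
  proof
    fix \<mu> assume "\<mu> \<in> S"
    then show "(x \<mu>, y \<mu>) \<in> W"
      unfolding W_def using \<open>finite S\<close>
      by (intro range_eqI[of _ _ "\<lambda>\<nu>. if \<nu> = \<mu> then 1 else 0"])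
        (simp add: if_distrib[of "\<lambda>c. c * _"] cong: if_cong)
  qed
  from isometric_graph_basis[OF W \<open>finite S\<close> this]
  obtain N :: nat and e f where basis: "(\<forall>t<N. (e t, f t) \<in> W) \<and>
    (\<forall>s<N. \<forall>t<N. coord_inner A (e s) (e t) = (if s = t then 1 else 0)) \<and>
    (\<forall>\<mu>\<in>S. (\<forall>a<A. x \<mu> a = (\<Sum>t<N. coord_inner A (x \<mu>) (e t) * e t a)) \<and>
      (\<forall>b<B. y \<mu> b = (\<Sum>t<N. coord_inner A (x \<mu>) (e t) * f t b)))"
    by blast
  then have ef: "\<And>t. t < N \<Longrightarrow> (e t, f t) \<in> W"
    and orth: "\<And>s t. s < N \<Longrightarrow> t < N \<Longrightarrow> coord_inner A (e s) (e t) = (if s = t then 1 else 0)"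
    and y: "\<And>\<mu> b. \<mu> \<in> S \<Longrightarrow> b < B \<Longrightarrow> y \<mu> b = (\<Sum>t<N. coord_inner A (x \<mu>) (e t) * f t b)"
    by simp_all
  define K where "K b a = (\<Sum>t<N. f t b * cnj (e t a))" for b a
  have K: "(\<Sum>a<A. K b a * v a) = (\<Sum>t<N. coord_inner A v (e t) * f t b)" for v b
  proof -
    have "(\<Sum>a<A. K b a * v a) = (\<Sum>t<N. \<Sum>a<A. f t b * cnj (e t a) * v a)"
      unfolding K_def sum_distrib_right by (rule sum.swap)
    then show ?thesis
      by (simp add: coord_inner_def sum_distrib_right sum_distrib_left mult_ac)
  qed
  show ?thesis
  proof
    show "y \<mu> b = (\<Sum>a<A. K b a * x \<mu> a)" if "\<mu> \<in> S" "b < B" for \<mu> b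
      using y that by (simp add: K)
  next
    fix v :: "nat \<Rightarrow> complex"
    let ?c = "\<lambda>t. coord_inner A v (e t)"
    define g where "g a = 0 + (\<Sum>t<N. ?c t * e t a)" for a
    define h where "h b = 0 + (\<Sum>t<N. ?c t * f t b)" for b
    have "(g, h) \<in> W"
      unfolding g_def[abs_def] h_def[abs_def]
      using W ef by (intro isometric_graph_lincomb[OF W]) (auto simp: isometric_graph_def)
    then have gh: "coord_inner A g g = coord_inner B h h"
      by (rule isometric_graphD(2)[OF W])
    have ge: "coord_inner A g (e s) = ?c s" if "s < N" for s
    proof -
      have "coord_inner A g (e s) = (\<Sum>t<N. ?c t * coord_inner A (e t) (e s))"
        unfolding g_def by (simp only: add_0_left coord_inner_sum_left coord_inner_scale_left)
      also have "\<dots> = (\<Sum>t<N. if t = s then ?c s else 0)"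
        using that by (intro sum.cong) (auto simp: orth)
      finally show ?thesis using that by simp
    qed
    have right: "coord_inner A u g = (\<Sum>t<N. cnj (?c t) * coord_inner A u (e t))" for u
    proof -
      have "coord_inner A u g = cnj (coord_inner A g u)"
        by (simp add: coord_inner_cnj)
      also have "coord_inner A g u = (\<Sum>t<N. ?c t * coord_inner A (e t) u)"
        unfolding g_def by (simp only: add_0_left coord_inner_sum_left coord_inner_scale_left)
      finally show ?thesis
        by (simp add: coord_inner_cnj)
    qed
    \<comment> \<open>Bessel's inequality: \<open>g\<close> is the orthogonal projection of \<open>v\<close> to the span of the \<open>e t\<close>.\<close>
    have "coord_inner A (\<lambda>i. v i - g i) g = 0"
      unfolding coord_inner_diff_left right by (simp add: ge)
    then have "coord_inner A (\<lambda>i. v i - g i) (\<lambda>i. v i - g i) = coord_inner A (\<lambda>i. v i - g i) v"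
      using coord_inner_cnj[of A "\<lambda>i. v i - g i" g]
      by (subst (1 2) coord_inner_cnj[symmetric]) (simp add: coord_inner_diff_left)
    also have "\<dots> = coord_inner A v v - coord_inner A g v"
      by (rule coord_inner_diff_left)
    also have "coord_inner A g v = coord_inner A g g"
      using \<open>coord_inner A (\<lambda>i. v i - g i) g = 0\<close>
      by (metis coord_inner_cnj coord_inner_diff_left eq_iff_diff_eq_0)
    finally have "of_real (\<Sum>i<A. (cmod (v i - g i))\<^sup>2) =
        complex_of_real ((\<Sum>i<A. (cmod (v i))\<^sup>2) - (\<Sum>b<B. (cmod (h b))\<^sup>2))"
      unfolding gh unfolding coord_inner_self by simp
    then have "(\<Sum>i<A. (cmod (v i - g i))\<^sup>2) = (\<Sum>i<A. (cmod (v i))\<^sup>2) - (\<Sum>b<B. (cmod (h b))\<^sup>2)"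
      by (simp only: of_real_eq_iff)
    moreover have "0 \<le> (\<Sum>i<A. (cmod (v i - g i))\<^sup>2)"
      by (intro sum_nonneg) simp
    ultimately show "(\<Sum>b<B. (cmod (\<Sum>a<A. K b a * v a))\<^sup>2) \<le> (\<Sum>a<A. (cmod (v a))\<^sup>2)"
      unfolding K by (simp add: h_def)
  qed
qed

section \<open>Lurking contractions\<close>

lemma lookup_cpoly_const_mult: "Poly_Mapping.lookup (cpoly_const c * f) \<mu> = c * Poly_Mapping.lookup f \<mu>"
proof (induction f rule: poly_mapping_single_induct)
  case (single \<nu> d)
  then show ?case by (simp add: cpoly_const_def mult_single lookup_single when_def)
next
  case (add f g)
  then show ?case by (simp add: distrib_left lookup_add)
qed

text \<open>
  The lurking contraction argument: equality of sums of Hermitian squares means equality of the Gram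
  matrices of the coefficient vectors, and the contraction between these vectors acts on the
  polynomials themselves.
\<close>

lemma lurking_contraction:
  fixes u v :: "nat \<Rightarrow> 'd cpoly"
  assumes eq: "(\<Sum>a<A. hsq (u a)) = (\<Sum>b<B. hsq (v b))"
  obtains K :: "nat \<Rightarrow> nat \<Rightarrow> complex"
  where "\<And>b. b < B \<Longrightarrow> v b = (\<Sum>a<A. cpoly_const (K b a) * u a)"
    and "\<And>x. (\<Sum>b<B. (cmod (\<Sum>a<A. K b a * x a))\<^sup>2) \<le> (\<Sum>a<A. (cmod (x a))\<^sup>2)"
proof -
  let ?S = "(\<Union>a<A. Poly_Mapping.keys (u a)) \<union> (\<Union>b<B. Poly_Mapping.keys (v b))"
  have gram: "coord_inner A (\<lambda>a. Poly_Mapping.lookup (u a) \<mu>) (\<lambda>a. Poly_Mapping.lookup (u a) \<nu>) =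
      coord_inner B (\<lambda>b. Poly_Mapping.lookup (v b) \<mu>) (\<lambda>b. Poly_Mapping.lookup (v b) \<nu>)" for \<mu> \<nu>
    using arg_cong[OF eq, of "\<lambda>f. Poly_Mapping.lookup f (wz_monomial \<nu> \<mu>)"]
    by (simp add: coord_inner_def lookup_sum hsq_def lookup_adj_w_times_in_z mult.commute)
  obtain K where K: "\<And>\<mu> b. \<mu> \<in> ?S \<Longrightarrow> b < B \<Longrightarrow>
      Poly_Mapping.lookup (v b) \<mu> = (\<Sum>a<A. K b a * Poly_Mapping.lookup (u a) \<mu>)"
    and contr: "\<And>x. (\<Sum>b<B. (cmod (\<Sum>a<A. K b a * x a))\<^sup>2) \<le> (\<Sum>a<A. (cmod (x a))\<^sup>2)"
    by (rule contraction_of_equal_gram[of ?S A "\<lambda>\<mu> a. Poly_Mapping.lookup (u a) \<mu>" B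
          "\<lambda>\<mu> b. Poly_Mapping.lookup (v b) \<mu>"]) (use gram in auto)
  show ?thesis
  proof
    fix b assume b: "b < B"
    show "v b = (\<Sum>a<A. cpoly_const (K b a) * u a)"
    proof (rule poly_mapping_eqI)
      fix \<mu>
      show "Poly_Mapping.lookup (v b) \<mu> = Poly_Mapping.lookup (\<Sum>a<A. cpoly_const (K b a) * u a) \<mu>"
      proof (cases "\<mu> \<in> ?S")
        case True
        then show ?thesis
          using K b by (simp add: lookup_sum lookup_cpoly_const_mult)
      next
        case False
        then have "Poly_Mapping.lookup (v b) \<mu> = 0" "\<And>a. a < A \<Longrightarrow> Poly_Mapping.lookup (u a) \<mu> = 0"
          using b by (auto simp: in_keys_iff)
        then show ?thesis
          by (simp add: lookup_sum lookup_cpoly_const_mult)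
      qed
    qed
  qed (rule contr)
qed

section \<open>Block matrices and spectral norms\<close>

lemma sum_lessThan_add:
  fixes f :: "nat \<Rightarrow> 'a :: comm_monoid_add" and A B :: nat
  shows "(\<Sum>x<A + B. f x) = (\<Sum>x<A. f x) + (\<Sum>x<B. f (A + x))"
  by (induction B) (simp_all add: add.assoc)

lemma sum_blocks:
  fixes f :: "nat \<Rightarrow> 'a :: comm_monoid_add" and k :: nat
  shows "(\<Sum>x<(\<Sum>i<k. m i). f x) = (\<Sum>j<k. \<Sum>a<m j. f ((\<Sum>i<j. m i) + a))"
  by (induction k) (simp_all add: sum_lessThan_add)

lemma sum_grid:
  fixes f :: "nat \<Rightarrow> 'a :: comm_monoid_add"
  shows "(\<Sum>x<m * n. f x) = (\<Sum>a<m. \<Sum>b<n. f (a * n + b))"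
proof (induction m)
  case (Suc m)
  have "(\<Sum>x<Suc m * n. f x) = (\<Sum>x<m * n + n. f x)"
    by (simp add: add.commute)
  then show ?case by (simp add: sum_lessThan_add Suc)
qed simp

lemma block_index_less:
  fixes m :: "nat \<Rightarrow> nat" and k :: nat
  assumes "j < k" "a < m j"
  shows "(\<Sum>i<j. m i) + a < (\<Sum>i<k. m i)"
  using assms
proof (induction k)
  case (Suc k)
  then show ?case by (cases "j = k") auto
qed simp

lemma block_function_exists:
  fixes m :: "nat \<Rightarrow> nat" and k :: nat
  shows "\<exists>h. \<forall>j<k. \<forall>a<m j. h ((\<Sum>i<j. m i) + a) = g j a"
proof (induction k)
  case (Suc k)
  then obtain h where h: "\<And>j a. j < k \<Longrightarrow> a < m j \<Longrightarrow> h ((\<Sum>i<j. m i) + a) = g j a"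
    by blast
  let ?M = "\<Sum>i<k. m i"
  have "(if (\<Sum>i<j. m i) + a < ?M then h ((\<Sum>i<j. m i) + a) else g k ((\<Sum>i<j. m i) + a - ?M)) = g j a"
    if "j < Suc k" "a < m j" for j a
  proof (cases "j = k")
    case False
    then show ?thesis using that h block_index_less[of j k a m] by simp
  qed simp
  then show ?case
    by (intro exI[of _ "\<lambda>x. if x < ?M then h x else g k (x - ?M)"]) blast
qed simp

lemma grid_index_less:
  fixes a b m n :: nat
  assumes "a < m" "b < n"
  shows "a * n + b < m * n"
proof -
  have "a * n + b < Suc a * n"
    using assms by simp
  also have "\<dots> \<le> m * n"
    using assms by (intro mult_le_mono1) simp
  finally show ?thesis .
qed

lemma dim_mat_direct_sum:
  "dim_row (mat_direct_sum k P) = (\<Sum>i<k. dim_row (P i))"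
  "dim_col (mat_direct_sum k P) = (\<Sum>i<k. dim_col (P i))"
  by (simp_all add: mat_direct_sum_def dim_diag_block_mat sum_list_sum_nth atLeast0LessThan)

lemma mat_direct_sum_Suc:
  "mat_direct_sum (Suc k) P = four_block_mat (mat_direct_sum k P)
    (0\<^sub>m (dim_row (mat_direct_sum k P)) (dim_col (P k)))
    (0\<^sub>m (dim_row (P k)) (dim_col (mat_direct_sum k P))) (P k)"
  by (simp add: mat_direct_sum_def diag_block_mat_last Let_def)

text \<open>
  Rows of direct sums are used only through their products with columns, so this form
  avoids case distinctions on the column index.
\<close>

lemma mat_direct_sum_row:
  fixes P :: "nat \<Rightarrow> 'a :: semiring_1 mat"
  assumes "j < k" "r < dim_row (P j)"
  shows "(\<Sum>x<(\<Sum>i<k. dim_col (P i)). mat_direct_sum k P $$ ((\<Sum>i<j. dim_row (P i)) + r, x) * h x) =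
    (\<Sum>a<dim_col (P j). P j $$ (r, a) * h ((\<Sum>i<j. dim_col (P i)) + a))"
  using assms
proof (induction k)
  case (Suc k)
  let ?i = "(\<Sum>i<j. dim_row (P i)) + r"
  have lt: "?i < (\<Sum>i<Suc k. dim_row (P i))"
    using Suc.prems by (rule block_index_less)
  show ?case
  proof (cases "j = k")
    case True
    then show ?thesis
      using Suc.prems lt
      by (simp add: mat_direct_sum_Suc sum_lessThan_add dim_mat_direct_sum)
  next
    case False
    then have "?i < (\<Sum>i<k. dim_row (P i))"
      using Suc.prems by (intro block_index_less) auto
    then show ?thesis
      using Suc False lt
      by (simp add: mat_direct_sum_Suc sum_lessThan_add dim_mat_direct_sum)
  qed
qed simp

lemma dim_kron: "dim_row (kron A B) = dim_row A * dim_row B" "dim_col (kron A B) = dim_col A * dim_col B"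
  by (simp_all add: kron_def)

lemma kron_one_row:
  fixes Q :: "'a :: semiring_1 mat"
  assumes "r < dim_row Q" "b < n"
  shows "(\<Sum>x<dim_col Q * n. kron Q (1\<^sub>m n) $$ (r * n + b, x) * h x) =
    (\<Sum>a<dim_col Q. Q $$ (r, a) * h (a * n + b))"
proof -
  have "kron Q (1\<^sub>m n) $$ (r * n + b, a * n + c) = Q $$ (r, a) * (if b = c then 1 else 0)"
    if "a < dim_col Q" "c < n" for a c
    using assms that grid_index_less[of r "dim_row Q" b n] grid_index_less[of a "dim_col Q" c n]
    by (simp add: kron_def)
  then have "(\<Sum>x<dim_col Q * n. kron Q (1\<^sub>m n) $$ (r * n + b, x) * h x) =
      (\<Sum>a<dim_col Q. \<Sum>c<n. if c = b then Q $$ (r, a) * h (a * n + b) else 0)"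
    unfolding sum_grid by (intro sum.cong refl) auto
  then show ?thesis
    using assms by simp
qed

lemma l2_norm_vec_eq: "l2_norm_vec v = sqrt (\<Sum>i<dim_vec v. (cmod (v $ i))\<^sup>2)"
proof -
  have "v \<bullet>c v = coord_inner (dim_vec v) (\<lambda>i. v $ i) (\<lambda>i. v $ i)"
    by (simp add: scalar_prod_def coord_inner_def atLeast0LessThan)
  then show ?thesis
    by (simp add: l2_norm_vec_def coord_inner_self del: of_real_power of_real_sum)
qed

lemma mult_mat_vec_index:
  assumes "i < dim_row A" "dim_vec v = dim_col A"
  shows "(A *\<^sub>v v) $ i = (\<Sum>a<dim_col A. A $$ (i, a) * v $ a)"
  using assms by (simp add: scalar_prod_def atLeast0LessThan)

lemma spectral_norm_le_1:
  assumes "\<And>v :: nat \<Rightarrow> complex. (\<Sum>i<dim_row A. (cmod (\<Sum>a<dim_col A. A $$ (i, a) * v a))\<^sup>2) \<le>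
    (\<Sum>a<dim_col A. (cmod (v a))\<^sup>2)"
  shows "spectral_norm A \<le> 1"
  unfolding spectral_norm_def
proof (rule cSUP_least)
  show "{v \<in> carrier_vec (dim_col A). l2_norm_vec v \<le> 1} \<noteq> {}"
    by (auto simp: l2_norm_vec_eq intro!: exI[of _ "0\<^sub>v (dim_col A)"])
next
  fix v assume v: "v \<in> {v \<in> carrier_vec (dim_col A). l2_norm_vec v \<le> 1}"
  then have dim: "dim_vec v = dim_col A" by auto
  have "l2_norm_vec (A *\<^sub>v v) \<le> l2_norm_vec v"
    using assms[of "\<lambda>a. v $ a"] dim
    by (simp add: l2_norm_vec_eq mult_mat_vec_index del: index_mult_mat_vec)
  then show "l2_norm_vec (A *\<^sub>v v) \<le> 1"
    using v by simp
qed

lemma spectral_norm_matpoly_eval_le_1: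
  fixes P :: "nat \<Rightarrow> 'd :: finite cpoly mat"
  assumes "\<And>j v. j < k \<Longrightarrow>
    (\<Sum>r<dim_row (P j). (cmod (\<Sum>a<dim_col (P j). cpoly_eval (P j $$ (r, a)) z * v a))\<^sup>2)
    \<le> (\<Sum>a<dim_col (P j). (cmod (v a))\<^sup>2)"
  shows "spectral_norm (matpoly_eval (mat_direct_sum k P) z) \<le> 1"
proof (rule spectral_norm_le_1)
  fix v :: "nat \<Rightarrow> complex"
  let ?Q = "mat_direct_sum k P"
  let ?L = "\<Sum>i<k. dim_row (P i)" and ?M = "\<Sum>i<k. dim_col (P i)"
  have row: "(\<Sum>x<?M. cpoly_eval (?Q $$ ((\<Sum>i<j. dim_row (P i)) + r, x)) z * v x) =
      (\<Sum>a<dim_col (P j). cpoly_eval (P j $$ (r, a)) z * v ((\<Sum>i<j. dim_col (P i)) + a))"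
    if "j < k" "r < dim_row (P j)" for j r
    using arg_cong[OF mat_direct_sum_row[where P = P and h = "\<lambda>x. cpoly_const (v x)", OF that],
        of "\<lambda>f. cpoly_eval f z"]
    by (simp add: cpoly_eval.hom_sum cpoly_eval.hom_mult)
  define F where "F i = (cmod (\<Sum>x<?M. cpoly_eval (?Q $$ (i, x)) z * v x))\<^sup>2" for i
  have "(\<Sum>i<?L. F i) = (\<Sum>j<k. \<Sum>r<dim_row (P j). F ((\<Sum>i<j. dim_row (P i)) + r))"
    by (rule sum_blocks)
  also have "\<dots> \<le> (\<Sum>j<k. \<Sum>a<dim_col (P j). (cmod (v ((\<Sum>i<j. dim_col (P i)) + a)))\<^sup>2)"
  proof (intro sum_mono)
    fix j assume "j \<in> {..<k}"
    then show "(\<Sum>r<dim_row (P j). F ((\<Sum>i<j. dim_row (P i)) + r))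
        \<le> (\<Sum>a<dim_col (P j). (cmod (v ((\<Sum>i<j. dim_col (P i)) + a)))\<^sup>2)"
      using assms[of j "\<lambda>a. v ((\<Sum>i<j. dim_col (P i)) + a)"] by (simp add: F_def row)
  qed
  also have "\<dots> = (\<Sum>x<?M. (cmod (v x))\<^sup>2)"
    by (rule sum_blocks[symmetric])
  finally have "(\<Sum>i<?L. F i) \<le> (\<Sum>x<?M. (cmod (v x))\<^sup>2)" .
  then show "(\<Sum>i<dim_row (matpoly_eval ?Q z). (cmod (\<Sum>a<dim_col (matpoly_eval ?Q z).
      matpoly_eval ?Q z $$ (i, a) * v a))\<^sup>2) \<le> (\<Sum>a<dim_col (matpoly_eval ?Q z). (cmod (v a))\<^sup>2)"
    by (simp add: F_def matpoly_eval_def dim_mat_direct_sum)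
qed

lemma dim_amplified_sum:
  "dim_row (amplified_sum k n P) = (\<Sum>i<k. dim_row (P i) * n i)"
  "dim_col (amplified_sum k n P) = (\<Sum>i<k. dim_col (P i) * n i)"
  by (simp_all add: amplified_sum_def dim_mat_direct_sum dim_kron)

lemma amplified_sum_row:
  fixes P :: "nat \<Rightarrow> 'a :: semiring_1 mat"
  assumes "j < k" "r < dim_row (P j)" "b < n j"
  shows "(\<Sum>x<(\<Sum>i<k. dim_col (P i) * n i).
      amplified_sum k n P $$ ((\<Sum>i<j. dim_row (P i) * n i) + (r * n j + b), x) * h x) =
    (\<Sum>a<dim_col (P j). P j $$ (r, a) * h ((\<Sum>i<j. dim_col (P i) * n i) + (a * n j + b)))"
  using mat_direct_sum_row[of j k "r * n j + b" "\<lambda>i. kron (P i) (1\<^sub>m (n i))" h] assms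
    grid_index_less[OF assms(2,3)] kron_one_row[where Q = "P j", OF assms(2,3)]
  by (simp add: amplified_sum_def dim_kron)

section \<open>Determinants of realizations\<close>

lemma det_replace_last_col:
  fixes M :: "'a :: comm_ring_1 mat"
  assumes M: "M \<in> carrier_mat (Suc n) (Suc n)"
  shows "Determinant.det (replace_col M (vec (Suc n) (\<lambda>i. if i = n then c else 0)) n) =
    c * Determinant.det (mat n n (\<lambda>(i, j). M $$ (i, j)))"
proof -
  let ?R = "replace_col M (vec (Suc n) (\<lambda>i. if i = n then c else 0)) n"
  have R: "?R \<in> carrier_mat (Suc n) (Suc n)"
    using M by (simp add: replace_col_def)
  have "Determinant.det ?R = (\<Sum>i<Suc n. ?R $$ (i, n) * cofactor ?R i n)"
    by (rule laplace_expansion_column[OF R]) simp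
  also have "\<dots> = (\<Sum>i<Suc n. if i = n then c * cofactor ?R n n else 0)"
    using M by (intro sum.cong) (auto simp: replace_col_def)
  also have "\<dots> = c * cofactor ?R n n"
    by simp
  also have "mat_delete ?R n n = mat n n (\<lambda>(i, j). M $$ (i, j))"
    using M by (intro eq_matI) (auto simp: mat_delete_def replace_col_def insert_index_def)
  then have "cofactor ?R n n = Determinant.det (mat n n (\<lambda>(i, j). M $$ (i, j)))"
    by (simp add: cofactor_def)
  finally show ?thesis .
qed

text \<open>
  The hypotheses say \<open>H = A X H + B p\<close> and \<open>c = C X H + D p\<close>, that is, \<open>c / p = D + C X (I - A X)\<inverse> B\<close>
  with \<open>X\<close> in the role of the variable. So the matrix \<open>E\<close> with rows \<open>(I - A X, - B)\<close> and \<open>(C X, D)\<close> maps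
  \<open>(H, p)\<close> to \<open>(0, c)\<close>, and Cramer's rule for the last coordinate reads \<open>p det E = c det (I - A X)\<close>.
\<close>

lemma det_of_realization:
  fixes X :: "'a :: comm_ring_1 mat" and H :: "nat \<Rightarrow> 'a"
  assumes X: "X \<in> carrier_mat L M" and A: "A \<in> carrier_mat M L"
    and H: "\<And>i. i < M \<Longrightarrow> H i = (\<Sum>s<L. A $$ (i, s) * (\<Sum>x<M. X $$ (s, x) * H x)) + B i * p"
    and c: "c = (\<Sum>s<L. C s * (\<Sum>x<M. X $$ (s, x) * H x)) + D * p"
  shows "\<exists>q. p * q = c * Determinant.det (1\<^sub>m M - A * X)"
proof -
  define E where "E = mat (Suc M) (Suc M) (\<lambda>(i, j).
    if i < M then if j < M then (1\<^sub>m M - A * X) $$ (i, j) else - B i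
    else if j < M then (\<Sum>s<L. C s * X $$ (s, j)) else D)"
  have E: "E \<in> carrier_mat (Suc M) (Suc M)"
    by (simp add: E_def)
  let ?h = "vec (Suc M) (\<lambda>i. if i = M then p else H i)"
  have swap: "(\<Sum>x<M. (\<Sum>s<L. a s * X $$ (s, x)) * H x) = (\<Sum>s<L. a s * (\<Sum>x<M. X $$ (s, x) * H x))" for a
    unfolding sum_distrib_right sum_distrib_left mult.assoc by (rule sum.swap)
  have AX: "(A * X) $$ (i, x) = (\<Sum>s<L. A $$ (i, s) * X $$ (s, x))" if "i < M" "x < M" for i x
    using that A X by (simp add: scalar_prod_def atLeast0LessThan)
  have "E *\<^sub>v ?h = vec (Suc M) (\<lambda>i. if i = M then c else 0)"
  proof (rule eq_vecI)
    fix i assume "i < dim_vec (vec (Suc M) (\<lambda>i. if i = M then c else 0))"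
    then have i: "i < Suc M" by simp
    have "(E *\<^sub>v ?h) $ i = (\<Sum>j<M. E $$ (i, j) * H j) + E $$ (i, M) * p"
      using E i by (simp add: mult_mat_vec_index del: index_mult_mat_vec)
    also have "\<dots> = (if i = M then c else 0)"
    proof (cases "i = M")
      case True
      then show ?thesis
        by (simp add: E_def swap c)
    next
      case False
      then have i: "i < M" using i by simp
      have "(\<Sum>j<M. E $$ (i, j) * H j) =
          (\<Sum>j<M. (if j = i then H i else 0) - (\<Sum>s<L. A $$ (i, s) * X $$ (s, j)) * H j)"
        using i A X by (intro sum.cong) (auto simp: E_def AX left_diff_distrib simp del: index_mult_mat(1))
      also have "\<dots> = B i * p"
        using i H[OF i] by (simp add: sum_subtractf swap)
      finally show ?thesis using i by (simp add: E_def)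
    qed
    finally show "(E *\<^sub>v ?h) $ i = vec (Suc M) (\<lambda>i. if i = M then c else 0) $ i"
      using i by simp
  qed (use E in simp)
  then have "Determinant.det (replace_col E (vec (Suc M) (\<lambda>i. if i = M then c else 0)) M) =
      ?h $ M * Determinant.det E"
    using cramer_lemma_mat[OF E, of ?h M] by simp
  moreover have "mat M M (\<lambda>(i, j). E $$ (i, j)) = 1\<^sub>m M - A * X"
    using A X by (intro eq_matI) (auto simp: E_def)
  ultimately have "p * Determinant.det E = c * Determinant.det (1\<^sub>m M - A * X)"
    by (simp add: det_replace_last_col[OF E])
  then show ?thesis by blast
qed

section \<open>One-dimensional Hilbert spaces and the approximation condition\<close>

text \<open>
  A copy of the Hilbert space \<open>\<complex>\<close> inside another type, transported along an injection \<open>e\<close>.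
\<close>

definition line_space :: "(complex \<Rightarrow> 'h) \<Rightarrow> 'h hilbert"
  where "line_space e = \<lparr>carrier = range e,
    mult = (\<lambda>x y. e (the_inv e x * the_inv e y)), one = e 1,
    zero = e 0, add = (\<lambda>x y. e (the_inv e x + the_inv e y)),
    smult = (\<lambda>c x. e (c * the_inv e x)), cinner = (\<lambda>x y. the_inv e x * cnj (the_inv e y))\<rparr>"

locale scalar_line =
  fixes e :: "complex \<Rightarrow> 'h"
  assumes inj: "inj e"
begin

abbreviation H :: "'h hilbert" where "H \<equiv> line_space e"

lemma the_inv_e [simp]: "the_inv e (e x) = x"
  by (rule the_inv_f_f[OF inj])

lemma line_simps [simp]:
  "carrier H = range e" "\<zero>\<^bsub>H\<^esub> = e 0" "e x \<oplus>\<^bsub>H\<^esub> e y = e (x + y)" "c \<odot>\<^bsub>H\<^esub> e x = e (c * x)"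
  "cinner H (e x) (e y) = x * cnj y"
  by (simp_all add: line_space_def)

lemma hnorm_e [simp]: "hnorm H (e x) = cmod x"
  by (simp add: hnorm_def cmod_def power2_eq_square)

lemma abelian_group_H: "abelian_group H"
proof (rule abelian_groupI)
  fix x assume "x \<in> carrier H"
  then obtain a where "x = e a" by auto
  then have "e (- a) \<oplus>\<^bsub>H\<^esub> x = \<zero>\<^bsub>H\<^esub>" by simp
  then show "\<exists>y\<in>carrier H. y \<oplus>\<^bsub>H\<^esub> x = \<zero>\<^bsub>H\<^esub>" by auto
qed (auto simp: add_ac)

lemma minus_e [simp]: "e x \<ominus>\<^bsub>H\<^esub> e y = e (x - y)"
proof -
  interpret abelian_group H by (rule abelian_group_H)
  have "\<ominus>\<^bsub>H\<^esub> e y = e (- y)"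
    by (rule minus_equality) auto
  then show ?thesis by (simp add: a_minus_def)
qed

lemma module_H: "module class_ring H"
proof (rule moduleI)
  show "cring (class_ring :: complex ring)"
    by (rule class_cring.cring_axioms)
qed (auto simp: abelian_group_H class_ring_simps algebra_simps)

lemma complex_hilbert_space_H: "complex_hilbert_space H"
proof -
  have pos: "0 < Im x * Im x + Re x * Re x" if "x \<noteq> 0" for x
    using that by (auto simp: sum_squares_gt_zero_iff complex_eq_iff)
  have "vectorspace class_ring H"
    by (intro vectorspace.intro module_H class_field.field_axioms)
  then show ?thesis
  proof (rule complex_hilbert_space.intro, unfold_locales)
    fix X :: "nat \<Rightarrow> 'h"
    assume X: "\<And>n. X n \<in> carrier H"
      and cauchy: "\<forall>e'>0. \<exists>N. \<forall>m\<ge>N. \<forall>n\<ge>N. hnorm H (X m \<ominus>\<^bsub>H\<^esub> X n) < e'"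
    define Y where "Y n = the_inv e (X n)" for n
    have XY: "X n = e (Y n)" for n
      using X[of n] by (auto simp: Y_def)
    have "Cauchy Y"
      using cauchy by (simp add: XY Cauchy_def dist_norm)
    then obtain y where "Y \<longlonglongrightarrow> y"
      using convergent_eq_Cauchy by blast
    then have "(\<lambda>n. cmod (Y n - y)) \<longlonglongrightarrow> 0"
      by (simp add: tendsto_norm_zero_iff LIM_zero_iff)
    then show "\<exists>x\<in>carrier H. (\<lambda>n. hnorm H (X n \<ominus>\<^bsub>H\<^esub> x)) \<longlonglongrightarrow> 0"
      by (intro bexI[of _ "e y"]) (auto simp: XY)
  qed (auto simp: algebra_simps intro: pos)
qed

lemma finsum_e:
  assumes "finite S" "\<And>i. i \<in> S \<Longrightarrow> F i = e (g i)"
  shows "finsum H F S = e (\<Sum>i\<in>S. g i)"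
proof -
  interpret abelian_group H by (rule abelian_group_H)
  show ?thesis
    using assms
  proof (induction S rule: finite_induct)
    case empty
    show ?case by (simp only: finsum_empty line_simps sum.empty)
  next
    case (insert i S)
    have "finsum H F (insert i S) = F i \<oplus>\<^bsub>H\<^esub> finsum H F S"
      using insert by (intro finsum_insert) auto
    then show ?case using insert by simp
  qed
qed

lemma monomial_op_e:
  fixes T :: "'d :: {finite, linorder} \<Rightarrow> 'h \<Rightarrow> 'h"
  assumes T: "\<And>i x. T i (e x) = e (vec_nth z i * x)"
  shows "monomial_op T \<mu> (e x) = e (monomial_val (vec_nth z) \<mu> * x)"
proof -
  have pow: "(T i ^^ n) (e x) = e (vec_nth z i ^ n * x)" for i n x
    by (induction n arbitrary: x) (simp_all add: T mult_ac)
  have "foldr (\<lambda>i A. (T i ^^ Poly_Mapping.lookup \<mu> i) \<circ> A) xs id (e x) =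
      e ((\<Prod>i\<leftarrow>xs. vec_nth z i ^ Poly_Mapping.lookup \<mu> i) * x)" for xs
    by (induction xs) (simp_all add: pow mult_ac)
  moreover have "(\<Prod>i\<leftarrow>sorted_list_of_set UNIV. vec_nth z i ^ Poly_Mapping.lookup \<mu> i) =
      monomial_val (vec_nth z) \<mu>"
    by (subst monomial_val_superset[of UNIV]) (simp_all add: prod.distinct_set_conv_list[symmetric])
  ultimately show ?thesis
    by (simp add: monomial_op_def)
qed

lemma matpoly_op_e:
  fixes T :: "'d :: {finite, linorder} \<Rightarrow> 'h \<Rightarrow> 'h"
  assumes T: "\<And>i x. T i (e x) = e (vec_nth z i * x)"
    and h: "\<And>b. b < dim_col Q \<Longrightarrow> h b = e (v b)"
  shows "matpoly_op H Q T h a = e (\<Sum>b<dim_col Q. cpoly_eval (Q $$ (a, b)) z * v b)"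
  unfolding matpoly_op_def
proof (rule finsum_e)
  fix b assume "b \<in> {..<dim_col Q}"
  then have hb: "h b = e (v b)" using h by simp
  have "(\<Oplus>\<^bsub>H\<^esub>\<mu>\<in>Poly_Mapping.keys (Q $$ (a, b)).
      Poly_Mapping.lookup (Q $$ (a, b)) \<mu> \<odot>\<^bsub>H\<^esub> monomial_op T \<mu> (h b)) =
      e (\<Sum>\<mu>\<in>Poly_Mapping.keys (Q $$ (a, b)).
        Poly_Mapping.lookup (Q $$ (a, b)) \<mu> * (monomial_val (vec_nth z) \<mu> * v b))"
    by (rule finsum_e) (simp_all add: hb monomial_op_e[OF T])
  then show "(\<Oplus>\<^bsub>H\<^esub>\<mu>\<in>Poly_Mapping.keys (Q $$ (a, b)).
      Poly_Mapping.lookup (Q $$ (a, b)) \<mu> \<odot>\<^bsub>H\<^esub> monomial_op T \<mu> (h b)) =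
      e (cpoly_eval (Q $$ (a, b)) z * v b)"
    by (simp add: cpoly_eval_def cpoly_subst_def monomial_val_def sum_distrib_right mult.assoc)
qed simp

lemma matpoly_op_norm_e:
  fixes T :: "'d :: {finite, linorder} \<Rightarrow> 'h \<Rightarrow> 'h"
  assumes T: "\<And>i x. T i (e x) = e (vec_nth z i * x)"
  shows "matpoly_op_norm H Q T = spectral_norm (matpoly_eval Q z)"
proof -
  let ?A = "matpoly_eval Q z"
  let ?v = "\<lambda>h. vec (dim_col Q) (\<lambda>b. the_inv e (h b))"
  have dim: "dim_row ?A = dim_row Q" "dim_col ?A = dim_col Q"
    by (simp_all add: matpoly_eval_def)
  have tuple: "hnorm_tuple H n h = l2_norm_vec (vec n g)" if "\<And>b. b < n \<Longrightarrow> h b = e (g b)" for n h g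
    using that by (simp add: hnorm_tuple_def l2_norm_vec_eq)
  have op: "hnorm_tuple H (dim_row Q) (matpoly_op H Q T h) = l2_norm_vec (?A *\<^sub>v v)"
    if "dim_vec v = dim_col Q" "\<And>b. b < dim_col Q \<Longrightarrow> h b = e (v $ b)" for h v
  proof -
    have "hnorm_tuple H (dim_row Q) (matpoly_op H Q T h) =
        l2_norm_vec (vec (dim_row Q) (\<lambda>a. \<Sum>b<dim_col Q. cpoly_eval (Q $$ (a, b)) z * v $ b))"
      by (rule tuple) (rule matpoly_op_e[OF T that(2)])
    also have "vec (dim_row Q) (\<lambda>a. \<Sum>b<dim_col Q. cpoly_eval (Q $$ (a, b)) z * v $ b) = ?A *\<^sub>v v"
      using that(1)
      by (intro eq_vecI) (simp_all add: mult_mat_vec_index dim matpoly_eval_def del: index_mult_mat_vec)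
    finally show ?thesis .
  qed
  have "(\<lambda>h. hnorm_tuple H (dim_row Q) (matpoly_op H Q T h)) `
      {h. (\<forall>b<dim_col Q. h b \<in> carrier H) \<and> hnorm_tuple H (dim_col Q) h \<le> 1} =
    (\<lambda>v. l2_norm_vec (?A *\<^sub>v v)) ` {v \<in> carrier_vec (dim_col ?A). l2_norm_vec v \<le> 1}"
  proof (intro equalityI image_subsetI)
    fix h assume h: "h \<in> {h. (\<forall>b<dim_col Q. h b \<in> carrier H) \<and> hnorm_tuple H (dim_col Q) h \<le> 1}"
    then have he: "h b = e (the_inv e (h b))" if "b < dim_col Q" for b
      using that by (auto simp: f_the_inv_into_f[OF inj])
    then have "l2_norm_vec (?v h) \<le> 1"
      using h tuple[of "dim_col Q" h "\<lambda>b. the_inv e (h b)"] by simp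
    moreover have "hnorm_tuple H (dim_row Q) (matpoly_op H Q T h) = l2_norm_vec (?A *\<^sub>v ?v h)"
      using he by (intro op) simp_all
    ultimately show "hnorm_tuple H (dim_row Q) (matpoly_op H Q T h) \<in>
        (\<lambda>v. l2_norm_vec (?A *\<^sub>v v)) ` {v \<in> carrier_vec (dim_col ?A). l2_norm_vec v \<le> 1}"
      by (intro image_eqI[of _ _ "?v h"]) (simp_all add: dim)
  next
    fix v assume v: "v \<in> {v \<in> carrier_vec (dim_col ?A). l2_norm_vec v \<le> 1}"
    let ?h = "\<lambda>b. e (v $ b)"
    have dv: "dim_vec v = dim_col Q" and v1: "l2_norm_vec v \<le> 1"
      using v by (auto simp: dim)
    have "hnorm_tuple H (dim_col Q) ?h = l2_norm_vec (vec (dim_col Q) (($) v))"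
      by (rule tuple) simp
    also have "vec (dim_col Q) (($) v) = v"
      using dv by (intro eq_vecI) auto
    finally have "hnorm_tuple H (dim_col Q) ?h \<le> 1"
      using v1 by simp
    moreover have "l2_norm_vec (?A *\<^sub>v v) = hnorm_tuple H (dim_row Q) (matpoly_op H Q T ?h)"
      using dv by (intro op[symmetric]) simp_all
    ultimately show "l2_norm_vec (?A *\<^sub>v v) \<in> (\<lambda>h. hnorm_tuple H (dim_row Q) (matpoly_op H Q T h)) `
        {h. (\<forall>b<dim_col Q. h b \<in> carrier H) \<and> hnorm_tuple H (dim_col Q) h \<le> 1}"
      by (intro image_eqI[of _ _ ?h]) simp_all
  qed
  then show ?thesis
    unfolding matpoly_op_norm_def spectral_norm_def by simp
qed

lemma bounded_operator_eq_scalar: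
  assumes "bounded_operator H S"
  shows "S (e x) = e (the_inv e (S (e 1)) * x)"
proof -
  have "S (e 1) \<in> range e"
    using assms by (simp add: bounded_operator_def)
  then obtain s where s: "S (e 1) = e s" by auto
  have "S (x \<odot>\<^bsub>H\<^esub> e 1) = x \<odot>\<^bsub>H\<^esub> S (e 1)"
    using assms unfolding bounded_operator_def by (metis line_simps(1) rangeI)
  then show ?thesis by (simp add: s mult.commute)
qed

lemma op_norm_e:
  assumes "\<And>x. A (e x) = e (s * x)"
  shows "op_norm H A = cmod s"
  unfolding op_norm_def
proof (rule cSup_eq_maximum)
  show "cmod s \<in> (\<lambda>x. hnorm H (A x)) ` {x \<in> carrier H. hnorm H x \<le> 1}"
    by (rule image_eqI[of _ _ "e 1"]) (simp_all add: assms)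
  show "t \<le> cmod s" if "t \<in> (\<lambda>x. hnorm H (A x)) ` {x \<in> carrier H. hnorm H x \<le> 1}" for t
    using that by (auto simp: assms norm_mult mult_left_le)
qed

lemma scalar_tuple_commuting: "commuting_tuple H (\<lambda>i x. e (z i * the_inv e x))"
proof -
  have "bounded_operator H (\<lambda>x. e (z i * the_inv e x))" for i
    unfolding bounded_operator_def
    by (auto simp: distrib_left mult_ac norm_mult intro!: exI[of _ "cmod (z i)"])
  then show ?thesis
    by (simp add: commuting_tuple_def mult_ac)
qed

text \<open>
  On \<open>\<complex>\<close>, commuting tuples of operators are points, and the operator norm of the matrix polynomial is the
  spectral norm of its value. Thus the approximation condition contains the statement that
  \<open>\<parallel>Q(z)\<parallel> \<le> 1\<close> describes no more than the closure of the domain.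
\<close>

lemma closure_poly_domain:
  fixes Q :: "'d :: {finite, linorder} cpoly mat"
  assumes approx: "approximation_condition TYPE('h) Q" and z: "spectral_norm (matpoly_eval Q z) \<le> 1"
  shows "z \<in> closure (poly_domain Q)"
proof -
  define T where "T i x = e (vec_nth z i * the_inv e x)" for i x
  have T: "T i (e x) = e (vec_nth z i * x)" for i x
    by (simp add: T_def)
  have "commuting_tuple H T"
    unfolding T_def[abs_def] by (rule scalar_tuple_commuting)
  moreover have "matpoly_op_norm H Q T \<le> 1"
    using z by (simp add: matpoly_op_norm_e[OF T])
  ultimately have "\<exists>S :: nat \<Rightarrow> 'd \<Rightarrow> 'h \<Rightarrow> 'h. (\<forall>r. S r \<in> op_class H Q) \<and>
      (\<forall>i. (\<lambda>r. op_norm H (\<lambda>x. S r i x \<ominus>\<^bsub>H\<^esub> T i x)) \<longlonglongrightarrow> 0)"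
    using approx complex_hilbert_space_H unfolding approximation_condition_def by blast
  then obtain S where S: "\<And>r :: nat. S r \<in> op_class H Q"
    and lim: "\<And>i. (\<lambda>r. op_norm H (\<lambda>x. S r i x \<ominus>\<^bsub>H\<^esub> T i x)) \<longlonglongrightarrow> 0"
    by blast
  define s where "s r = vec_lambda (\<lambda>i. the_inv e (S r i (e 1)))" for r
  have Ss: "S r i (e x) = e (vec_nth (s r) i * x)" for r i x
    using bounded_operator_eq_scalar[of "S r i" x] S[of r]
    by (simp add: s_def op_class_def commuting_tuple_def)
  have "s r \<in> poly_domain Q" for r
    using S[of r] by (simp add: poly_domain_def op_class_def matpoly_op_norm_e[OF Ss])
  moreover have "s \<longlonglongrightarrow> z"
  proof (rule vec_tendstoI)
    fix i
    have "op_norm H (\<lambda>x. S r i x \<ominus>\<^bsub>H\<^esub> T i x) = cmod (vec_nth (s r) i - vec_nth z i)" for r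
      by (rule op_norm_e) (simp add: Ss T left_diff_distrib)
    then have "(\<lambda>r. cmod (vec_nth (s r) i - vec_nth z i)) \<longlonglongrightarrow> 0"
      using lim[of i] by simp
    then show "(\<lambda>r. vec_nth (s r) i) \<longlonglongrightarrow> vec_nth z i"
      by (simp add: tendsto_norm_zero_iff LIM_zero_iff)
  qed
  ultimately show ?thesis
    unfolding closure_sequential by blast
qed

end

lemma complex_lepoll_real: "(UNIV :: complex set) \<lesssim> (UNIV :: real set)"
proof -
  have "(card_of ((UNIV :: real set) \<times> (UNIV :: real set)), card_of (UNIV :: real set)) \<in> ordIso"
    by (rule card_of_Times_same_infinite) (rule infinite_UNIV_char_0)
  then obtain f :: "real \<times> real \<Rightarrow> real" where "bij_betw f (UNIV \<times> UNIV) UNIV"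
    using card_of_ordIso by blast
  then have f: "inj f"
    by (simp add: bij_betw_def)
  have "inj (\<lambda>w. f (Re w, Im w))"
    by (auto intro!: injI complex_eqI dest: injD[OF f])
  then show ?thesis
    unfolding lepoll_def by blast
qed

section \<open>The determinantal representation\<close>

lemma matpoly_simps:
  "dim_row (matpoly_z Q) = dim_row Q" "dim_col (matpoly_z Q) = dim_col Q"
  "dim_row (matpoly_adj_w Q) = dim_col Q" "dim_col (matpoly_adj_w Q) = dim_row Q"
  "a < dim_row Q \<Longrightarrow> b < dim_col Q \<Longrightarrow> matpoly_z Q $$ (a, b) = in_z (Q $$ (a, b))"
  "a < dim_row Q \<Longrightarrow> b < dim_col Q \<Longrightarrow> matpoly_adj_w Q $$ (b, a) = adj_w (Q $$ (a, b))"
  by (simp_all add: matpoly_z_def matpoly_adj_w_def in_z_def adj_w_def)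

lemma mult_mat_index:
  assumes "i < dim_row A" "j < dim_col B" "dim_row B = dim_col A"
  shows "(A * B) $$ (i, j) = (\<Sum>x<dim_col A. A $$ (i, x) * B $$ (x, j))"
  using assms by (simp add: scalar_prod_def atLeast0LessThan)

lemma square_in_quad_module:
  assumes "H \<in> carrier_mat n 1"
  shows "(matpoly_adj_w H * matpoly_z H) $$ (0, 0) \<in> quad_module k P"
proof -
  have "(matpoly_adj_w H * matpoly_z H) $$ (0, 0) = (\<Sum>i<n. hsq (H $$ (i, 0)))"
    using assms by (simp add: mult_mat_index matpoly_simps hsq_def del: index_mult_mat(1))
  then show ?thesis
    by (auto intro: quad_module_sum quad_module.square)
qed

text \<open>
  The term \<open>H\<^sup>*(w) ((I - Q\<^sup>*(w) Q(z)) \<otimes> I\<^sub>n) H(z)\<close> splits into \<open>n\<close> forms, since \<open>H\<close> consists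
  of \<open>n\<close> interleaved columns.
\<close>

lemma kron_form_eq:
  assumes H: "H \<in> carrier_mat (dim_col Q * n) 1"
  shows "(matpoly_adj_w H * kron (1\<^sub>m (dim_col Q) - matpoly_adj_w Q * matpoly_z Q) (1\<^sub>m n) *
      matpoly_z H) $$ (0, 0) = (\<Sum>b<n. poly_form Q (\<lambda>a. H $$ (a * n + b, 0)))"
proof -
  let ?m = "dim_col Q" and ?l = "dim_row Q"
  let ?G = "1\<^sub>m ?m - matpoly_adj_w Q * matpoly_z Q"
  let ?K = "kron ?G (1\<^sub>m n)"
  let ?h = "\<lambda>a b. H $$ (a * n + b, 0)"
  have G: "dim_row ?G = ?m" "dim_col ?G = ?m"
    by (simp_all add: matpoly_simps)
  have K: "dim_row ?K = ?m * n" "dim_col ?K = ?m * n"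
    by (simp_all add: dim_kron matpoly_simps)
  have Hd: "dim_row H = ?m * n" "dim_col H = 1"
    using H by auto
  have Gij: "?G $$ (a, a') = (if a = a' then 1 else 0) - (\<Sum>r<?l. adj_w (Q $$ (r, a)) * in_z (Q $$ (r, a')))"
    if "a < ?m" "a' < ?m" for a a'
    using that by (simp add: mult_mat_index matpoly_simps del: index_mult_mat(1))
  have KH: "(?K * matpoly_z H) $$ (a * n + b, 0) =
      in_z (?h a b) - (\<Sum>r<?l. adj_w (Q $$ (r, a)) * in_z (\<Sum>a'<?m. Q $$ (r, a') * ?h a' b))"
    if a: "a < ?m" and b: "b < n" for a b
  proof -
    have "(?K * matpoly_z H) $$ (a * n + b, 0) =
        (\<Sum>x<?m * n. ?K $$ (a * n + b, x) * matpoly_z H $$ (x, 0))"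
      using K Hd grid_index_less[OF a b] by (subst mult_mat_index) (simp_all add: matpoly_simps)
    also have "\<dots> = (\<Sum>a'<?m. ?G $$ (a, a') * matpoly_z H $$ (a' * n + b, 0))"
      using kron_one_row[of a ?G b n "\<lambda>x. matpoly_z H $$ (x, 0)"] a b unfolding G by blast
    also have "\<dots> = (\<Sum>a'<?m. (if a' = a then in_z (?h a b) else 0) -
        (\<Sum>r<?l. adj_w (Q $$ (r, a)) * (in_z (Q $$ (r, a')) * in_z (?h a' b))))"
    proof (intro sum.cong refl)
      fix a' assume "a' \<in> {..<?m}"
      then have a': "a' < ?m" by simp
      have "matpoly_z H $$ (a' * n + b, 0) = in_z (?h a' b)"
        using grid_index_less[OF a' b] Hd by (simp add: matpoly_simps)
      then show "?G $$ (a, a') * matpoly_z H $$ (a' * n + b, 0) = (if a' = a then in_z (?h a b) else 0) -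
          (\<Sum>r<?l. adj_w (Q $$ (r, a)) * (in_z (Q $$ (r, a')) * in_z (?h a' b)))"
        unfolding Gij[OF a a'] by (auto simp: left_diff_distrib sum_distrib_right mult.assoc)
    qed
    also have "\<dots> = in_z (?h a b) -
        (\<Sum>a'<?m. \<Sum>r<?l. adj_w (Q $$ (r, a)) * (in_z (Q $$ (r, a')) * in_z (?h a' b)))"
      using a by (simp add: sum_subtractf)
    also have "(\<Sum>a'<?m. \<Sum>r<?l. adj_w (Q $$ (r, a)) * (in_z (Q $$ (r, a')) * in_z (?h a' b))) =
        (\<Sum>r<?l. adj_w (Q $$ (r, a)) * in_z (\<Sum>a'<?m. Q $$ (r, a') * ?h a' b))"
      by (subst sum.swap) (simp add: in_z.hom_sum in_z.hom_mult sum_distrib_left)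
    finally show ?thesis .
  qed
  have "matpoly_adj_w H * ?K * matpoly_z H = matpoly_adj_w H * (?K * matpoly_z H)"
    using K Hd
    by (intro assoc_mult_mat[of _ 1 "?m * n" _ "?m * n" _ 1] carrier_matI) (simp_all only: matpoly_simps)
  then have "(matpoly_adj_w H * ?K * matpoly_z H) $$ (0, 0) =
      (\<Sum>x<?m * n. matpoly_adj_w H $$ (0, x) * (?K * matpoly_z H) $$ (x, 0))"
    using K Hd by (simp add: mult_mat_index matpoly_simps del: index_mult_mat(1))
  also have "\<dots> = (\<Sum>a<?m. \<Sum>b<n. adj_w (?h a b) * (in_z (?h a b) -
      (\<Sum>r<?l. adj_w (Q $$ (r, a)) * in_z (\<Sum>a'<?m. Q $$ (r, a') * ?h a' b))))"
    unfolding sum_grid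
  proof (intro sum.cong refl)
    fix a b assume "a \<in> {..<?m}" "b \<in> {..<n}"
    then have ab: "a < ?m" "b < n" by auto
    have "matpoly_adj_w H $$ (0, a * n + b) = adj_w (?h a b)"
      using grid_index_less[OF ab] Hd by (simp add: matpoly_simps)
    then show "matpoly_adj_w H $$ (0, a * n + b) * (?K * matpoly_z H) $$ (a * n + b, 0) =
        adj_w (?h a b) * (in_z (?h a b) -
          (\<Sum>r<?l. adj_w (Q $$ (r, a)) * in_z (\<Sum>a'<?m. Q $$ (r, a') * ?h a' b)))"
      by (simp only: KH[OF ab])
  qed
  also have "\<dots> = (\<Sum>b<n. \<Sum>a<?m. adj_w (?h a b) * (in_z (?h a b) -
      (\<Sum>r<?l. adj_w (Q $$ (r, a)) * in_z (\<Sum>a'<?m. Q $$ (r, a') * ?h a' b))))"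
    by (rule sum.swap)
  also have "\<dots> = (\<Sum>b<n. poly_form Q (\<lambda>a. ?h a b))"
  proof (intro sum.cong refl)
    fix b
    let ?g = "\<lambda>r. \<Sum>a<?m. Q $$ (r, a) * ?h a b"
    have "(\<Sum>a<?m. \<Sum>r<?l. adj_w (?h a b) * (adj_w (Q $$ (r, a)) * in_z (?g r))) =
        (\<Sum>r<?l. hsq (?g r))"
      by (subst sum.swap, simp only: hsq_def adj_w.hom_sum adj_w.hom_mult sum_distrib_right,
          simp only: mult_ac)
    then show "(\<Sum>a<?m. adj_w (?h a b) * (in_z (?h a b) -
        (\<Sum>r<?l. adj_w (Q $$ (r, a)) * in_z (?g r)))) = poly_form Q (\<lambda>a. ?h a b)"
      by (simp add: poly_form_def right_diff_distrib sum_subtractf sum_distrib_left)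
        (simp add: hsq_def)
  qed
  finally show ?thesis .
qed

lemma archimedean_moduleI:
  assumes "archimedean_condition k m P" and m: "\<And>j. j < k \<Longrightarrow> dim_col (P j) = m j"
  shows "archimedean_module k P"
proof -
  obtain c where c: "0 < c" and rep: "\<And>i. \<exists>n0 n H0 H. H0 \<in> carrier_mat n0 1 \<and>
      (\<forall>j<k. H j \<in> carrier_mat (m j * n j) 1) \<and>
      cpoly_const (of_real (c\<^sup>2)) - cpoly_var (Inl i) * cpoly_var (Inr i) =
        (matpoly_adj_w H0 * matpoly_z H0) $$ (0, 0) +
        (\<Sum>j<k. (matpoly_adj_w (H j) *
            kron (1\<^sub>m (m j) - matpoly_adj_w (P j) * matpoly_z (P j)) (1\<^sub>m (n j)) *
            matpoly_z (H j)) $$ (0, 0))"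
    using assms(1) unfolding archimedean_condition_def by blast
  have "qm_bound k P (cpoly_var i) c" for i
  proof -
    from rep[of i] obtain n0 n H0 H where H0: "H0 \<in> carrier_mat n0 1"
      and H: "\<And>j. j < k \<Longrightarrow> H j \<in> carrier_mat (m j * n j) 1"
      and eq: "cpoly_const (of_real (c\<^sup>2)) - cpoly_var (Inl i) * cpoly_var (Inr i) =
        (matpoly_adj_w H0 * matpoly_z H0) $$ (0, 0) +
        (\<Sum>j<k. (matpoly_adj_w (H j) *
            kron (1\<^sub>m (m j) - matpoly_adj_w (P j) * matpoly_z (P j)) (1\<^sub>m (n j)) *
            matpoly_z (H j)) $$ (0, 0))"
      by blast
    have "(matpoly_adj_w (H j) * kron (1\<^sub>m (m j) - matpoly_adj_w (P j) * matpoly_z (P j)) (1\<^sub>m (n j)) *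
        matpoly_z (H j)) $$ (0, 0) \<in> quad_module k P" if "j < k" for j
      using kron_form_eq[of "H j" "P j" "n j"] H[OF that] m[OF that] that
      by (auto intro!: quad_module_sum quad_module.form)
    then have "cpoly_const (of_real (c\<^sup>2)) - cpoly_var (Inl i) * cpoly_var (Inr i) \<in> quad_module k P"
      unfolding eq by (intro quad_module.add square_in_quad_module[OF H0] quad_module_sum) auto
    then show ?thesis
      using c by (simp add: qm_bound_def hsq_def)
  qed
  then show ?thesis
    unfolding archimedean_module_def by blast
qed

lemma quad_module_decompose:
  assumes "f \<in> quad_module k P"
  shows "\<exists>ss hs. f = (\<Sum>s\<leftarrow>ss. hsq s) + (\<Sum>j<k. \<Sum>h\<leftarrow>hs j. poly_form (P j) h)"
  using assms
proof induction
  case zero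
  show ?case by (rule exI[of _ "[]"], rule exI[of _ "\<lambda>_. []"]) simp
next
  case (add f g)
  then obtain ss hs ss' hs' where
    "f = (\<Sum>s\<leftarrow>ss. hsq s) + (\<Sum>j<k. \<Sum>h\<leftarrow>hs j. poly_form (P j) h)"
    "g = (\<Sum>s\<leftarrow>ss'. hsq s) + (\<Sum>j<k. \<Sum>h\<leftarrow>hs' j. poly_form (P j) h)" by blast
  then show ?case
    by (intro exI[of _ "ss @ ss'"], intro exI[of _ "\<lambda>j. hs j @ hs' j"]) (simp add: sum.distrib)
next
  case (square f)
  show ?case by (rule exI[of _ "[f]"], rule exI[of _ "\<lambda>_. []"]) simp
next
  case (form j h)
  have "(\<Sum>i<k. \<Sum>h\<leftarrow>(if i = j then [h] else []). poly_form (P i) h) =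
      (\<Sum>i<k. if i = j then poly_form (P j) h else 0)"
    by (intro sum.cong) auto
  then show ?case
    using form by (intro exI[of _ "[]"] exI[of _ "\<lambda>i. if i = j then [h] else []"]) simp
qed

text \<open>
  Let \<open>H\<close> be the column of all columns in the certificate and \<open>X = P\<^sub>n\<close>. Moving the
  negative terms to the other side, the certificate equates the Hermitian squares of \<open>(X H, p)\<close>
  with those of \<open>(H, c)\<close> and of the polynomials \<open>ss\<close>. The contraction from the
  former to the latter has a block row for \<open>H\<close>, which is \<open>(K, B)\<close>, and one for \<open>c\<close>, which is
  \<open>(C, D)\<close>; together they form a realization of \<open>c / p\<close> with contractive \<open>K\<close>.
\<close>

lemma determinantal_representation_of_certificate:
  fixes p :: "'d cpoly" and P :: "nat \<Rightarrow> 'd cpoly mat"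
  assumes c: "0 < c" and cert: "hsq p - cpoly_const (of_real (c\<^sup>2)) \<in> quad_module k P"
  shows "\<exists>(q :: 'd cpoly) (n :: nat \<Rightarrow> nat) (K :: complex mat).
    K \<in> carrier_mat (\<Sum>i<k. dim_col (P i) * n i) (\<Sum>i<k. dim_row (P i) * n i) \<and>
    spectral_norm K \<le> 1 \<and>
    p * q = Determinant.det
      (1\<^sub>m (\<Sum>i<k. dim_col (P i) * n i) - map_mat cpoly_const K * amplified_sum k n P)"
proof -
  obtain ss hs where rep: "hsq p - cpoly_const (of_real (c\<^sup>2)) =
      (\<Sum>s\<leftarrow>ss. hsq s) + (\<Sum>j<k. \<Sum>h\<leftarrow>hs j. poly_form (P j) h)"
    using quad_module_decompose[OF cert] by blast
  define n where "n j = length (hs j)" for j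
  let ?m = "\<lambda>i. dim_col (P i)" and ?l = "\<lambda>i. dim_row (P i)"
  define M where "M = (\<Sum>i<k. ?m i * n i)"
  define L where "L = (\<Sum>i<k. ?l i * n i)"
  define X where "X = amplified_sum k n P"
  have X: "X \<in> carrier_mat L M"
    by (intro carrier_matI) (simp_all only: X_def L_def M_def dim_amplified_sum)
  obtain H where H: "\<And>j x. j < k \<Longrightarrow> x < ?m j * n j \<Longrightarrow>
      H ((\<Sum>i<j. ?m i * n i) + x) = (hs j ! (x mod n j)) (x div n j)"
    using block_function_exists[of k "\<lambda>i. ?m i * n i" "\<lambda>j x. (hs j ! (x mod n j)) (x div n j)"] by blast
  have Hab: "H ((\<Sum>i<j. ?m i * n i) + (a * n j + b)) = (hs j ! b) a"
    if "j < k" "a < ?m j" "b < n j" for j a b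
    using H[OF that(1) grid_index_less[OF that(2,3)]] that(3) by simp
  define XH where "XH s = (\<Sum>x<M. X $$ (s, x) * H x)" for s
  have XHab: "XH ((\<Sum>i<j. ?l i * n i) + (r * n j + b)) = (\<Sum>a<?m j. P j $$ (r, a) * (hs j ! b) a)"
    if "j < k" "r < ?l j" "b < n j" for j r b
    unfolding XH_def X_def M_def amplified_sum_row[where P = P and n = n, OF that] using that by (simp add: Hab)
  have sumH: "(\<Sum>x<M. hsq (H x)) = (\<Sum>j<k. \<Sum>b<n j. \<Sum>a<?m j. hsq ((hs j ! b) a))"
  proof -
    have "(\<Sum>x<M. hsq (H x)) = (\<Sum>j<k. \<Sum>a<?m j. \<Sum>b<n j. hsq (H ((\<Sum>i<j. ?m i * n i) + (a * n j + b))))"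
      unfolding M_def sum_blocks sum_grid ..
    also have "\<dots> = (\<Sum>j<k. \<Sum>a<?m j. \<Sum>b<n j. hsq ((hs j ! b) a))"
      by (intro sum.cong refl) (simp add: Hab)
    also have "\<dots> = (\<Sum>j<k. \<Sum>b<n j. \<Sum>a<?m j. hsq ((hs j ! b) a))"
      by (intro sum.cong refl sum.swap)
    finally show ?thesis .
  qed
  have sumXH: "(\<Sum>s<L. hsq (XH s)) =
      (\<Sum>j<k. \<Sum>b<n j. \<Sum>r<?l j. hsq (\<Sum>a<?m j. P j $$ (r, a) * (hs j ! b) a))"
  proof -
    have "(\<Sum>s<L. hsq (XH s)) = (\<Sum>j<k. \<Sum>r<?l j. \<Sum>b<n j. hsq (XH ((\<Sum>i<j. ?l i * n i) + (r * n j + b))))"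
      unfolding L_def sum_blocks sum_grid ..
    also have "\<dots> = (\<Sum>j<k. \<Sum>r<?l j. \<Sum>b<n j. hsq (\<Sum>a<?m j. P j $$ (r, a) * (hs j ! b) a))"
      by (intro sum.cong refl) (simp add: XHab)
    also have "\<dots> = (\<Sum>j<k. \<Sum>b<n j. \<Sum>r<?l j. hsq (\<Sum>a<?m j. P j $$ (r, a) * (hs j ! b) a))"
      by (intro sum.cong refl sum.swap)
    finally show ?thesis .
  qed
  define N where "N = length ss"
  define u where "u a = (if a < L then XH a else p)" for a
  \<comment> \<open>The first \<open>M + 1\<close> rows of the contraction will give the realization; those belonging to \<open>ss\<close> are
    dropped, which keeps it contractive.\<close>
  define v where "v b = (if b < M then H b else if b = M then cpoly_const (of_real c) else ss ! (b - Suc M))" for b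
  have "(\<Sum>j<k. \<Sum>h\<leftarrow>hs j. poly_form (P j) h) = (\<Sum>x<M. hsq (H x)) - (\<Sum>s<L. hsq (XH s))"
    unfolding sumH sumXH sum_list_sum_nth
    by (simp add: n_def atLeast0LessThan poly_form_def sum_subtractf)
  moreover have "(\<Sum>s\<leftarrow>ss. hsq s) = (\<Sum>i<N. hsq (ss ! i))"
    by (simp add: sum_list_sum_nth N_def atLeast0LessThan)
  ultimately have "(\<Sum>s<L. hsq (XH s)) + hsq p =
      (\<Sum>x<M. hsq (H x)) + cpoly_const (of_real (c\<^sup>2)) + (\<Sum>i<N. hsq (ss ! i))"
    using rep by (simp add: algebra_simps)
  moreover have "(\<Sum>a<Suc L. hsq (u a)) = (\<Sum>s<L. hsq (XH s)) + hsq p"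
    by (simp add: u_def)
  moreover have "(\<Sum>b<Suc M + N. hsq (v b)) = (\<Sum>b<Suc M. hsq (v b)) + (\<Sum>i<N. hsq (v (Suc M + i)))"
    by (rule sum_lessThan_add)
  moreover have "(\<Sum>b<Suc M. hsq (v b)) = (\<Sum>x<M. hsq (H x)) + cpoly_const (of_real (c\<^sup>2))"
    using c by (simp add: v_def hsq_const)
  moreover have "(\<Sum>i<N. hsq (v (Suc M + i))) = (\<Sum>i<N. hsq (ss ! i))"
    by (simp add: v_def)
  ultimately have "(\<Sum>a<Suc L. hsq (u a)) = (\<Sum>b<Suc M + N. hsq (v b))"
    by simp
  from lurking_contraction[OF this] obtain V where
    V: "\<And>b. b < Suc M + N \<Longrightarrow> v b = (\<Sum>a<Suc L. cpoly_const (V b a) * u a)"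
    and contr: "\<And>x. (\<Sum>b<Suc M + N. (cmod (\<Sum>a<Suc L. V b a * x a))\<^sup>2) \<le> (\<Sum>a<Suc L. (cmod (x a))\<^sup>2)"
    by blast
  define K where "K = mat M L (\<lambda>(i, j). V i j)"
  have K: "K \<in> carrier_mat M L"
    by (simp add: K_def)
  have norm: "spectral_norm K \<le> 1"
  proof (rule spectral_norm_le_1)
    fix y :: "nat \<Rightarrow> complex"
    \<comment> \<open>Restricting to vectors that vanish in the coordinate of \<open>p\<close> drops the column \<open>B\<close>.\<close>
    let ?x = "\<lambda>a. if a < L then y a else 0"
    have "(\<Sum>i<M. (cmod (\<Sum>a<L. V i a * y a))\<^sup>2) = (\<Sum>i<M. (cmod (\<Sum>a<Suc L. V i a * ?x a))\<^sup>2)"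
      by simp
    also have "\<dots> \<le> (\<Sum>i<Suc M + N. (cmod (\<Sum>a<Suc L. V i a * ?x a))\<^sup>2)"
      by (intro sum_mono2) auto
    also have "\<dots> \<le> (\<Sum>a<Suc L. (cmod (?x a))\<^sup>2)"
      by (rule contr)
    finally show "(\<Sum>i<dim_row K. (cmod (\<Sum>a<dim_col K. K $$ (i, a) * y a))\<^sup>2) \<le>
        (\<Sum>a<dim_col K. (cmod (y a))\<^sup>2)"
      by (simp add: K_def)
  qed
  have "\<exists>q. p * q = cpoly_const (of_real c) * Determinant.det (1\<^sub>m M - map_mat cpoly_const K * X)"
  proof (rule det_of_realization[OF X])
    show "map_mat cpoly_const K \<in> carrier_mat M L"
      using K by simp
    show "H i = (\<Sum>s<L. map_mat cpoly_const K $$ (i, s) * (\<Sum>x<M. X $$ (s, x) * H x)) +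
        cpoly_const (V i L) * p" if "i < M" for i
      using V[of i] that by (simp add: v_def u_def K_def XH_def)
    show "cpoly_const (of_real c) = (\<Sum>s<L. cpoly_const (V M s) * (\<Sum>x<M. X $$ (s, x) * H x)) +
        cpoly_const (V M L) * p"
      using V[of M] by (simp add: v_def u_def XH_def)
  qed
  then obtain q where q: "p * q = cpoly_const (of_real c) * Determinant.det (1\<^sub>m M - map_mat cpoly_const K * X)"
    by blast
  have "cpoly_const (of_real (1 / c)) * cpoly_const (of_real c) =
      (cpoly_const (of_real (1 / c * c)) :: 'd cpoly)"
    by (simp only: cpoly_const.hom_mult of_real_mult)
  then have inverse: "cpoly_const (of_real (1 / c)) * cpoly_const (of_real c) = (1 :: 'd cpoly)"
    using c by simp
  have "p * (cpoly_const (of_real (1 / c)) * q) = cpoly_const (of_real (1 / c)) * (p * q)"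
    by (rule mult.left_commute)
  also have "\<dots> = (cpoly_const (of_real (1 / c)) * cpoly_const (of_real c)) *
      Determinant.det (1\<^sub>m M - map_mat cpoly_const K * X)"
    by (simp only: q mult.assoc)
  also have "\<dots> = Determinant.det (1\<^sub>m M - map_mat cpoly_const K * X)"
    by (simp only: inverse mult_1_left)
  finally have "p * (cpoly_const (of_real (1 / c)) * q) =
      Determinant.det (1\<^sub>m M - map_mat cpoly_const K * X)" .
  then show ?thesis
    using K norm unfolding M_def L_def X_def by blast
qed

theorem theorem4p1:
  fixes k :: nat
    and l m :: "nat \<Rightarrow> nat"
    and P :: "nat \<Rightarrow> 'd :: {finite, linorder} cpoly mat"
    and p :: "'d cpoly"
  assumes universe: "(UNIV :: real set) \<lesssim> (UNIV :: 'h set)"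
    and size: "\<And>i. i < k \<Longrightarrow> P i \<in> carrier_mat (l i) (m i)"
    and approx: "approximation_condition TYPE('h) (mat_direct_sum k P)"
    and archimedean: "archimedean_condition k m P"
    and stable: "strongly_stable p (poly_domain (mat_direct_sum k P))"
  shows "\<exists>(q :: 'd cpoly) (n :: nat \<Rightarrow> nat) (K :: complex mat).
    K \<in> carrier_mat (\<Sum>i<k. m i * n i) (\<Sum>i<k. l i * n i) \<and>
    spectral_norm K \<le> 1 \<and>
    p * q = Determinant.det
      (1\<^sub>m (\<Sum>i<k. m i * n i) - map_mat cpoly_const K * amplified_sum k n P)"
proof -
  obtain e :: "complex \<Rightarrow> 'h" where "inj e"
    using lepoll_trans[OF complex_lepoll_real universe] by (auto simp: lepoll_def)
  then interpret scalar_line e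
    by unfold_locales
  have dims: "dim_row (P i) = l i" "dim_col (P i) = m i" if "i < k" for i
    using size[OF that] by auto
  have arch: "archimedean_module k P"
    using archimedean dims by (intro archimedean_moduleI)
  have "cpoly_eval p z \<noteq> 0" if "\<And>f. cmod (cpoly_eval f z) \<le> qm_norm k P f" for z
  proof -
    have "spectral_norm (matpoly_eval (mat_direct_sum k P) z) \<le> 1"
      by (intro spectral_norm_matpoly_eval_le_1 evaluation_contractive[OF that])
    then have "z \<in> closure (poly_domain (mat_direct_sum k P))"
      by (rule closure_poly_domain[OF approx])
    then show ?thesis
      using stable by (simp add: strongly_stable_def)
  qed
  then obtain c where c: "0 < c" "hsq p - cpoly_const (of_real (c\<^sup>2)) \<in> quad_module k P"
    using hsq_bounded_below[OF arch] by metis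
  have "(\<Sum>i<k. dim_col (P i) * n i) = (\<Sum>i<k. m i * n i)"
    "(\<Sum>i<k. dim_row (P i) * n i) = (\<Sum>i<k. l i * n i)" for n
    by (simp_all add: dims)
  then show ?thesis
    using determinantal_representation_of_certificate[OF c] by simp
qed

end
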